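(* Let $n\ge1$ and consider the system in $\mathbb R^n$ $$y'(t)+Ay(t)=F(y(t))+f(t).\qquad(\ast)$$ Assume: (1) $A$ is a real $n\times n$ matrix all of whose eigenvalues have positive real parts. (2) $F:\mathbb R^n\to\mathbb R^n$ is locally Lipschitz, $F(0)=0$, and either (H1) there are numbers $\beta_k\in(1,\infty)$, $k\in\mathbb N$, increasing strictly to infinity, and $F_k\in\mathcal H_{\beta_k}(\mathbb R^n)\cap C^\infty(\mathbb R^n\setminus\{0\})$ such that for every $N\in\mathbb N$, $|F(x)-\sum_{k=1}^NF_k(x)|=\mathcal O(|x|^\beta)$ as $x\to0$ for some $\beta>\beta_N$; or (H2) there are $N_*\in\mathbb N$, strictly increasing $\beta_1,\dots,\beta_{N_*}\in(1,\infty)$ and $F_k\in\mathcal H_{\beta_k}(\mathbb R^n)\cap C^\infty(\mathbb R^n\setminus\{0\})$, $1\le k\le N_*$, such that $|F(x)-\sum_{k=1}^{N_*}F_k(x)|=\mathcal O(|x|^\beta)$ as $x\to0$ for all $\beta>\beta_{N_*}$. (3) $m_*\in\mathbb Z_+$ is given, and $f\in C([T,\infty),\mathbb R^n)$ for some $T\ge0$ satisfies either (f1) there are a strictly increasing, divergent sequence $(\gamma_k)_{k\ge1}$ of positive numbers, integers $\widetilde n_k\in\mathbb N\cap[m_*,\infty)$ and $g_k\in\mathcal P^1_{m_*}(\widetilde n_k,\mathbb R^n)$, $k\in\mathbb N$, such that for every $N\in\mathbb N$ there is $\mu>\gamma_N$ with $|f(t)-\sum_{k=1}^Ng_k(\widehat{\mathcal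 L}_{\widetilde n_k}(t))L_{m_*}(t)^{-\gamma_k}|=\mathcal O(L_{m_*}(t)^{-\mu})$; or (f2) there are $K\in\mathbb N$, positive numbers $\gamma_1<\dots<\gamma_K$, an integer $n_*\in\mathbb N\cap[m_*,\infty)$ and $g_k\in\mathcal P^1_{m_*}(n_*,\mathbb R^n)$, $1\le k\le K$, such that $|f(t)-\sum_{k=1}^Kg_k(\widehat{\mathcal L}_{n_*}(t))L_{m_*}(t)^{-\gamma_k}|=\mathcal O(L_{m_*}(t)^{-\mu})$ for all $\mu>\gamma_K$. (4) There are $g_0\in\mathcal P^+_{m_*}(n_1)$ and $\xi_0\in\mathbb R^n\setminus\{0\}$ with $g_1(z)=g_0(z)\xi_0$, where $n_1=\widetilde n_1$ in case (f1) and $n_1=n_*$ in case (f2). Then there exist a divergent, strictly increasing sequence $(\mu_k)_{k=1}^\infty\subset(0,\infty)$, an increasing (i.e. nondecreasing) sequence $(n_k)_{k=0}^\infty\subset\mathbb Z_+\cap[m_*,\infty)$, a function $\zeta_\bullet\in\mathcal P^+_{m_*}(n_0)$, and functions $h_k\in\widehat{\mathcal P}^1_{m_*}(n_k,\mathbb R^n)$ for all $k\in\mathbb N$ (here $(n_k)_{k\ge 0}$ is part of the conclusion and its $n_1$ need not equal the integer $n_1$ in (4)), such that every solution $y\in C^1([T_0,\infty),\mathbb R^n)$ of $(\ast)$ on $(T_0,\infty)$ (for some $T_0>0$, $T_0\ge T$) with $\lim_{t\to\infty}y(t)=0$ admits the asymptotic expansion $$y(t)\sim\sum_{k=1}^\infty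 h_k\big(\widehat{\mathcal L}_{n_k}(t),\zeta_\bullet(\widehat{\mathcal L}_{n_0}(t))\big)L_{m_*}(t)^{-\mu_k},$$ meaning: for each $N\in\mathbb N$ there is $\mu>\mu_N$ such that $$\Big|y(t)-\sum_{k=1}^Nh_k\big(\widehat{\mathcal L}_{n_k}(t),\zeta_\bullet(\widehat{\mathcal L}_{n_0}(t))\big)L_{m_*}(t)^{-\mu_k}\Big|=\mathcal O(L_{m_*}(t)^{-\mu})\quad\text{as }t\to\infty.$$
   Context: Conventions: $\mathbb N=\{1,2,\dots\}$, $\mathbb Z_+=\mathbb N\cup\{0\}$; $|\cdot|$ is the Euclidean norm; $\mathcal O(\cdot)$ in $t$ means as $t\to\infty$. $\mathcal H_\beta(\mathbb R^n)$ is the set of $G:\mathbb R^n\to\mathbb R^n$ with $G(tx)=t^\beta G(x)$ for all $x\in\mathbb R^n$, $t>0$. Iterated functions: $E_0(t)=t$, $E_{m+1}(t)=e^{E_m(t)}$; $L_{-1}(t)=e^t$, $L_0(t)=t$, $L_{m+1}(t)=\ln L_m(t)$ for $t>E_m(0)$, $m\in\mathbb Z_+$. $\widehat{\mathcal L}_k(t)=(L_{-1}(t),L_0(t),\dots,L_k(t))$. For $z=(z_{-1},z_0,\dots,z_k)\in(0,\infty)^{k+2}$ and $\alpha=(\alpha_{-1},\dots,\alpha_k)\in\mathbb R^{k+2}$, $z^\alpha=\prod_{j=-1}^kz_j^{\alpha_j}$. $\mathcal E_{\mathbb R}(m,k,0)$ is the set of $\alpha\in\mathbb R^{k+2}$ with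 $\alpha_{-1}=\dots=\alpha_m=0$. Let $X$ be a real linear space and $k\ge m\ge0$ integers. $\widehat{\mathcal P}^1_m(k,X)$ is the set of functions $p(z,\zeta)$ on $(0,\infty)^{k+2}\times(0,\infty)$ that are finite sums of functions $$(z,\zeta)\mapsto z^\alpha\zeta^\beta\prod_{j=0}^k\sigma_j(\omega_jz_j)\,\xi,$$ with $\xi\in X$, $\alpha\in\mathcal E_{\mathbb R}(m,k,0)$, $\beta\in\mathbb R$, $\omega_j\in\mathbb R$, and each $\sigma_j$ either cosine or sine. $\mathcal P^1_m(k,X)$ is defined in the same way with $\zeta$ and $\beta$ omitted (functions of $z$ only). $\mathcal P_m^+(k)$ is the set of $p\in\mathcal P^1_m(k,\mathbb R)$ of the form $p(z)=c_{\max}z^{\alpha_{\max}}+q(z)$ with $\alpha_{\max}\in\mathcal E_{\mathbb R}(m,k,0)$, $c_{\max}>0$, and $q$ a finite sum of functions $z\mapsto z^\alpha\prod_{j=0}^k\sigma_j(\omega_jz_j)\,\xi$, where $\xi\in\mathbb R$, $\alpha\in\mathcal E_{\mathbb R}(m,k,0)$, $\omega_j\in\mathbb R$, each $\sigma_j$ is either cosine or sine, and in every term $\alpha<\alpha_{\max}$ in the lexicographic order and $\omega_0=0$. For such $p$ one has $p(\widehat{\mathcal L}_k(t))>0$ for all sufficiently large $t$. *)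

theory Defs
  imports "HOL-Analysis.Analysis" "HOL-Library.Landau_Symbols"
begin

text \<open>Sequences indexed by the positive integers are functions on \<^typ>\<open>nat\<close> whose value at \<open>0\<close>
  is never used; tuples \<open>(z_{-1}, z_0, ..., z_k)\<close> are functions on \<^typ>\<open>int\<close> that are extensional
  on \<open>{-1..k}\<close>.\<close>

definition complex_eigenvalue :: "real^'n^'n \<Rightarrow> complex \<Rightarrow> bool" where
  "complex_eigenvalue A l \<longleftrightarrow>
     (\<exists>v::complex^'n. v \<noteq> 0 \<and> (\<chi> i j. complex_of_real (A $ i $ j)) *v v = l *s v)"

definition locally_lipschitz :: "('a::metric_space \<Rightarrow> 'b::metric_space) \<Rightarrow> bool" where
  "locally_lipschitz F \<longleftrightarrow> (\<forall>x. \<exists>u>0. \<exists>C. C-lipschitz_on (cball x u) F)"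

definition pos_homogeneous :: "real \<Rightarrow> ('a::real_vector \<Rightarrow> 'b::real_vector) set" where
  "pos_homogeneous \<beta> = {G. \<forall>x. \<forall>t>0. G (t *\<^sub>R x) = (t powr \<beta>) *\<^sub>R G x}"

text \<open>\<open>k\<close> times continuously differentiable, meant for open \<open>S\<close> and finite-dimensional domains:
  \<open>f\<close> is differentiable and each of its directional derivatives is \<open>k - 1\<close> times
  continuously differentiable.\<close>

primrec Ck_on ::
    "nat \<Rightarrow> 'a::euclidean_space set \<Rightarrow> ('a \<Rightarrow> 'b::real_normed_vector) \<Rightarrow> bool" where
  "Ck_on 0 S f \<longleftrightarrow> continuous_on S f"
| "Ck_on (Suc k) S f \<longleftrightarrow>
     (\<forall>x\<in>S. f differentiable (at x)) \<and>
     (\<forall>v. Ck_on k S (\<lambda>x. frechet_derivative f (at x) v))"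

definition smooth_on ::
    "'a::euclidean_space set \<Rightarrow> ('a \<Rightarrow> 'b::real_normed_vector) \<Rightarrow> bool" where
  "smooth_on S f \<longleftrightarrow> (\<forall>k. Ck_on k S f)"

text \<open>At the left end point \<open>a\<close> the derivative is one-sided.\<close>

definition C1_on_atLeast :: "real \<Rightarrow> (real \<Rightarrow> 'a::real_normed_vector) \<Rightarrow> bool" where
  "C1_on_atLeast a y \<longleftrightarrow>
     (\<exists>D. continuous_on {a..} D \<and>
          (\<forall>t\<ge>a. (y has_vector_derivative D t) (at t within {a..})))"

text \<open>The iterated logarithms; the values at those small \<open>t\<close> for which the iterate is not
  defined mathematically are irrelevant, since only \<open>t \<rightarrow> \<infinity>\<close> matters.\<close>

definition iter_log :: "int \<Rightarrow> real \<Rightarrow> real" where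
  "iter_log j t = (if j = -1 then exp t else (ln ^^ nat j) t)"

definition log_tuple :: "nat \<Rightarrow> real \<Rightarrow> int \<Rightarrow> real" where
  "log_tuple k t = (\<lambda>j\<in>{-1..int k}. iter_log j t)"

definition pos_tuples :: "nat \<Rightarrow> (int \<Rightarrow> real) set" where
  "pos_tuples k = {-1..int k} \<rightarrow>\<^sub>E {0<..}"

definition exponents :: "nat \<Rightarrow> nat \<Rightarrow> (int \<Rightarrow> real) set" where
  "exponents m k = {\<alpha> \<in> {-1..int k} \<rightarrow>\<^sub>E UNIV. \<forall>j\<in>{-1..int m}. \<alpha> j = 0}"

definition tuple_powr :: "nat \<Rightarrow> (int \<Rightarrow> real) \<Rightarrow> (int \<Rightarrow> real) \<Rightarrow> real" where
  "tuple_powr k z \<alpha> = (\<Prod>j\<in>{-1..int k}. z j powr \<alpha> j)"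

definition lex_less :: "nat \<Rightarrow> (int \<Rightarrow> real) \<Rightarrow> (int \<Rightarrow> real) \<Rightarrow> bool" where
  "lex_less k \<alpha> \<alpha>' \<longleftrightarrow>
     (\<exists>j\<in>{-1..int k}. \<alpha> j < \<alpha>' j \<and> (\<forall>i\<in>{-1..<j}. \<alpha> i = \<alpha>' i))"

definition trig_prod ::
    "nat \<Rightarrow> (int \<Rightarrow> real \<Rightarrow> real) \<Rightarrow> (int \<Rightarrow> real) \<Rightarrow> (int \<Rightarrow> real) \<Rightarrow> real" where
  "trig_prod k \<sigma> \<omega> z = (\<Prod>j\<in>{0..int k}. \<sigma> j (\<omega> j * z j))"

definition trig_choice :: "nat \<Rightarrow> (int \<Rightarrow> real \<Rightarrow> real) \<Rightarrow> bool" where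
  "trig_choice k \<sigma> \<longleftrightarrow> (\<forall>j\<in>{0..int k}. \<sigma> j = cos \<or> \<sigma> j = sin)"

text \<open>The classes \<open>\<P>^1_m(k,X)\<close> (\<open>P1\<close>), its variant with the extra variable \<open>\<zeta>\<close> (\<open>P1hat\<close>) and
  \<open>\<P>_m^+(k)\<close> (\<open>Pplus\<close>). Members are constrained only on the domain \<open>pos_tuples k\<close>
  (and \<open>\<zeta> > 0\<close>).\<close>

definition P1 :: "nat \<Rightarrow> nat \<Rightarrow> ((int \<Rightarrow> real) \<Rightarrow> 'x::real_vector) set" where
  "P1 m k = {p. \<exists>(M::nat) \<alpha> \<sigma> \<omega> \<xi>.
     (\<forall>i<M. \<alpha> i \<in> exponents m k \<and> trig_choice k (\<sigma> i)) \<and>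
     (\<forall>z\<in>pos_tuples k.
        p z = (\<Sum>i<M. (tuple_powr k z (\<alpha> i) * trig_prod k (\<sigma> i) (\<omega> i) z) *\<^sub>R \<xi> i))}"

definition P1hat :: "nat \<Rightarrow> nat \<Rightarrow> ((int \<Rightarrow> real) \<Rightarrow> real \<Rightarrow> 'x::real_vector) set" where
  "P1hat m k = {p. \<exists>(M::nat) \<alpha> \<beta> \<sigma> \<omega> \<xi>.
     (\<forall>i<M. \<alpha> i \<in> exponents m k \<and> trig_choice k (\<sigma> i)) \<and>
     (\<forall>z\<in>pos_tuples k. \<forall>\<zeta>>0.
        p z \<zeta> = (\<Sum>i<M. (tuple_powr k z (\<alpha> i) * \<zeta> powr \<beta> i
                            * trig_prod k (\<sigma> i) (\<omega> i) z) *\<^sub>R \<xi> i))}"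

definition Pplus :: "nat \<Rightarrow> nat \<Rightarrow> ((int \<Rightarrow> real) \<Rightarrow> real) set" where
  "Pplus m k = {p \<in> P1 m k. \<exists>\<alpha>max c (M::nat) \<alpha> \<sigma> \<omega> \<xi>.
     \<alpha>max \<in> exponents m k \<and> c > 0 \<and>
     (\<forall>i<M. \<alpha> i \<in> exponents m k \<and> trig_choice k (\<sigma> i) \<and>
            lex_less k (\<alpha> i) \<alpha>max \<and> \<omega> i 0 = 0) \<and>
     (\<forall>z\<in>pos_tuples k.
        p z = c * tuple_powr k z \<alpha>max +
              (\<Sum>i<M. tuple_powr k z (\<alpha> i) * trig_prod k (\<sigma> i) (\<omega> i) z * \<xi> i))}"

text \<open>The order of the remainder of \<open>u\<close> after the first \<open>N\<close> terms \<open>v k t L_m(t)^(-\<gamma> k)\<close>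
  is at most \<open>L_m(t)^(-\<mu>)\<close>.\<close>

definition remainder_bound ::
    "nat \<Rightarrow> (real \<Rightarrow> 'a::real_normed_vector) \<Rightarrow> (nat \<Rightarrow> real \<Rightarrow> 'a) \<Rightarrow> (nat \<Rightarrow> real)
       \<Rightarrow> nat \<Rightarrow> real \<Rightarrow> bool" where
  "remainder_bound m u v \<gamma> N \<mu> \<longleftrightarrow>
     (\<lambda>t. norm (u t - (\<Sum>k=1..N. (iter_log (int m) t powr (- \<gamma> k)) *\<^sub>R v k t)))
       \<in> O[at_top](\<lambda>t. iter_log (int m) t powr (- \<mu>))"

definition asymp_expansion ::
    "nat \<Rightarrow> (real \<Rightarrow> 'a::real_normed_vector) \<Rightarrow> (nat \<Rightarrow> real \<Rightarrow> 'a) \<Rightarrow> (nat \<Rightarrow> real) \<Rightarrow> bool"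
  where
  "asymp_expansion m u v \<gamma> \<longleftrightarrow> (\<forall>N\<ge>1. \<exists>\<mu>>\<gamma> N. remainder_bound m u v \<gamma> N \<mu>)"

definition nonlin_H1 :: "('a::euclidean_space \<Rightarrow> 'a) \<Rightarrow> bool" where
  "nonlin_H1 F \<longleftrightarrow> (\<exists>(\<beta>::nat \<Rightarrow> real) Fk.
     (\<forall>k\<ge>1. \<beta> k > 1) \<and> strict_mono_on {1..} \<beta> \<and> filterlim \<beta> at_top sequentially \<and>
     (\<forall>k\<ge>1. Fk k \<in> pos_homogeneous (\<beta> k) \<and> smooth_on (- {0}) (Fk k)) \<and>
     (\<forall>N\<ge>1. \<exists>b>\<beta> N.
        (\<lambda>x. norm (F x - (\<Sum>k=1..N. Fk k x))) \<in> O[at 0](\<lambda>x. norm x powr b)))"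

definition nonlin_H2 :: "('a::euclidean_space \<Rightarrow> 'a) \<Rightarrow> bool" where
  "nonlin_H2 F \<longleftrightarrow> (\<exists>(N::nat) (\<beta>::nat \<Rightarrow> real) Fk.
     N \<ge> 1 \<and> (\<forall>k\<in>{1..N}. \<beta> k > 1) \<and> strict_mono_on {1..N} \<beta> \<and>
     (\<forall>k\<in>{1..N}. Fk k \<in> pos_homogeneous (\<beta> k) \<and> smooth_on (- {0}) (Fk k)) \<and>
     (\<forall>b>\<beta> N.
        (\<lambda>x. norm (F x - (\<Sum>k=1..N. Fk k x))) \<in> O[at 0](\<lambda>x. norm x powr b)))"

definition forcing_f1 ::
    "nat \<Rightarrow> (real \<Rightarrow> 'a::real_normed_vector) \<Rightarrow> (nat \<Rightarrow> real) \<Rightarrow> (nat \<Rightarrow> nat)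
       \<Rightarrow> (nat \<Rightarrow> (int \<Rightarrow> real) \<Rightarrow> 'a) \<Rightarrow> bool" where
  "forcing_f1 m f \<gamma> nt g \<longleftrightarrow>
     (\<forall>k\<ge>1. \<gamma> k > 0) \<and> strict_mono_on {1..} \<gamma> \<and> filterlim \<gamma> at_top sequentially \<and>
     (\<forall>k\<ge>1. nt k \<ge> 1 \<and> nt k \<ge> m \<and> g k \<in> P1 m (nt k)) \<and>
     asymp_expansion m f (\<lambda>k t. g k (log_tuple (nt k) t)) \<gamma>"

definition forcing_f2 ::
    "nat \<Rightarrow> (real \<Rightarrow> 'a::real_normed_vector) \<Rightarrow> nat \<Rightarrow> (nat \<Rightarrow> real) \<Rightarrow> nat
       \<Rightarrow> (nat \<Rightarrow> (int \<Rightarrow> real) \<Rightarrow> 'a) \<Rightarrow> bool" where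
  "forcing_f2 m f K \<gamma> n g \<longleftrightarrow>
     K \<ge> 1 \<and> (\<forall>k\<in>{1..K}. \<gamma> k > 0) \<and> strict_mono_on {1..K} \<gamma> \<and>
     n \<ge> 1 \<and> n \<ge> m \<and> (\<forall>k\<in>{1..K}. g k \<in> P1 m n) \<and>
     (\<forall>\<mu>>\<gamma> K. remainder_bound m f (\<lambda>k t. g k (log_tuple n t)) \<gamma> K \<mu>)"

text \<open>\<open>y\<close> is a \<open>C^1\<close> function on \<open>[T0,\<infinity>)\<close> that solves the system on \<open>(T0,\<infinity>)\<close>.\<close>

definition solves_system ::
    "real^'n^'n \<Rightarrow> (real^'n \<Rightarrow> real^'n) \<Rightarrow> (real \<Rightarrow> real^'n) \<Rightarrow> real \<Rightarrow> (real \<Rightarrow> real^'n) \<Rightarrow> bool"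
  where
  "solves_system A F f T0 y \<longleftrightarrow>
     C1_on_atLeast T0 y \<and>
     (\<forall>t>T0. vector_derivative y (at t) + A *v y t = F (y t) + f t)"

end

theory Submission
  imports Defs "HOL-Computational_Algebra.Fundamental_Theorem_Algebra"
begin

text \<open>Write \<open>L = L_{m_*}(t)\<close>, \<open>\<zeta> = g_0\<close> (evaluated at the iterated logarithms) and \<open>A x_0 = \<xi>_0\<close>. The
  solution is governed by \<open>P x_0\<close> with \<open>P = L^(-\<gamma>_1) \<zeta>\<close>, so that \<open>y = P (x_0 + H)\<close> with \<open>H \<rightarrow> 0\<close>; homogeneity
  gives \<open>F_k(y) = P^(\<beta>_k) F_k(x_0 + H)\<close>, and \<open>F_k\<close> may be replaced by its Taylor polynomials at \<open>x_0 \<noteq> 0\<close>.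
  The functions that are finite sums of admissible monomials form an algebra filtered by the
  power of \<open>1 / L\<close>, on which \<open>w' + A w = r\<close> is solvable up to one order: only the oscillation in
  \<open>z_0 = t\<close> is differentiated to leading order. Iterating this produces, independently of any solution,
  functions \<open>S_j\<close> that satisfy the equation up to order \<open>\<gamma>_1 + j \<delta>\<close>. Since \<open>F\<close> has a small Lipschitz constant
  near the origin up to errors of high order, the difference between \<open>S_j\<close> and a decaying solution is
  controlled by a differential inequality for a quadratic Lyapunov form of \<open>A\<close>.\<close>

subsection \<open>A Lyapunov form for a matrix with spectrum in the right half plane\<close>

text \<open>Nothing is assumed about the Jordan structure of A, so the Lyapunov form is built from
  an annihilating product of factors M - l with l an eigenvalue. Its coercivity serves twice: for
  the decay estimate, and for solving the systems of cosine and sine coefficients, whose case of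
  frequency 0 gives x_0. The step \<delta> is the least of three gains: 1 from differentiating an
  amplitude, \<gamma>_1 (\<beta>_1 - 1) from the nonlinearity, and the gap between the first two
  orders of the forcing. The later logarithms and the powers of \<zeta> are invisible on the scale
  of powers of L: they cost an arbitrarily small exponent, so bounds are drawn from the grading with
  strict loss. Small Lipschitz constants come from the homogeneous partial sums of F only; the rest
  of F is merely small, of order |y|^\<beta>_N, and this helps only after an a priori decay rate of
  y has been extracted from y \<rightarrow> 0.\<close>

definition cshift :: "complex^'n^'n \<Rightarrow> complex \<Rightarrow> complex^'n \<Rightarrow> complex^'n" where
  "cshift M l x = M *v x - l *s x"

text \<open>The product of the factors M - l over a list. A list is kept instead of a polynomial
  because the Lyapunov form is built by recursion over the factors.\<close>

primrec kill :: "complex^'n^'n \<Rightarrow> complex list \<Rightarrow> complex^'n \<Rightarrow> complex^'n" where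
  "kill M [] x = x"
| "kill M (l # ls) x = kill M ls (cshift M l x)"

lemma cshift_add: "cshift M l (x + y) = cshift M l x + cshift M l y"
  by (simp add: cshift_def matrix_vector_right_distrib vec.scale_right_distrib)

lemma cshift_scale: "cshift M l (c *s x) = c *s cshift M l x"
  by (simp add: cshift_def vec.scale vec.scale_right_diff_distrib vec.scale_left_commute)

lemma cshift_mult_vec: "cshift M l (M *v x) = M *v cshift M l x"
  by (simp add: cshift_def vec.scale vec.diff)

lemma cshift_commute: "cshift M l (cshift M k x) = cshift M k (cshift M l x)"
  by (simp add: cshift_def vec.scale vec.diff vec.scale_right_diff_distrib vec.scale_left_commute)

lemma kill_add: "kill M ls (x + y) = kill M ls x + kill M ls y"
  by (induction ls arbitrary: x y) (simp_all add: cshift_add)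

lemma kill_scale: "kill M ls (c *s x) = c *s kill M ls x"
  by (induction ls arbitrary: x) (simp_all add: cshift_scale)

lemma kill_zero [simp]: "kill M ls 0 = 0"
  using kill_scale[of M ls 0 0] by simp

lemma kill_sum: "finite I \<Longrightarrow> kill M ls (\<Sum>i\<in>I. v i) = (\<Sum>i\<in>I. kill M ls (v i))"
  by (induction I rule: finite_induct) (simp_all add: kill_add)

lemma kill_append: "kill M (ls @ ks) x = kill M ks (kill M ls x)"
  by (induction ls arbitrary: x) simp_all

lemma kill_cshift: "kill M ls (cshift M l x) = cshift M l (kill M ls x)"
  by (induction ls arbitrary: x) (simp, metis cshift_commute kill.simps(2))

lemma kill_commute: "kill M ls (kill M ks x) = kill M ks (kill M ls x)"
  by (induction ks arbitrary: x) (simp_all add: kill_cshift)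

text \<open>This is p(M) x.\<close>

definition poly_vec :: "complex^'n^'n \<Rightarrow> complex poly \<Rightarrow> complex^'n \<Rightarrow> complex^'n" where
  "poly_vec M p x = (\<Sum>i\<le>degree p. coeff p i *s (((*v) M ^^ i) x))"

lemma poly_vec_eq:
  assumes "degree p \<le> n"
  shows "poly_vec M p x = (\<Sum>i\<le>n. coeff p i *s (((*v) M ^^ i) x))"
  unfolding poly_vec_def
  by (rule sum.mono_neutral_left) (use assms in \<open>auto simp: coeff_eq_0\<close>)

lemma poly_vec_linear_factor:
  "poly_vec M ([:- a, 1:] * q) x = cshift M a (poly_vec M q x)"
proof -
  let ?n = "degree q" and ?v = "\<lambda>i. ((*v) M ^^ i) x"
  have deg: "degree ([:- a, 1:] * q) \<le> Suc ?n"
    using degree_mult_le[of "[:- a, 1:]" q] by simp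
  have c: "coeff ([:- a, 1:] * q) i = (case i of 0 \<Rightarrow> 0 | Suc j \<Rightarrow> coeff q j) - a * coeff q i" for i
    by (simp add: coeff_pCons split: nat.split)
  have "poly_vec M ([:- a, 1:] * q) x
      = (\<Sum>i\<le>Suc ?n. (case i of 0 \<Rightarrow> 0 | Suc j \<Rightarrow> coeff q j) *s ?v i)
        - (\<Sum>i\<le>Suc ?n. (a * coeff q i) *s ?v i)"
    unfolding poly_vec_eq[OF deg] c by (simp only: vec.scale_left_diff_distrib sum_subtractf)
  also have "(\<Sum>i\<le>Suc ?n. (case i of 0 \<Rightarrow> 0 | Suc j \<Rightarrow> coeff q j) *s ?v i)
      = (\<Sum>i\<le>?n. coeff q i *s (M *v ?v i))"
    by (subst sum.atMost_Suc_shift) simp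
  also have "\<dots> = M *v poly_vec M q x"
    by (simp add: poly_vec_def vec.sum vec.scale)
  also have "(\<Sum>i\<le>Suc ?n. (a * coeff q i) *s ?v i) = a *s poly_vec M q x"
    by (simp add: poly_vec_def vec.scale_sum_right coeff_eq_0)
  finally show ?thesis by (simp add: cshift_def)
qed

lemma poly_vec_cshift: "poly_vec M q (cshift M a x) = cshift M a (poly_vec M q x)"
proof -
  have 1: "((*v) M ^^ i) (cshift M a x) = cshift M a (((*v) M ^^ i) x)" for i
    by (induction i) (simp_all add: cshift_mult_vec)
  have 2: "cshift M a (\<Sum>i\<in>I. v i) = (\<Sum>i\<in>I. cshift M a (v i))" for I :: "nat set" and v
    by (simp add: cshift_def vec.sum vec.scale_sum_right sum_subtractf)
  show ?thesis by (simp add: poly_vec_def 1 2 cshift_scale)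
qed

lemma kill_of_poly_vec:
  assumes "p \<noteq> 0" "poly_vec M p x = 0"
  shows "\<exists>ls. (\<forall>l\<in>set ls. \<exists>v. v \<noteq> 0 \<and> M *v v = l *s v) \<and> kill M ls x = 0"
  using assms
proof (induction "degree p" arbitrary: p x)
  case 0
  then obtain c where "p = [:c:]" "c \<noteq> 0" by (metis degree_eq_zeroE pCons_0_0)
  with 0 have "x = 0" by (auto simp: poly_vec_def)
  then show ?case by (intro exI[of _ "[]"]) simp
next
  case (Suc d)
  have "\<not> constant (poly p)" using Suc.hyps(2) constant_degree by force
  then obtain a where "poly p a = 0" using fundamental_theorem_of_algebra by blast
  then obtain q where p: "p = [:- a, 1:] * q" by (metis dvdE poly_eq_0_iff_dvd)
  with Suc.prems have q: "q \<noteq> 0" by auto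
  have "degree p = Suc (degree q)" unfolding p using q by (subst degree_mult_eq) auto
  with Suc.hyps have d: "d = degree q" by simp
  have z: "cshift M a (poly_vec M q x) = 0" using Suc.prems(2) unfolding p poly_vec_linear_factor .
  show ?case
  proof (cases "\<exists>v. v \<noteq> 0 \<and> M *v v = a *s v")
    case True
    have "poly_vec M q (cshift M a x) = 0" using z by (simp add: poly_vec_cshift)
    from Suc.hyps(1)[OF d q this] obtain ls where
      "\<forall>l\<in>set ls. \<exists>v. v \<noteq> 0 \<and> M *v v = l *s v" "kill M ls (cshift M a x) = 0" by blast
    with True show ?thesis by (intro exI[of _ "a # ls"]) simp
  next
    case False
    with z have "poly_vec M q x = 0" by (auto simp: cshift_def)
    from Suc.hyps(1)[OF d q this] show ?thesis .
  qed
qed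

text \<open>With d the real dimension of the space, the d + 1 vectors x, M x, ..., M^d x are
  dependent over the reals, and the coefficients of a dependence are those of p.\<close>

lemma exists_poly_vec_eq_0:
  fixes M :: "complex^'n^'n"
  shows "\<exists>p. p \<noteq> 0 \<and> poly_vec M p x = 0"
proof -
  define d where "d = DIM(complex^'n)"
  define v where "v i = ((*v) M ^^ i) x" for i
  have real_scale: "complex_of_real r *s w = r *\<^sub>R w" for r and w :: "complex^'n"
    by (simp add: vec_eq_iff scaleR_conv_of_real[where 'a = complex])
  have "\<exists>c::nat \<Rightarrow> real. (\<exists>i\<le>d. c i \<noteq> 0) \<and> (\<Sum>i\<le>d. c i *\<^sub>R v i) = 0"
  proof (cases "inj_on v {..d}")
    case True
    then have "card (v ` {..d}) > DIM(complex^'n)" by (simp add: card_image d_def)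
    then have "dependent (v ` {..d})" by (intro dependent_biggerset) auto
    then obtain u where u: "\<exists>w\<in>v ` {..d}. u w \<noteq> 0" "(\<Sum>w\<in>v ` {..d}. u w *\<^sub>R w) = 0"
      by (subst (asm) dependent_finite) auto
    with True show ?thesis by (intro exI[of _ "\<lambda>i. u (v i)"]) (auto simp: sum.reindex)
  next
    \<comment> \<open>Equal iterates collapse to one element of the set of vectors, so its
      dependence is not at hand; the coefficients 1 and -1 at the two indices do instead.\<close>
    case False
    then obtain i j where ij: "i \<le> d" "j \<le> d" "i \<noteq> j" "v i = v j" by (auto simp: inj_on_def)
    have "(\<Sum>k\<le>d. ((if k = i then 1 else 0) - (if k = j then 1 else (0::real))) *\<^sub>R v k) = v i - v j"
      using ij by (simp add: scaleR_diff_left sum_subtractf if_distrib[of "\<lambda>c. c *\<^sub>R _"] cong: if_cong)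
    with ij show ?thesis
      by (intro exI[of _ "\<lambda>k. (if k = i then 1 else 0) - (if k = j then 1 else 0)"]) auto
  qed
  then obtain c :: "nat \<Rightarrow> real" and i where c: "i \<le> d" "c i \<noteq> 0" "(\<Sum>i\<le>d. c i *\<^sub>R v i) = 0" by auto
  define p where "p = (\<Sum>i\<le>d. monom (complex_of_real (c i)) i)"
  have cf: "coeff p k = (if k \<le> d then complex_of_real (c k) else 0)" for k
    by (simp add: p_def coeff_sum)
  have "coeff p i \<noteq> 0" using c by (simp add: cf)
  then have "p \<noteq> 0" by auto
  moreover have "degree p \<le> d" by (rule degree_le) (simp add: cf)
  then have "poly_vec M p x = (\<Sum>i\<le>d. c i *\<^sub>R v i)"
    by (simp add: poly_vec_eq cf v_def real_scale)
  ultimately show ?thesis using c by auto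
qed

text \<open>Concatenate lists that annihilate the basis vectors one by one. The factors commute, so
  what one sublist kills is killed by the whole list.\<close>

lemma exists_kill_all:
  fixes M :: "complex^'n^'n"
  shows "\<exists>ls. (\<forall>l\<in>set ls. \<exists>v. v \<noteq> 0 \<and> M *v v = l *s v) \<and> (\<forall>x. kill M ls x = 0)"
proof -
  have "\<exists>ls. (\<forall>l\<in>set ls. \<exists>v. v \<noteq> 0 \<and> M *v v = l *s v) \<and> (\<forall>i\<in>I. kill M ls (axis i 1) = 0)"
    if "finite I" for I :: "'n set"
    using that
  proof (induction I rule: finite_induct)
    case empty
    show ?case by (intro exI[of _ "[]"]) simp
  next
    case (insert i I)
    then obtain ls where ls: "\<forall>l\<in>set ls. \<exists>v. v \<noteq> 0 \<and> M *v v = l *s v"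
      "\<forall>i\<in>I. kill M ls (axis i 1) = 0" by auto
    obtain p where "p \<noteq> 0" "poly_vec M p (axis i 1) = 0" using exists_poly_vec_eq_0 by blast
    then obtain ks where ks: "\<forall>l\<in>set ks. \<exists>v. v \<noteq> 0 \<and> M *v v = l *s v"
      "kill M ks (axis i 1) = 0" using kill_of_poly_vec by blast
    have "kill M (ls @ ks) (axis j 1) = 0" if "j \<in> insert i I" for j
      using that ls(2) ks(2) by (auto simp: kill_append) (metis kill_commute kill_zero)
    with ls ks show ?case by (intro exI[of _ "ls @ ks"]) auto
  qed
  from this[of UNIV] obtain ls where ls: "\<forall>l\<in>set ls. \<exists>v. v \<noteq> 0 \<and> M *v v = l *s v"
    "\<forall>i. kill M ls (axis i 1) = 0" by auto
  have "kill M ls x = 0" for x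
    by (subst basis_expansion[symmetric]) (simp add: kill_sum kill_scale ls)
  with ls show ?thesis by blast
qed

text \<open>The inner product is the real one, for which x and its multiple by the imaginary unit
  are orthogonal; hence only the real part of l survives.\<close>

lemma inner_scale_complex:
  fixes x :: "complex^'n"
  shows "inner x (l *s x) = Re l * (norm x)\<^sup>2"
proof -
  have "inner (x $ i) (l * x $ i) = Re l * inner (x $ i) (x $ i)" for i
    by (simp add: inner_complex_def algebra_simps)
  then show ?thesis
    by (simp add: power2_norm_eq_inner inner_vec_def sum_distrib_left)
qed

lemma bounded_linear_cshift: "bounded_linear (cshift (M::complex^'n^'n) l)"
proof (rule linear_conv_bounded_linear[THEN iffD1], rule linearI)
  show "cshift M l (r *\<^sub>R x) = r *\<^sub>R cshift M l x" for r x
    by (simp add: cshift_def vec_eq_iff matrix_vector_mult_def scaleR_sum_right scaleR_diff_right)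
qed (simp add: cshift_add)

text \<open>Prepending an eigenvalue \<open>l\<close> to the list adds the Euclidean form; the cross term between \<open>x\<close>
  and \<open>(M - l) x\<close> is absorbed by giving the old form, evaluated at \<open>(M - l) x\<close>, a large weight.\<close>

lemma lyapunov_complex:
  fixes M :: "complex^'n^'n"
  assumes "\<forall>l\<in>set ls. Re l > 0"
  shows "\<exists>B a. a > 0 \<and> bounded_bilinear B \<and> (\<forall>x y. B x y = B y x) \<and>
    (\<forall>x. kill M ls x = 0 \<longrightarrow> (norm x)\<^sup>2 \<le> B x x \<and> a * B x x \<le> (B x (M *v x) :: real))"
  using assms
proof (induction ls)
  case Nil
  have "bounded_bilinear (\<lambda>x y::complex^'n. 0::real)"
    by (rule bounded_bilinear.intro) (auto intro: exI[of _ 0])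
  then show ?case by (intro exI[of _ "\<lambda>x y. 0"] exI[of _ 1]) auto
next
  case (Cons l ls)
  then obtain B a where a: "a > 0" and bb: "bounded_bilinear B" and sym: "\<And>x y. B x y = B y x"
    and B: "\<And>x. kill M ls x = 0 \<Longrightarrow> (norm x)\<^sup>2 \<le> B x x \<and> a * B x x \<le> (B x (M *v x) :: real)"
    by auto
  define r where "r = Re l"
  have r: "r > 0" using Cons.prems by (simp add: r_def)
  \<comment> \<open>The cross term will cost B u u / (2 r) by Young's inequality. This weight makes
    K a B u u twice that loss, so that half of it remains for the coercivity of the new
    form.\<close>
  define K where "K = 1 / (a * r)"
  have K: "K > 0" using a r by (simp add: K_def)
  define B' where "B' x y = inner x y + K * B (cshift M l x) (cshift M l y)" for x y
  have "bilinear B'"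
    unfolding bilinear_def
  proof (intro allI conjI)
    have bb': "bounded_bilinear (\<lambda>x y. B (cshift M l x) (cshift M l y))"
      by (rule bounded_bilinear.comp[OF bb bounded_linear_cshift bounded_linear_cshift])
    show "linear (B' x)" for x
      unfolding B'_def
      by (intro bounded_linear.linear bounded_linear_add bounded_linear_inner_right
          bounded_linear_const_mult bounded_bilinear.bounded_linear_right[OF bb'])
    show "linear (\<lambda>x. B' x y)" for y
      unfolding B'_def
      by (intro bounded_linear.linear bounded_linear_add bounded_linear_inner_left
          bounded_linear_const_mult bounded_bilinear.bounded_linear_left[OF bb'])
  qed
  then have bb': "bounded_bilinear B'" by (simp add: bilinear_conv_bounded_bilinear)
  have sym': "B' x y = B' y x" for x y
    by (simp add: B'_def inner_commute sym[of "cshift M l x"])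
  define a' where "a' = min (r / 2) (a / 2)"
  have a': "a' > 0" "a' \<le> r / 2" "a' \<le> a / 2" using a r by (auto simp: a'_def)
  have "(norm x)\<^sup>2 \<le> B' x x \<and> a' * B' x x \<le> B' x (M *v x)" if x: "kill M (l # ls) x = 0" for x
  proof -
    define u where "u = cshift M l x"
    have Mx: "M *v x = l *s x + u" by (simp add: u_def cshift_def)
    \<comment> \<open>Since x lies in the kernel of the longer product, u lies in the kernel of the
      shorter one, where the induction hypothesis applies.\<close>
    have u: "(norm u)\<^sup>2 \<le> B u u" "a * B u u \<le> B u (M *v u)"
      using B[of u] x by (auto simp: u_def)
    have Buu: "B u u \<ge> 0" using u(1) zero_le_power2 order_trans by blast
    have 1: "(norm x)\<^sup>2 \<le> B' x x"
      using Buu K by (simp add: B'_def power2_norm_eq_inner u_def[symmetric])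
    have "- (norm x * norm u) \<le> inner x u"
      using Cauchy_Schwarz_ineq2[of x u] by linarith
    moreover have "norm x * norm u \<le> r / 2 * (norm x)\<^sup>2 + (norm u)\<^sup>2 / (2 * r)"
    proof -
      have "0 \<le> (r * norm x - norm u)\<^sup>2 / (2 * r)" using r by simp
      also have "\<dots> = r / 2 * (norm x)\<^sup>2 + (norm u)\<^sup>2 / (2 * r) - norm x * norm u"
        using r by (simp add: power2_diff field_simps power2_eq_square)
      finally show ?thesis by simp
    qed
    ultimately have c: "inner x (M *v x) \<ge> r / 2 * (norm x)\<^sup>2 - (norm u)\<^sup>2 / (2 * r)"
      by (simp add: Mx inner_add_right inner_scale_complex r_def)
    have "B' x (M *v x) \<ge> r / 2 * (norm x)\<^sup>2 - B u u / (2 * r) + K * (a * B u u)"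
    proof -
      have "(norm u)\<^sup>2 / (2 * r) \<le> B u u / (2 * r)" using u(1) r by (simp add: divide_right_mono)
      moreover have "K * (a * B u u) \<le> K * B u (M *v u)" using u(2) K by simp
      ultimately show ?thesis using c by (simp add: B'_def cshift_mult_vec u_def[symmetric])
    qed
    also have "K * (a * B u u) = B u u / r" using a r by (simp add: K_def field_simps)
    also have "r / 2 * (norm x)\<^sup>2 - B u u / (2 * r) + B u u / r
        = r / 2 * (norm x)\<^sup>2 + a / 2 * (K * B u u)"
      using a r by (simp add: K_def field_simps)
    finally have "B' x (M *v x) \<ge> r / 2 * (norm x)\<^sup>2 + a / 2 * (K * B u u)" .
    moreover have "a' * (norm x)\<^sup>2 \<le> r / 2 * (norm x)\<^sup>2" using a' by (intro mult_right_mono) auto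
    moreover have "a' * (K * B u u) \<le> a / 2 * (K * B u u)"
      using a' Buu K by (intro mult_right_mono) auto
    moreover have "a' * B' x x = a' * (norm x)\<^sup>2 + a' * (K * B u u)"
      by (simp add: B'_def power2_norm_eq_inner u_def[symmetric] distrib_left)
    ultimately show ?thesis using 1 by linarith
  qed
  with a' bb' sym' show ?case by blast
qed

text \<open>Real vectors embed isometrically into complex ones, and the embedding intertwines A with
  its complexification; the form found there is real bilinear and is pulled back.\<close>

lemma lyapunov_form:
  fixes A :: "real^'n^'n"
  assumes "\<And>l. complex_eigenvalue A l \<Longrightarrow> Re l > 0"
  shows "\<exists>B a. a > 0 \<and> bounded_bilinear B \<and> (\<forall>x y. B x y = B y x) \<and>
    (\<forall>x. (norm x)\<^sup>2 \<le> B x x \<and> a * B x x \<le> (B x (A *v x) :: real))"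
proof -
  define M :: "complex^'n^'n" where "M = (\<chi> i j. complex_of_real (A $ i $ j))"
  define c :: "real^'n \<Rightarrow> complex^'n" where "c x = (\<chi> i. complex_of_real (x $ i))" for x
  obtain ls where ls: "\<forall>l\<in>set ls. \<exists>v. v \<noteq> 0 \<and> M *v v = l *s v" "\<And>x. kill M ls x = 0"
    using exists_kill_all by blast
  have "\<forall>l\<in>set ls. Re l > 0"
    using ls(1) assms unfolding complex_eigenvalue_def M_def by blast
  from lyapunov_complex[OF this, of M] obtain B a where B: "a > 0" "bounded_bilinear B"
    "\<And>x y. B x y = B y x" "\<And>x. (norm x)\<^sup>2 \<le> B x x \<and> a * B x x \<le> (B x (M *v x) :: real)"
    using ls(2) by blast
  have lin: "bounded_linear c"
    by (rule linear_conv_bounded_linear[THEN iffD1], rule linearI)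
      (simp_all add: c_def vec_eq_iff scaleR_conv_of_real[where 'a = complex])
  have Mc: "M *v c x = c (A *v x)" for x
    by (simp add: M_def c_def vec_eq_iff matrix_vector_mult_def)
  have nc: "norm (c x) = norm x" for x
    by (simp add: norm_vec_def c_def)
  show ?thesis
    using B(1) bounded_bilinear.comp[OF B(2) lin lin] B(3) B(4)[of "c _", unfolded Mc nc] by blast
qed

subsection \<open>Monomials in iterated logarithms\<close>

text \<open>The index -1 can be left out: all exponents in play vanish there, and no oscillation
  involves exp t.\<close>

definition Lg :: "nat \<Rightarrow> real \<Rightarrow> real" where
  "Lg j t = (ln ^^ j) t"

lemma Lg_0 [simp]: "Lg 0 t = t"
  by (simp add: Lg_def)

lemma Lg_Suc: "Lg (Suc j) t = ln (Lg j t)"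
  by (simp add: Lg_def)

lemma iter_log_int [simp]: "iter_log (int j) t = Lg j t"
  by (simp add: iter_log_def Lg_def)

lemma filterlim_Lg: "filterlim (Lg j) at_top at_top"
proof (induction j)
  case 0
  show ?case unfolding Lg_0[abs_def] by (rule filterlim_ident)
next
  case (Suc j)
  show ?case unfolding Lg_Suc[abs_def] by (rule filterlim_compose[OF ln_at_top Suc])
qed

lemma eventually_Lg_gt: "\<forall>\<^sub>F t in at_top. c < Lg j t"
  using filterlim_Lg[of j] by (simp add: filterlim_at_top_dense)

lemma eventually_Lg_le: "i \<le> j \<Longrightarrow> \<forall>\<^sub>F t in at_top. Lg j t \<le> Lg i t"
proof (induction j rule: dec_induct)
  case (step j)
  show ?case
    using step.IH eventually_Lg_gt[of 0 j]
    by eventually_elim (use ln_le_minus_one in \<open>force simp: Lg_Suc\<close>)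
qed simp

text \<open>Order at most L_m^(-a) for vector-valued functions. Negative \<open>a\<close> admits
  growth: \<open>log_bigo m (- \<epsilon>)\<close> for all \<epsilon> > 0 expresses growth slower
  than every power of L_m.\<close>

definition log_bigo :: "nat \<Rightarrow> real \<Rightarrow> (real \<Rightarrow> 'a::real_normed_vector) \<Rightarrow> bool" where
  "log_bigo m a u \<longleftrightarrow> (\<exists>C. \<forall>\<^sub>F t in at_top. norm (u t) \<le> C * Lg m t powr (- a))"

lemma log_bigo_I: "\<forall>\<^sub>F t in at_top. norm (u t) \<le> C * Lg m t powr (- a) \<Longrightarrow> log_bigo m a u"
  unfolding log_bigo_def by blast

lemma log_bigo_E:
  assumes "log_bigo m a u"
  obtains C where "C > 0" "\<forall>\<^sub>F t in at_top. norm (u t) \<le> C * Lg m t powr (- a)"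
proof -
  obtain C where C: "\<forall>\<^sub>F t in at_top. norm (u t) \<le> C * Lg m t powr (- a)"
    using assms unfolding log_bigo_def by blast
  have "\<forall>\<^sub>F t in at_top. norm (u t) \<le> max C 1 * Lg m t powr (- a)"
    using C by eventually_elim (meson max.cobounded1 mult_right_mono order_trans powr_ge_zero)
  then show ?thesis by (intro that[of "max C 1"]) auto
qed

lemma log_bigo_le:
  assumes "log_bigo m a v" "\<forall>\<^sub>F t in at_top. norm (u t) \<le> c * norm (v t)" "c \<ge> 0"
  shows "log_bigo m a u"
proof -
  obtain C where "\<forall>\<^sub>F t in at_top. norm (v t) \<le> C * Lg m t powr (- a)"
    using log_bigo_E assms(1) by blast
  with assms(2) have "\<forall>\<^sub>F t in at_top. norm (u t) \<le> (c * C) * Lg m t powr (- a)"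
    by eventually_elim (metis (no_types) assms(3) mult.assoc mult_left_mono order_trans)
  then show ?thesis by (rule log_bigo_I)
qed

lemma log_bigo_cong:
  assumes "log_bigo m a v" "\<forall>\<^sub>F t in at_top. u t = v t"
  shows "log_bigo m a u"
  by (rule log_bigo_le[OF assms(1), of _ 1]) (use assms(2) in \<open>auto elim: eventually_mono\<close>)

lemma log_bigo_zero [simp]: "log_bigo m a (\<lambda>t. 0)"
  by (rule log_bigo_I[of _ 0]) simp

lemma log_bigo_powr [simp]: "log_bigo m a (\<lambda>t. Lg m t powr (- a))"
  by (rule log_bigo_I[of _ 1]) simp

lemma log_bigo_mono:
  assumes "log_bigo m a u" "b \<le> a"
  shows "log_bigo m b u"
proof -
  obtain C where C: "C > 0" "\<forall>\<^sub>F t in at_top. norm (u t) \<le> C * Lg m t powr (- a)"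
    using log_bigo_E assms(1) by blast
  have "\<forall>\<^sub>F t in at_top. norm (u t) \<le> C * Lg m t powr (- b)"
    using C(2) eventually_Lg_gt[of 1 m]
  proof eventually_elim
    case (elim t)
    have "Lg m t powr (- a) \<le> Lg m t powr (- b)" using elim assms(2) by (intro powr_mono) auto
    with elim C(1) show ?case by (meson mult_left_mono order_trans less_imp_le)
  qed
  then show ?thesis by (rule log_bigo_I)
qed

lemma log_bigo_add:
  assumes "log_bigo m a u" "log_bigo m a v"
  shows "log_bigo m a (\<lambda>t. u t + v t)"
proof -
  obtain C C' where "\<forall>\<^sub>F t in at_top. norm (u t) \<le> C * Lg m t powr (- a)"
    "\<forall>\<^sub>F t in at_top. norm (v t) \<le> C' * Lg m t powr (- a)"
    using assms unfolding log_bigo_def by blast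
  then have "\<forall>\<^sub>F t in at_top. norm (u t + v t) \<le> (C + C') * Lg m t powr (- a)"
    by eventually_elim (simp add: distrib_right norm_triangle_mono)
  then show ?thesis by (rule log_bigo_I)
qed

lemma log_bigo_minus: "log_bigo m a u \<Longrightarrow> log_bigo m a (\<lambda>t. - u t)"
  by (rule log_bigo_le[of _ _ u _ 1]) auto

lemma log_bigo_diff: "log_bigo m a u \<Longrightarrow> log_bigo m a v \<Longrightarrow> log_bigo m a (\<lambda>t. u t - v t)"
  using log_bigo_add[of m a u "\<lambda>t. - v t"] log_bigo_minus[of m a v] by simp

lemma log_bigo_sum:
  assumes "finite I" "\<And>i. i \<in> I \<Longrightarrow> log_bigo m a (u i)"
  shows "log_bigo m a (\<lambda>t. \<Sum>i\<in>I. u i t)"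
  using assms
proof (induction I rule: finite_induct)
  case (insert i I)
  then show ?case by (simp add: log_bigo_add)
qed simp

lemma log_bigo_bounded_linear:
  assumes "bounded_linear h" "log_bigo m a u"
  shows "log_bigo m a (\<lambda>t. h (u t))"
proof -
  obtain K where "\<And>x. norm (h x) \<le> norm x * K" "K > 0"
    using bounded_linear.pos_bounded[OF assms(1)] by blast
  then show ?thesis
    by (intro log_bigo_le[OF assms(2), of _ K]) (auto simp: mult.commute)
qed

lemma log_bigo_scaleR:
  assumes "log_bigo m a p" "log_bigo m b u"
  shows "log_bigo m (a + b) (\<lambda>t. p t *\<^sub>R u t)"
proof -
  obtain C C' where "\<forall>\<^sub>F t in at_top. norm (p t) \<le> C * Lg m t powr (- a)"
    "\<forall>\<^sub>F t in at_top. norm (u t) \<le> C' * Lg m t powr (- b)"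
    using assms unfolding log_bigo_def by blast
  then have "\<forall>\<^sub>F t in at_top. norm (p t *\<^sub>R u t) \<le> (C * C') * Lg m t powr (- (a + b))"
  proof eventually_elim
    case (elim t)
    have "norm (p t *\<^sub>R u t) \<le> (C * Lg m t powr (- a)) * (C' * Lg m t powr (- b))"
      unfolding norm_scaleR using elim by (intro mult_mono') auto
    also have "\<dots> = (C * C') * (Lg m t powr (- a) * Lg m t powr (- b))" by simp
    also have "Lg m t powr (- a) * Lg m t powr (- b) = Lg m t powr (- (a + b))"
      by (simp flip: powr_add)
    finally show ?case .
  qed
  then show ?thesis by (rule log_bigo_I)
qed

lemma log_bigo_tendsto_0:
  assumes "log_bigo m a u" "a > 0"
  shows "(u \<longlongrightarrow> 0) at_top"
proof -
  obtain C where C: "\<forall>\<^sub>F t in at_top. norm (u t) \<le> C * Lg m t powr (- a)"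
    using log_bigo_E assms(1) by blast
  have "((\<lambda>t. Lg m t powr (- a)) \<longlongrightarrow> 0) at_top"
    using tendsto_neg_powr[OF _ filterlim_Lg] assms(2) by simp
  then have "((\<lambda>t. C * Lg m t powr (- a)) \<longlongrightarrow> 0) at_top" by (rule tendsto_mult_right_zero)
  with C show ?thesis by (rule Lim_null_comparison)
qed

lemma log_bigo_norm_powr:
  assumes "log_bigo m a u" "b \<ge> 0"
  shows "log_bigo m (a * b) (\<lambda>t. norm (u t) powr b)"
proof -
  obtain C where C: "C > 0" "\<forall>\<^sub>F t in at_top. norm (u t) \<le> C * Lg m t powr (- a)"
    using log_bigo_E assms(1) by blast
  from C(2) have "\<forall>\<^sub>F t in at_top. norm (norm (u t) powr b) \<le> C powr b * Lg m t powr (- (a * b))"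
  proof eventually_elim
    case (elim t)
    have "norm (u t) powr b \<le> (C * Lg m t powr (- a)) powr b"
      using elim assms(2) by (intro powr_mono2) auto
    also have "\<dots> = C powr b * Lg m t powr (- (a * b))"
      using C(1) by (simp add: powr_mult powr_powr)
    finally show ?case by simp
  qed
  then show ?thesis by (rule log_bigo_I)
qed

definition negligible_fn :: "nat \<Rightarrow> (real \<Rightarrow> 'a::real_normed_vector) \<Rightarrow> bool" where
  "negligible_fn m u \<longleftrightarrow> (\<forall>a. log_bigo m a u)"

lemma negligible_eventually_0: "\<forall>\<^sub>F t in at_top. u t = 0 \<Longrightarrow> negligible_fn m u"
  unfolding negligible_fn_def using log_bigo_cong[OF log_bigo_zero] by blast

lemma negligible_scaleR_left:
  assumes "negligible_fn m p" "log_bigo m b u"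
  shows "negligible_fn m (\<lambda>t. p t *\<^sub>R u t)"
  unfolding negligible_fn_def
proof
  fix a
  have "log_bigo m (a - b) p" using assms(1) by (simp add: negligible_fn_def)
  from log_bigo_scaleR[OF this assms(2)] show "log_bigo m a (\<lambda>t. p t *\<^sub>R u t)" by simp
qed

lemma negligible_scaleR_right:
  assumes "negligible_fn m u" "log_bigo m b p"
  shows "negligible_fn m (\<lambda>t. p t *\<^sub>R u t)"
  unfolding negligible_fn_def
proof
  fix a
  have "log_bigo m (a - b) u" using assms(1) by (simp add: negligible_fn_def)
  from log_bigo_scaleR[OF assms(2) this] show "log_bigo m a (\<lambda>t. p t *\<^sub>R u t)" by simp
qed

text \<open>For large t, L_j is dominated by ln L_m, and a logarithm grows more slowly than every
  power of its argument.\<close>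

lemma log_bigo_Lg_powr:
  assumes "m < j" "\<epsilon> > 0"
  shows "log_bigo m (- \<epsilon>) (\<lambda>t. Lg j t powr a)"
proof -
  \<comment> \<open>The bound for powers of ln needs a positive exponent; raising a to at least 1 is
    harmless because L_j > 1 eventually.\<close>
  define b where "b = max a 1"
  define c where "c = ((b / \<epsilon>) powr (b / \<epsilon>)) powr \<epsilon>"
  have "\<forall>\<^sub>F t in at_top. Lg (Suc m) t powr b \<le> c * Lg m t powr \<epsilon>"
    using eventually_Lg_gt[of 1 m]
  proof eventually_elim
    case (elim t)
    have "Lg (Suc m) t powr b = (ln (Lg m t) powr (b / \<epsilon>)) powr \<epsilon>"
      using assms(2) by (simp add: Lg_Suc powr_powr)
    also have "\<dots> \<le> ((b / \<epsilon>) powr (b / \<epsilon>) * Lg m t) powr \<epsilon>"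
      using elim assms(2) by (intro powr_mono2 ln_powr_bound2) (auto simp: b_def)
    also have "\<dots> = c * Lg m t powr \<epsilon>" using elim by (simp add: powr_mult c_def)
    finally show ?case .
  qed
  moreover have "\<forall>\<^sub>F t in at_top. Lg j t \<le> Lg (Suc m) t"
    using assms(1) by (intro eventually_Lg_le) simp
  ultimately have "\<forall>\<^sub>F t in at_top. norm (Lg j t powr a) \<le> c * Lg m t powr (- (- \<epsilon>))"
    using eventually_Lg_gt[of 1 j]
  proof eventually_elim
    case (elim t)
    have "Lg j t powr a \<le> Lg j t powr b" using elim by (intro powr_mono) (auto simp: b_def)
    also have "\<dots> \<le> Lg (Suc m) t powr b" using elim by (intro powr_mono2) (auto simp: b_def)
    finally show ?case using elim by simp
  qed
  then show ?thesis by (rule log_bigo_I)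
qed

text \<open>The preceding comparison with base scale t itself: every power of L_m is eventually
  below a multiple of t.\<close>

lemma negligible_inverse:
  assumes "m > 0"
  shows "negligible_fn m (\<lambda>t. inverse t)"
  unfolding negligible_fn_def
proof
  fix a
  have "log_bigo 0 (- 1) (\<lambda>t. Lg m t powr a)" by (rule log_bigo_Lg_powr[OF assms]) simp
  then obtain C where C: "C > 0"
    "\<forall>\<^sub>F t in at_top. norm (Lg m t powr a) \<le> C * Lg 0 t powr (- (- 1))"
    by (rule log_bigo_E)
  have "\<forall>\<^sub>F t in at_top. norm (inverse t) \<le> C * Lg m t powr (- a)"
    using C(2) eventually_Lg_gt[of 1 m] eventually_gt_at_top[of 0]
    by eventually_elim (simp add: powr_minus field_simps)
  then show "log_bigo m a (\<lambda>t. inverse t)" by (rule log_bigo_I)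
qed

section \<open>Derivatives of the iterated logarithms and the classes of monomials\<close>

definition dLg :: "nat \<Rightarrow> real \<Rightarrow> real" where
  "dLg j t = (\<Prod>i<j. inverse (Lg i t))"

lemma Lg_has_derivative: "\<forall>\<^sub>F t in at_top. (Lg j has_real_derivative dLg j t) (at t)"
proof (induction j)
  case 0
  show ?case by (simp add: dLg_def Lg_0[abs_def])
next
  case (Suc j)
  from Suc eventually_Lg_gt[of 0 j] show ?case
  proof eventually_elim
    case (elim t)
    have "((\<lambda>t. ln (Lg j t)) has_real_derivative dLg (Suc j) t) (at t)"
      using elim by (auto intro!: derivative_eq_intros simp: dLg_def field_simps)
    then show ?case by (simp add: Lg_Suc[abs_def])
  qed
qed

text \<open>Products of the factors of the monomials, except the power of \<open>L_m\<close> and the oscillation in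
  \<open>z_0 = t\<close>. Shifting phases makes the sine redundant.\<close>

inductive_set amplitudes :: "nat \<Rightarrow> (real \<Rightarrow> real) \<Rightarrow> (real \<Rightarrow> real) set" for m \<zeta> where
  one: "(\<lambda>t. 1) \<in> amplitudes m \<zeta>"
| const: "s \<in> amplitudes m \<zeta> \<Longrightarrow> (\<lambda>t. c * s t) \<in> amplitudes m \<zeta>"
| log: "m < j \<Longrightarrow> s \<in> amplitudes m \<zeta> \<Longrightarrow> (\<lambda>t. Lg j t powr a * s t) \<in> amplitudes m \<zeta>"
| zeta: "s \<in> amplitudes m \<zeta> \<Longrightarrow> (\<lambda>t. \<zeta> t powr b * s t) \<in> amplitudes m \<zeta>"
| trig: "0 < j \<Longrightarrow> s \<in> amplitudes m \<zeta> \<Longrightarrow> (\<lambda>t. cos (w * Lg j t + \<phi>) * s t) \<in> amplitudes m \<zeta>"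

text \<open>The functions of order at most \<open>L_m^(-M)\<close> that are, up to errors beyond all orders, finite
  sums of monomials.\<close>

inductive_set graded :: "nat \<Rightarrow> (real \<Rightarrow> real) \<Rightarrow> real \<Rightarrow> (real \<Rightarrow> 'x::real_normed_vector) set"
  for m \<zeta> M where
  trm: "s \<in> amplitudes m \<zeta> \<Longrightarrow> M \<le> a \<Longrightarrow>
    (\<lambda>t. (Lg m t powr (- a) * cos (w * t + \<phi>) * s t) *\<^sub>R \<xi>) \<in> graded m \<zeta> M"
| add: "u \<in> graded m \<zeta> M \<Longrightarrow> v \<in> graded m \<zeta> M \<Longrightarrow> (\<lambda>t. u t + v t) \<in> graded m \<zeta> M"
| neg: "u \<in> graded m \<zeta> M \<Longrightarrow> negligible_fn m (\<lambda>t. v t - u t) \<Longrightarrow> v \<in> graded m \<zeta> M"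

lemma amplitudes_mult: "s \<in> amplitudes m \<zeta> \<Longrightarrow> r \<in> amplitudes m \<zeta> \<Longrightarrow> (\<lambda>t. s t * r t) \<in> amplitudes m \<zeta>"
proof (induction s rule: amplitudes.induct)
  case (const s c)
  from amplitudes.const[OF const(2)[OF const(3)], of c] show ?case by (simp add: mult.assoc)
next
  case (log j s a)
  from amplitudes.log[OF log(1) log(3)[OF log(4)], of a] show ?case by (simp add: mult.assoc)
next
  case (zeta s b)
  from amplitudes.zeta[OF zeta(2)[OF zeta(3)], of b] show ?case by (simp add: mult.assoc)
next
  case (trig j s w \<phi>)
  from amplitudes.trig[OF trig(1) trig(3)[OF trig(4)], of w \<phi>] show ?case by (simp add: mult.assoc)
qed simp

lemma amplitudes_prod:
  assumes "finite I" "\<And>i. i \<in> I \<Longrightarrow> s i \<in> amplitudes m \<zeta>"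
  shows "(\<lambda>t. \<Prod>i\<in>I. s i t) \<in> amplitudes m \<zeta>"
  using assms
proof (induction I rule: finite_induct)
  case (insert i I)
  then show ?case by (simp add: amplitudes_mult)
qed (simp add: amplitudes.one)

lemma amplitudes_log: "m < j \<Longrightarrow> (\<lambda>t. Lg j t powr a) \<in> amplitudes m \<zeta>"
  using amplitudes.log[OF _ amplitudes.one, of m j a \<zeta>] by simp

lemma amplitudes_zeta: "(\<lambda>t. \<zeta> t powr b) \<in> amplitudes m \<zeta>"
  using amplitudes.zeta[OF amplitudes.one, of \<zeta> b m] by simp

lemma amplitudes_trig: "0 < j \<Longrightarrow> (\<lambda>t. cos (w * Lg j t + \<phi>)) \<in> amplitudes m \<zeta>"
  using amplitudes.trig[OF _ amplitudes.one, of j w \<phi> m \<zeta>] by simp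

lemma graded_mono: "u \<in> graded m \<zeta> M \<Longrightarrow> M' \<le> M \<Longrightarrow> u \<in> graded m \<zeta> M'"
proof (induction u rule: graded.induct)
  case (trm s a w \<phi> \<xi>)
  then show ?case by (intro graded.trm) auto
next
  case (add u v)
  then show ?case by (intro graded.add)
next
  case (neg u v)
  show ?case by (rule graded.neg[OF neg(3)[OF neg(4)] neg(2)])
qed

lemma graded_cong:
  assumes "u \<in> graded m \<zeta> M" "\<forall>\<^sub>F t in at_top. v t = u t"
  shows "v \<in> graded m \<zeta> M"
  by (rule graded.neg[OF assms(1)], rule negligible_eventually_0)
    (use assms(2) in \<open>auto elim: eventually_mono\<close>)

lemma graded_zero: "(\<lambda>t. 0) \<in> graded m \<zeta> M"
  using graded.trm[OF amplitudes.one order_refl, where \<xi> = 0] by simp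

lemma graded_negligible: "negligible_fn m v \<Longrightarrow> v \<in> graded m \<zeta> M"
  by (rule graded.neg[OF graded_zero]) simp

lemma graded_sum:
  assumes "finite I" "\<And>i. i \<in> I \<Longrightarrow> u i \<in> graded m \<zeta> M"
  shows "(\<lambda>t. \<Sum>i\<in>I. u i t) \<in> graded m \<zeta> M"
  using assms
proof (induction I rule: finite_induct)
  case (insert i I)
  then show ?case by (simp add: graded.add)
qed (simp add: graded_zero)

lemma graded_bounded_linear:
  assumes "bounded_linear h" "u \<in> graded m \<zeta> M"
  shows "(\<lambda>t. h (u t)) \<in> graded m \<zeta> M"
  using assms(2)
proof (induction u rule: graded.induct)
  case (trm s a w \<phi> \<xi>)
  then show ?case
    using graded.trm[of s m \<zeta> M a w \<phi> "h \<xi>"] by (simp add: linear_simps(5)[OF assms(1)])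
next
  case (add u v)
  then show ?case using graded.add by (simp add: linear_simps(1)[OF assms(1)])
next
  case (neg u v)
  have "negligible_fn m (\<lambda>t. h (v t - u t))"
    using neg(2) log_bigo_bounded_linear[OF assms(1)] by (auto simp: negligible_fn_def)
  then show ?case by (intro graded.neg[OF neg(3)]) (simp add: linear_simps(2)[OF assms(1)])
qed

lemma graded_minus: "u \<in> graded m \<zeta> M \<Longrightarrow> (\<lambda>t. - u t) \<in> graded m \<zeta> M"
  using graded_bounded_linear[OF bounded_linear_minus[OF bounded_linear_ident]] .

lemma graded_diff: "u \<in> graded m \<zeta> M \<Longrightarrow> v \<in> graded m \<zeta> M \<Longrightarrow> (\<lambda>t. u t - v t) \<in> graded m \<zeta> M"
  using graded.add[of u m \<zeta> M "\<lambda>t. - v t"] graded_minus[of v m \<zeta> M] by simp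

lemma graded_amplitudes:
  assumes "s \<in> amplitudes m \<zeta>"
  shows "(\<lambda>t. s t *\<^sub>R \<xi>) \<in> graded m \<zeta> 0"
proof (rule graded_cong[OF graded.trm[where s = s and M = 0 and a = 0 and w = 0 and \<phi> = 0 and \<xi> = \<xi>]])
  show "\<forall>\<^sub>F t in at_top. s t *\<^sub>R \<xi> = (Lg m t powr (-0) * cos (0 * t + 0) * s t) *\<^sub>R \<xi>"
    using eventually_Lg_gt[of 0 m] by eventually_elim simp
qed (use assms in auto)

lemma graded_amplitudes_real: "s \<in> amplitudes m \<zeta> \<Longrightarrow> s \<in> graded m \<zeta> 0"
  using graded_amplitudes[of s m \<zeta> "1::real"] by simp

lemma graded_powr: "(\<lambda>t. Lg m t powr (- a)) \<in> graded m \<zeta> a"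
  using graded.trm[OF amplitudes.one order_refl, where w = 0 and \<phi> = 0 and \<xi> = "1::real"] by simp

lemma cos_times_cos: "cos x * cos y = (cos (x - y) + cos (x + y)) / (2::real)"
  by (simp add: cos_add cos_diff)

text \<open>The exponent b runs over all reals, so on the scale of powers of L_m the function
  \<zeta> is neither large nor small.\<close>

locale log_scale =
  fixes m :: nat and \<zeta> :: "real \<Rightarrow> real"
  assumes zeta_pos: "\<forall>\<^sub>F t in at_top. 0 < \<zeta> t"
    and zeta_growth: "\<And>\<epsilon> b. \<epsilon> > 0 \<Longrightarrow> log_bigo m (- \<epsilon>) (\<lambda>t. \<zeta> t powr b)"
begin

lemma log_bigo_trig_scale: "log_bigo m a u \<Longrightarrow> log_bigo m a (\<lambda>t. cos (w * v t + \<phi>) *\<^sub>R u t)"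
  by (rule log_bigo_le[of _ _ u _ 1]) (auto simp: mult_left_le_one_le)

lemma amplitudes_log_bigo:
  assumes "s \<in> amplitudes m \<zeta>" "\<epsilon> > 0"
  shows "log_bigo m (- \<epsilon>) s"
  using assms
proof (induction s arbitrary: \<epsilon> rule: amplitudes.induct)
  case one
  have "log_bigo m 0 (\<lambda>t. 1::real)"
    using log_bigo_powr[of m 0] by (rule log_bigo_cong) (use eventually_Lg_gt[of 0 m] in \<open>auto elim: eventually_mono\<close>)
  then show ?case using one by (auto intro: log_bigo_mono)
next
  case (const s c)
  have "log_bigo m (- \<epsilon>) (\<lambda>t. c *\<^sub>R s t)"
    using log_bigo_bounded_linear[OF bounded_linear_scaleR_right const.IH[OF const.prems]] .
  then show ?case by simp
next
  case (log j s a)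
  then show ?case using log_bigo_scaleR[OF log_bigo_Lg_powr[of m j "\<epsilon>/2" a] log.IH[of "\<epsilon>/2"]] by simp
next
  case (zeta s b)
  then show ?case using log_bigo_scaleR[OF zeta_growth[of "\<epsilon>/2" b] zeta.IH[of "\<epsilon>/2"]] by simp
next
  case (trig j s w \<phi>)
  then show ?case using log_bigo_trig_scale[of "- \<epsilon>" s w "Lg j" \<phi>] by simp
qed

text \<open>The strict inequality pays for the amplitudes, which may grow, though more slowly than
  any power of L_m.\<close>

lemma graded_log_bigo:
  assumes "u \<in> graded m \<zeta> M" "a < M"
  shows "log_bigo m a u"
  using assms(1)
proof (induction u rule: graded.induct)
  case (trm s b w \<phi> \<xi>)
  have "log_bigo m (a - b) s" using amplitudes_log_bigo[OF trm(1), of "b - a"] trm assms by simp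
  then have "log_bigo m (a - b) (\<lambda>t. cos (w * t + \<phi>) *\<^sub>R s t)" by (rule log_bigo_trig_scale)
  from log_bigo_scaleR[OF log_bigo_powr[of m b] this]
  have "log_bigo m a (\<lambda>t. Lg m t powr (- b) * cos (w * t + \<phi>) * s t)" by (simp add: mult.assoc)
  from log_bigo_bounded_linear[OF bounded_linear_scaleR_left this] show ?case .
next
  case (add u v)
  then show ?case by (intro log_bigo_add)
next
  case (neg u v)
  then have "log_bigo m a (\<lambda>t. u t + (v t - u t))" by (intro log_bigo_add) (auto simp: negligible_fn_def)
  then show ?case by simp
qed

text \<open>The product formula for cosines turns two oscillations in t into a sum of two single
  ones; the factor 1/2 and the real coefficient of p are put into the amplitude. A negligible error
  stays negligible because the other factor is bounded by some power of L_m.\<close>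

lemma graded_scaleR:
  assumes "p \<in> graded m \<zeta> M" "u \<in> graded m \<zeta> M'"
  shows "(\<lambda>t. p t *\<^sub>R u t) \<in> graded m \<zeta> (M + M')"
  using assms
proof (induction p rule: graded.induct)
  case (trm s a w \<phi> \<xi>)
  from trm.prems trm.hyps show ?case
  proof (induction u rule: graded.induct)
    case (trm s' a' w' \<phi>' \<xi>')
    define r where "r t = (\<xi> / 2) * (s t * s' t)" for t
    have r: "r \<in> amplitudes m \<zeta>" unfolding r_def by (intro amplitudes.const amplitudes_mult trm)
    have 1: "M + M' \<le> a + a'" using trm by simp
    have "(\<lambda>t. (Lg m t powr (- (a + a')) * cos ((w - w') * t + (\<phi> - \<phi>')) * r t) *\<^sub>R \<xi>'
       + (Lg m t powr (- (a + a')) * cos ((w + w') * t + (\<phi> + \<phi>')) * r t) *\<^sub>R \<xi>') \<in> graded m \<zeta> (M + M')"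
      by (intro graded.add graded.trm r 1)
    also have "(\<lambda>t. (Lg m t powr (- (a + a')) * cos ((w - w') * t + (\<phi> - \<phi>')) * r t) *\<^sub>R \<xi>'
       + (Lg m t powr (- (a + a')) * cos ((w + w') * t + (\<phi> + \<phi>')) * r t) *\<^sub>R \<xi>')
       = (\<lambda>t. ((Lg m t powr (- a) * cos (w * t + \<phi>) * s t) *\<^sub>R \<xi>) *\<^sub>R
              (Lg m t powr (- a') * cos (w' * t + \<phi>') * s' t) *\<^sub>R \<xi>')"
    proof
      fix t
      have pw: "Lg m t powr (- (a + a')) = Lg m t powr (- a) * Lg m t powr (- a')"
        by (simp flip: powr_add)
      have c: "cos ((w - w') * t + (\<phi> - \<phi>')) + cos ((w + w') * t + (\<phi> + \<phi>'))
          = 2 * (cos (w * t + \<phi>) * cos (w' * t + \<phi>'))"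
        unfolding cos_times_cos by (simp add: algebra_simps)
      have "Lg m t powr (- (a + a')) * cos ((w - w') * t + (\<phi> - \<phi>')) * r t
          + Lg m t powr (- (a + a')) * cos ((w + w') * t + (\<phi> + \<phi>')) * r t
          = Lg m t powr (- a) * Lg m t powr (- a') *
            (cos ((w - w') * t + (\<phi> - \<phi>')) + cos ((w + w') * t + (\<phi> + \<phi>'))) * r t"
        unfolding pw by (simp add: distrib_left distrib_right mult_ac)
      also have "\<dots> = (Lg m t powr (- a) * cos (w * t + \<phi>) * s t) * \<xi> *
              (Lg m t powr (- a') * cos (w' * t + \<phi>') * s' t)"
        unfolding c by (simp add: r_def)
      finally show "(Lg m t powr (- (a + a')) * cos ((w - w') * t + (\<phi> - \<phi>')) * r t) *\<^sub>R \<xi>'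
       + (Lg m t powr (- (a + a')) * cos ((w + w') * t + (\<phi> + \<phi>')) * r t) *\<^sub>R \<xi>'
       = ((Lg m t powr (- a) * cos (w * t + \<phi>) * s t) *\<^sub>R \<xi>) *\<^sub>R
              (Lg m t powr (- a') * cos (w' * t + \<phi>') * s' t) *\<^sub>R \<xi>'"
        by (simp add: scaleR_left_distrib[symmetric])
    qed
    finally show ?case .
  next
    case (add u v)
    then show ?case using graded.add by (simp add: scaleR_right_distrib)
  next
    case (neg u v)
    have "(\<lambda>t. (Lg m t powr (- a) * cos (w * t + \<phi>) * s t) *\<^sub>R \<xi>) \<in> graded m \<zeta> M"
      using neg by (intro graded.trm)
    then have "log_bigo m (M - 1) (\<lambda>t. (Lg m t powr (- a) * cos (w * t + \<phi>) * s t) *\<^sub>R \<xi>)"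
      by (rule graded_log_bigo) simp
    from negligible_scaleR_right[OF neg(2) this] show ?case
      by (intro graded.neg[OF neg(3)[OF neg(4-)]]) (simp only: scaleR_right_diff_distrib)
  qed
next
  case (add p q)
  then show ?case using graded.add by (simp add: scaleR_left_distrib)
next
  case (neg p q)
  have "log_bigo m (M' - 1) u" using neg.prems by (rule graded_log_bigo) simp
  from negligible_scaleR_left[OF neg(2) this] show ?case
    by (intro graded.neg[OF neg(3)[OF neg(4)]]) (simp only: scaleR_left_diff_distrib)
qed

lemma graded_mult: "p \<in> graded m \<zeta> M \<Longrightarrow> q \<in> graded m \<zeta> M' \<Longrightarrow> (\<lambda>t. p t * (q t :: real)) \<in> graded m \<zeta> (M + M')"
  using graded_scaleR[of p M q M'] by simp

text \<open>For m = 0 the factor 1/t is exactly one power of 1/L_0 and the other factors are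
  amplitudes. For m > 0 the whole derivative is bounded by 1/t and hence beyond all orders.\<close>

lemma dLg_in_graded: assumes "j > 0" shows "dLg j \<in> graded m \<zeta> 1"
proof (cases "m = 0")
  case True
  have "(\<lambda>t. Lg m t powr (- 1) * (\<Prod>i\<in>{1..<j}. Lg i t powr (- 1))) \<in> graded m \<zeta> (1 + 0)"
    by (intro graded_mult graded_powr graded_amplitudes_real amplitudes_prod amplitudes_log) (auto simp: True)
  moreover have "\<forall>\<^sub>F t in at_top. \<forall>i\<in>{..<j}. 0 < Lg i t"
    by (intro eventually_ball_finite) (auto intro: eventually_Lg_gt)
  then have "\<forall>\<^sub>F t in at_top. dLg j t = Lg m t powr (- 1) * (\<Prod>i\<in>{1..<j}. Lg i t powr (- 1))"
  proof eventually_elim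
    case (elim t)
    have e: "Lg i t powr (- 1) = inverse (Lg i t)" if "i < j" for i
      using elim that by (simp add: powr_minus abs_of_pos)
    have "dLg j t = (\<Prod>i\<in>insert 0 {1..<j}. inverse (Lg i t))"
      unfolding dLg_def by (rule prod.cong) (use assms in auto)
    also have "\<dots> = (\<Prod>i\<in>insert 0 {1..<j}. Lg i t powr (- 1))"
      using assms by (intro prod.cong refl e[symmetric]) auto
    also have "\<dots> = Lg m t powr (- 1) * (\<Prod>i\<in>{1..<j}. Lg i t powr (- 1))"
      using True by (subst prod.insert) auto
    finally show ?case .
  qed
  ultimately show ?thesis by (auto intro: graded_cong)
next
  case False
  have "\<forall>\<^sub>F t in at_top. \<forall>i\<in>{..<j}. 1 < Lg i t"
    by (intro eventually_ball_finite) (auto intro: eventually_Lg_gt)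
  then have *: "\<forall>\<^sub>F t in at_top. norm (dLg j t) \<le> 1 * norm (inverse t)"
  proof eventually_elim
    case (elim t)
    have "dLg j t = inverse (Lg 0 t) * (\<Prod>i\<in>{1..<j}. inverse (Lg i t))"
      unfolding dLg_def using assms
      by (metis One_nat_def lessThan_atLeast0 prod.atLeast_Suc_lessThan)
    moreover have pos: "0 \<le> Lg i t \<and> 1 \<le> Lg i t" if "i < j" for i
      using elim that by (auto dest!: bspec[of _ _ i])
    have "(\<Prod>i\<in>{1..<j}. inverse (Lg i t)) \<le> 1" "(\<Prod>i\<in>{1..<j}. inverse (Lg i t)) \<ge> 0"
      using pos by (auto intro!: prod_le_1 prod_nonneg simp: inverse_le_1_iff)
    ultimately show ?case by (simp add: abs_mult mult_left_le)
  qed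
  have "log_bigo m a (dLg j)" for a
    using negligible_inverse[of m] False unfolding negligible_fn_def by (intro log_bigo_le[OF _ *]) auto
  then show ?thesis by (intro graded_negligible) (simp add: negligible_fn_def)
qed

section \<open>Functions whose derivative has order 1 in the grading\<close>

definition slow :: "(real \<Rightarrow> real) \<Rightarrow> bool" where
  "slow s \<longleftrightarrow> (\<exists>s'. (\<forall>\<^sub>F t in at_top. (s has_real_derivative s' t) (at t)) \<and> s' \<in> graded m \<zeta> 1)"

lemma slow_I: "\<forall>\<^sub>F t in at_top. (s has_real_derivative s' t) (at t) \<Longrightarrow> s' \<in> graded m \<zeta> 1 \<Longrightarrow> slow s"
  unfolding slow_def by blast

lemma slow_const: "slow (\<lambda>t. c)"
  by (rule slow_I[of _ "\<lambda>t. 0"]) (auto intro: graded_zero)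

lemma slow_add:
  assumes "slow s" "slow r" shows "slow (\<lambda>t. s t + r t)"
proof -
  obtain s' r' where *: "\<forall>\<^sub>F t in at_top. (s has_real_derivative s' t) (at t)" "s' \<in> graded m \<zeta> 1"
    "\<forall>\<^sub>F t in at_top. (r has_real_derivative r' t) (at t)" "r' \<in> graded m \<zeta> 1"
    using assms unfolding slow_def by blast
  from *(1,3) have "\<forall>\<^sub>F t in at_top. ((\<lambda>t. s t + r t) has_real_derivative s' t + r' t) (at t)"
    by eventually_elim (rule DERIV_add)
  then show ?thesis by (rule slow_I[OF _ graded.add[OF *(2) *(4)]])
qed

lemma slow_mult:
  assumes "slow s" "slow r" "s \<in> graded m \<zeta> 0" "r \<in> graded m \<zeta> 0" shows "slow (\<lambda>t. s t * r t)"
proof -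
  obtain s' r' where *: "\<forall>\<^sub>F t in at_top. (s has_real_derivative s' t) (at t)" "s' \<in> graded m \<zeta> 1"
    "\<forall>\<^sub>F t in at_top. (r has_real_derivative r' t) (at t)" "r' \<in> graded m \<zeta> 1"
    using assms unfolding slow_def by blast
  from *(1,3) have "\<forall>\<^sub>F t in at_top. ((\<lambda>t. s t * r t) has_real_derivative s' t * r t + r' t * s t) (at t)"
    by eventually_elim (rule DERIV_mult)
  moreover have "(\<lambda>t. s' t * r t + r' t * s t) \<in> graded m \<zeta> 1"
    using graded_mult[OF *(2) assms(4)] graded_mult[OF *(4) assms(3)] by (intro graded.add) auto
  ultimately show ?thesis by (intro slow_I)
qed

lemma slow_sum:
  assumes "finite I" "\<And>i. i \<in> I \<Longrightarrow> slow (u i)"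
  shows "slow (\<lambda>t. \<Sum>i\<in>I. u i t)"
  using assms
proof (induction I rule: finite_induct)
  case (insert i I)
  then show ?case by (simp add: slow_add)
qed (simp add: slow_const)

lemma slow_prod:
  assumes "finite I" "\<And>i. i \<in> I \<Longrightarrow> slow (u i) \<and> u i \<in> amplitudes m \<zeta>"
  shows "slow (\<lambda>t. \<Prod>i\<in>I. u i t)"
  using assms
proof (induction I rule: finite_induct)
  case (insert i I)
  then have "slow (\<lambda>t. u i t * (\<Prod>i\<in>I. u i t))" by (intro slow_mult graded_amplitudes_real amplitudes_prod) auto
  with insert show ?case by simp
qed (simp add: slow_const)

lemma slow_log:
  assumes "m < j" shows "slow (\<lambda>t. Lg j t powr a)"
proof (rule slow_I)
  show "\<forall>\<^sub>F t in at_top. ((\<lambda>t. Lg j t powr a) has_real_derivative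
      (a * Lg j t powr (a - 1)) * dLg j t) (at t)"
    using Lg_has_derivative[of j] eventually_Lg_gt[of 0 j]
    by eventually_elim (auto intro!: derivative_eq_intros simp: powr_diff)
  have "(\<lambda>t. (a * Lg j t powr (a - 1)) * dLg j t) \<in> graded m \<zeta> (0 + 1)"
    using assms by (intro graded_mult dLg_in_graded graded_amplitudes_real amplitudes.const amplitudes_log) auto
  then show "(\<lambda>t. (a * Lg j t powr (a - 1)) * dLg j t) \<in> graded m \<zeta> 1" by simp
qed

lemma slow_trig:
  assumes "0 < j" shows "slow (\<lambda>t. cos (w * Lg j t + \<phi>))"
proof (rule slow_I)
  \<comment> \<open>Minus sine appears as a cosine with shifted phase, the only form in which
    amplitudes contain it.\<close>
  have "(\<lambda>t. (w * cos (w * Lg j t + (\<phi> + pi / 2))) * dLg j t) \<in> graded m \<zeta> (0 + 1)"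
    using assms by (intro graded_mult dLg_in_graded graded_amplitudes_real amplitudes.const amplitudes_trig) auto
  then show "(\<lambda>t. (w * cos (w * Lg j t + (\<phi> + pi / 2))) * dLg j t) \<in> graded m \<zeta> 1" by simp
  have [simp]: "cos (w * Lg j t + (\<phi> + pi / 2)) = - sin (w * Lg j t + \<phi>)" for t
    using cos_add[of "w * Lg j t + \<phi>" "pi / 2"] by (simp add: add.assoc)
  show "\<forall>\<^sub>F t in at_top. ((\<lambda>t. cos (w * Lg j t + \<phi>)) has_real_derivative
      (w * cos (w * Lg j t + (\<phi> + pi / 2))) * dLg j t) (at t)"
    using Lg_has_derivative[of j]
    by eventually_elim (auto intro!: derivative_eq_intros)
qed

lemma slow_powr:
  assumes "slow \<zeta>" shows "slow (\<lambda>t. \<zeta> t powr b)"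
proof -
  obtain z' where z': "\<forall>\<^sub>F t in at_top. (\<zeta> has_real_derivative z' t) (at t)" "z' \<in> graded m \<zeta> 1"
    using assms unfolding slow_def by blast
  show ?thesis
  proof (rule slow_I)
    show "\<forall>\<^sub>F t in at_top. ((\<lambda>t. \<zeta> t powr b) has_real_derivative
        (b * \<zeta> t powr (b - 1)) * z' t) (at t)"
      using z'(1) zeta_pos
      by eventually_elim (auto intro!: derivative_eq_intros simp: powr_diff)
    have "(\<lambda>t. (b * \<zeta> t powr (b - 1)) * z' t) \<in> graded m \<zeta> (0 + 1)"
      using z' by (intro graded_mult graded_amplitudes_real amplitudes.const amplitudes_zeta) auto
    then show "(\<lambda>t. (b * \<zeta> t powr (b - 1)) * z' t) \<in> graded m \<zeta> 1" by simp
  qed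
qed

end

text \<open>Slowness of \<zeta> means that its derivative lies in \<open>graded m \<zeta> 1\<close>,
  where powers of \<zeta> itself are allowed; it can be required only once this algebra is
  available.\<close>

locale slow_log_scale = log_scale +
  assumes zeta_slow: "slow \<zeta>"
begin

lemma slow_amplitudes: "s \<in> amplitudes m \<zeta> \<Longrightarrow> slow s"
proof (induction s rule: amplitudes.induct)
  case (const s c)
  have "(\<lambda>t. c) \<in> amplitudes m \<zeta>" using amplitudes.const[OF amplitudes.one, of c] by simp
  with const show ?case by (intro slow_mult slow_const graded_amplitudes_real)
next
  case (log j s a)
  then show ?case by (intro slow_mult slow_log graded_amplitudes_real amplitudes_log)
next
  case (zeta s b)
  then show ?case by (intro slow_mult slow_powr zeta_slow graded_amplitudes_real amplitudes_zeta)
next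
  case (trig j s w \<phi>)
  then show ?case by (intro slow_mult slow_trig graded_amplitudes_real amplitudes_trig)
qed (rule slow_const)

text \<open>Differentiation raises the order by one. For m = 0 the power of L_0 = t itself loses one
  degree; for m > 0 its derivative carries the negligible factor \<open>dLg m\<close>.\<close>

lemma amplitude_derivative:
  assumes "s \<in> amplitudes m \<zeta>"
  shows "\<exists>v'. (\<forall>\<^sub>F t in at_top. ((\<lambda>t. Lg m t powr (- a) * s t) has_real_derivative v' t) (at t)) \<and>
    v' \<in> graded m \<zeta> (a + 1)"
proof -
  obtain s' where s': "\<forall>\<^sub>F t in at_top. (s has_real_derivative s' t) (at t)" "s' \<in> graded m \<zeta> 1"
    using slow_amplitudes[OF assms] unfolding slow_def by blast
  have d: "(\<lambda>t. (- a) * (Lg m t powr (- (a + 1)) * dLg m t)) \<in> graded m \<zeta> (a + 1)"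
  proof (cases "m = 0")
    case True
    then have "dLg m = (\<lambda>t. 1)" by (simp add: dLg_def fun_eq_iff)
    then show ?thesis
      using graded_bounded_linear[OF bounded_linear_mult_right graded_powr[of m "a + 1"], of "- a"] by simp
  next
    case False
    have "(\<lambda>t. Lg m t powr (- (a + 1)) * dLg m t) \<in> graded m \<zeta> (a + 1)"
      using graded_mult[OF graded_powr[of m "a + 1"] dLg_in_graded[of m]] False by (auto intro: graded_mono)
    from graded_bounded_linear[OF bounded_linear_mult_right this] show ?thesis .
  qed
  have "(\<lambda>t. ((- a) * (Lg m t powr (- (a + 1)) * dLg m t)) * s t + s' t * Lg m t powr (- a))
      \<in> graded m \<zeta> (a + 1)"
    using graded_mult[OF d graded_amplitudes_real[OF assms]] graded_mult[OF s'(2) graded_powr[of m a]]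
    by (intro graded.add) (auto simp: add.commute)
  moreover have "\<forall>\<^sub>F t in at_top. ((\<lambda>t. Lg m t powr (- a) * s t) has_real_derivative
     ((- a) * (Lg m t powr (- (a + 1)) * dLg m t)) * s t + s' t * Lg m t powr (- a)) (at t)"
    using s'(1) Lg_has_derivative[of m] eventually_Lg_gt[of 0 m]
  proof eventually_elim
    case (elim t)
    then show ?case
      by (intro DERIV_mult) (auto intro!: derivative_eq_intros simp: powr_diff)
  qed
  ultimately show ?thesis by (intro exI conjI)
qed

text \<open>To leading order only the oscillation in \<open>t\<close> is differentiated, so that \<open>w' + A w = r\<close> becomes a
  linear system for the coefficients of \<open>cos\<close> and \<open>sin\<close>.\<close>

lemma graded_solve:
  fixes h :: "'x::real_normed_vector \<Rightarrow> 'x"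
  assumes h: "bounded_linear h"
    and ex: "\<And>w \<xi>. \<exists>a b. h a + w *\<^sub>R b = \<xi> \<and> h b = w *\<^sub>R a"
    and "r \<in> graded m \<zeta> M"
  shows "\<exists>u u'. u \<in> graded m \<zeta> M \<and> (\<forall>\<^sub>F t in at_top. (u has_vector_derivative u' t) (at t)) \<and>
    (\<lambda>t. u' t + h (u t) - r t) \<in> graded m \<zeta> (M + 1)"
  using assms(3)
proof (induction r rule: graded.induct)
  case (trm s a w \<phi> \<xi>)
  \<comment> \<open>These are the equations for the coefficients of cosine and sine when u = v (cos
    p + sin q) is inserted and v is treated as constant.\<close>
  obtain p q where pq: "h p + w *\<^sub>R q = \<xi>" "h q = w *\<^sub>R p" using ex by blast
  define v where "v t = Lg m t powr (- a) * s t" for t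
  obtain v' where v': "\<forall>\<^sub>F t in at_top. (v has_real_derivative v' t) (at t)" "v' \<in> graded m \<zeta> (a + 1)"
    using amplitude_derivative[OF trm(1), of a] unfolding v_def by blast
  have s: "sin x = cos (x - pi / 2)" for x :: real by (simp add: cos_diff)
  have tr: "(\<lambda>t. cos (w * t + \<phi>)) \<in> graded m \<zeta> 0" for \<phi>
  proof (rule graded_cong[OF graded.trm[OF amplitudes.one order_refl, where M = 0 and w = w and \<phi> = \<phi> and \<xi> = "1::real"]])
    show "\<forall>\<^sub>F t in at_top. cos (w * t + \<phi>) = (Lg m t powr - 0 * cos (w * t + \<phi>) * 1) *\<^sub>R 1"
      using eventually_Lg_gt[of 0 m] by eventually_elim simp
  qed
  have tr': "(\<lambda>t. sin (w * t + \<phi>)) \<in> graded m \<zeta> 0"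
    using tr[of "\<phi> - pi / 2"] by (simp add: s add_diff_eq)
  let ?c = "\<lambda>t. cos (w * t + \<phi>)" and ?s = "\<lambda>t. sin (w * t + \<phi>)"
  define u where "u t = (v t * ?c t) *\<^sub>R p + (v t * ?s t) *\<^sub>R q" for t
  define u' where "u' t = (v' t * ?c t - v t * (w * ?s t)) *\<^sub>R p
     + (v' t * ?s t + v t * (w * ?c t)) *\<^sub>R q" for t
  have "u = (\<lambda>t. (Lg m t powr (- a) * cos (w * t + \<phi>) * s t) *\<^sub>R p
     + (Lg m t powr (- a) * cos (w * t + (\<phi> - pi / 2)) * s t) *\<^sub>R q)"
    by (auto simp: u_def v_def fun_eq_iff s add_diff_eq mult_ac)
  then have "u \<in> graded m \<zeta> M" using trm by (auto intro!: graded.add graded.trm)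
  moreover have "\<forall>\<^sub>F t in at_top. (u has_vector_derivative u' t) (at t)"
    using v'(1)
  proof eventually_elim
    case (elim t)
    have 1: "((\<lambda>t. v t * ?c t) has_real_derivative v' t * ?c t - v t * (w * ?s t)) (at t)"
      "((\<lambda>t. v t * ?s t) has_real_derivative v' t * ?s t + v t * (w * ?c t)) (at t)"
      using elim by (auto intro!: derivative_eq_intros)
    show ?case unfolding u_def u'_def
      by (intro has_vector_derivative_add
          bounded_linear.has_vector_derivative[OF bounded_linear_scaleR_left]
          1[unfolded has_real_derivative_iff_has_vector_derivative])
  qed
  \<comment> \<open>All terms without v' cancel by the choice of p and q, and v' has order one
    higher.\<close>
  moreover have "u' t + h (u t) - (Lg m t powr (- a) * cos (w * t + \<phi>) * s t) *\<^sub>R \<xi>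
     = v' t *\<^sub>R (?c t *\<^sub>R p) + v' t *\<^sub>R (?s t *\<^sub>R q)" for t
    by (simp add: pq(1)[symmetric] u_def u'_def linear_simps[OF h] pq(2) v_def algebra_simps)
  moreover have "(\<lambda>t. v' t *\<^sub>R (?c t *\<^sub>R p) + v' t *\<^sub>R (?s t *\<^sub>R q)) \<in> graded m \<zeta> (a + 1 + 0)"
    by (intro graded.add graded_scaleR v'(2) graded_bounded_linear[OF bounded_linear_scaleR_left] tr tr')
  ultimately show ?case using trm(2)
    by (intro exI[of _ u] exI[of _ u']) (auto intro: graded_mono)
next
  case (add r1 r2)
  then obtain u1 u1' u2 u2' where u1: "u1 \<in> graded m \<zeta> M"
    "\<forall>\<^sub>F t in at_top. (u1 has_vector_derivative u1' t) (at t)"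
    "(\<lambda>t. u1' t + h (u1 t) - r1 t) \<in> graded m \<zeta> (M + 1)"
    and u2: "u2 \<in> graded m \<zeta> M"
    "\<forall>\<^sub>F t in at_top. (u2 has_vector_derivative u2' t) (at t)"
    "(\<lambda>t. u2' t + h (u2 t) - r2 t) \<in> graded m \<zeta> (M + 1)" by blast
  have "\<forall>\<^sub>F t in at_top. ((\<lambda>t. u1 t + u2 t) has_vector_derivative u1' t + u2' t) (at t)"
    using u1(2) u2(2) by eventually_elim (rule has_vector_derivative_add)
  moreover have "(\<lambda>t. (u1' t + u2' t) + h (u1 t + u2 t) - (r1 t + r2 t)) \<in> graded m \<zeta> (M + 1)"
    using graded.add[OF u1(3) u2(3)] by (simp add: linear_simps[OF h] algebra_simps)
  ultimately show ?case using graded.add[OF u1(1) u2(1)]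
    by (intro exI[of _ "\<lambda>t. u1 t + u2 t"] exI[of _ "\<lambda>t. u1' t + u2' t"]) simp
next
  case (neg r1 r2)
  then obtain u u' where u: "u \<in> graded m \<zeta> M"
    "\<forall>\<^sub>F t in at_top. (u has_vector_derivative u' t) (at t)"
    "(\<lambda>t. u' t + h (u t) - r1 t) \<in> graded m \<zeta> (M + 1)" by blast
  have "(\<lambda>t. u' t + h (u t) - r1 t - (r2 t - r1 t)) \<in> graded m \<zeta> (M + 1)"
    by (intro graded_diff u graded_negligible neg)
  with u show ?case by (intro exI[of _ u] exI[of _ u']) simp
qed

end

subsection \<open>Taylor expansion and homogeneous functions\<close>

text \<open>The homogeneous part of degree i of the Taylor expansion at x0. Euler's identity for
  this part, whose partial derivatives are the parts of degree i - 1 of the partial derivatives of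
  G, gives the recursion and avoids multilinear higher derivatives.\<close>

primrec taylor_poly ::
    "'a \<Rightarrow> nat \<Rightarrow> ('a::euclidean_space \<Rightarrow> 'b::real_normed_vector) \<Rightarrow> 'a \<Rightarrow> 'b" where
  "taylor_poly x0 0 G h = G x0"
| "taylor_poly x0 (Suc i) G h = (\<Sum>b\<in>Basis. (inverse (real (Suc i)) * (h \<bullet> b)) *\<^sub>R
     taylor_poly x0 i (\<lambda>x. frechet_derivative G (at x) b) h)"

lemma taylor_poly_scale:
  "taylor_poly x0 i G (s *\<^sub>R h) = s ^ i *\<^sub>R taylor_poly x0 i G h"
  by (induction i arbitrary: G) (simp_all add: scaleR_sum_right mult_ac del: of_nat_Suc)

lemma Ck_on_continuous: "Ck_on k S f \<Longrightarrow> continuous_on S f"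
  by (cases k) (auto intro: continuous_at_imp_continuous_on differentiable_imp_continuous_within)

lemma frechet_expand:
  fixes G :: "'a::euclidean_space \<Rightarrow> 'b::real_normed_vector"
  assumes "G differentiable (at x)"
  shows "frechet_derivative G (at x) h = (\<Sum>b\<in>Basis. (h \<bullet> b) *\<^sub>R frechet_derivative G (at x) b)"
proof -
  have lin: "linear (frechet_derivative G (at x))"
    using assms by (rule linear_frechet_derivative)
  have "frechet_derivative G (at x) h = frechet_derivative G (at x) (\<Sum>b\<in>Basis. (h \<bullet> b) *\<^sub>R b)"
    by (simp add: euclidean_representation)
  also have "\<dots> = (\<Sum>b\<in>Basis. (h \<bullet> b) *\<^sub>R frechet_derivative G (at x) b)"
    by (simp add: linear_sum[OF lin] linear_scale[OF lin])
  finally show ?thesis .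
qed

text \<open>Along the segment from x0 to x0 + h, the derivative of the remainder of G is the sum
  over b of h_b times the remainder of the partial derivative in direction b. The induction
  hypothesis and the mean value inequality yield one more power of |h|.\<close>

lemma taylor_remainder:
  fixes G :: "'a::euclidean_space \<Rightarrow> 'b::real_normed_vector"
  assumes "open U" "x0 \<in> U" "Ck_on N U G"
  shows "\<exists>C r. r > 0 \<and>
    (\<forall>h. norm h < r \<longrightarrow> norm (G (x0 + h) - (\<Sum>i<N. taylor_poly x0 i G h)) \<le> C * norm h ^ N)"
  using assms(3)
proof (induction N arbitrary: G)
  case 0
  have "isCont G x0"
    using 0 assms by (simp add: continuous_on_eq_continuous_at)
  then obtain r where r: "r > 0" "\<And>x. dist x x0 < r \<Longrightarrow> dist (G x) (G x0) < 1"
    unfolding continuous_at_eps_delta by (metis zero_less_one)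
  have "norm (G (x0 + h)) \<le> norm (G x0) + 1" if "norm h < r" for h
    using r(2)[of "x0 + h"] that norm_triangle_ineq2[of "G (x0 + h)" "G x0"]
    by (simp add: dist_norm)
  with r show ?case
    by (intro exI[of _ "norm (G x0) + 1"] exI[of _ r]) auto
next
  case (Suc N)
  define dG where "dG b x = frechet_derivative G (at x) b" for b x
  have diff: "G differentiable (at x)" if "x \<in> U" for x using Suc.prems that by simp
  define q where "q b i = taylor_poly x0 i (dG b)" for b i
  have ex: "\<exists>C r. r > 0 \<and>
    (\<forall>h. norm h < r \<longrightarrow> norm (dG b (x0 + h) - (\<Sum>i<N. q b i h)) \<le> C * norm h ^ N)" for b
    unfolding dG_def q_def using Suc.prems by (intro Suc.IH) simp
  obtain C r where r: "\<And>b. r b > (0::real)"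
    and C: "\<And>b h. norm h < r b \<Longrightarrow> norm (dG b (x0 + h) - (\<Sum>i<N. q b i h)) \<le> C b * norm h ^ N"
    using ex by metis
  have q_scale: "q b i (s *\<^sub>R h) = s ^ i *\<^sub>R q b i h" for b i s h
    unfolding q_def by (rule taylor_poly_scale)
  obtain \<rho> where \<rho>: "\<rho> > 0" "ball x0 \<rho> \<subseteq> U" using assms by (meson openE)
  define r0 where "r0 = Min (insert \<rho> (r ` Basis))"
  have r0: "r0 > 0" "r0 \<le> \<rho>" "\<And>b. b \<in> Basis \<Longrightarrow> r0 \<le> r b"
    using r \<rho> by (auto simp: r0_def simp del: Min_insert intro!: Min_le)
  define Q where "Q i = taylor_poly x0 i G" for i
  define K where "K = (\<Sum>b\<in>(Basis::'a set). \<bar>C b\<bar>)"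
  have "norm (G (x0 + h) - (\<Sum>i<Suc N. Q i h)) \<le> K * norm h ^ Suc N" if h: "norm h < r0" for h
  proof -
    \<comment> \<open>The remainder on the segment; it vanishes at s = 0, and s = 1 is the wanted
      value.\<close>
    define \<phi> where "\<phi> s = G (x0 + s *\<^sub>R h) - (\<Sum>i<Suc N. s ^ i *\<^sub>R Q i h)" for s
    define \<phi>' where "\<phi>' s = (\<Sum>b\<in>Basis. (h \<bullet> b) *\<^sub>R (dG b (x0 + s *\<^sub>R h) - (\<Sum>i<N. q b i (s *\<^sub>R h))))" for s
    have sh: "norm (s *\<^sub>R h) < r0" if "s \<in> {0..1}" for s
    proof -
      have "norm (s *\<^sub>R h) \<le> norm h" using that by (simp add: mult_left_le_one_le)
      with h show ?thesis by simp
    qed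
    have sum_eq: "(\<Sum>i<Suc N. (real i * s ^ (i - 1)) *\<^sub>R Q i h)
        = (\<Sum>b\<in>Basis. (h \<bullet> b) *\<^sub>R (\<Sum>i<N. q b i (s *\<^sub>R h)))" for s
    proof -
      have "(\<Sum>i<Suc N. (real i * s ^ (i - 1)) *\<^sub>R Q i h)
          = (\<Sum>i<N. (real (Suc i) * s ^ i) *\<^sub>R Q (Suc i) h)"
        by (subst sum.lessThan_Suc_shift) simp
      also have "\<dots> = (\<Sum>i<N. \<Sum>b\<in>Basis. (h \<bullet> b) *\<^sub>R q b i (s *\<^sub>R h))"
      proof (intro sum.cong refl)
        fix i
        have "real (Suc i) *\<^sub>R Q (Suc i) h = (\<Sum>b\<in>Basis. (h \<bullet> b) *\<^sub>R q b i h)"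
          by (simp add: Q_def q_def dG_def[abs_def] scaleR_sum_right mult.assoc[symmetric] del: of_nat_Suc)
        then have "(real (Suc i) * s ^ i) *\<^sub>R Q (Suc i) h = s ^ i *\<^sub>R (\<Sum>b\<in>Basis. (h \<bullet> b) *\<^sub>R q b i h)"
          by (metis mult.commute scaleR_scaleR)
        then show "(real (Suc i) * s ^ i) *\<^sub>R Q (Suc i) h = (\<Sum>b\<in>Basis. (h \<bullet> b) *\<^sub>R q b i (s *\<^sub>R h))"
          by (simp add: scaleR_sum_right q_scale mult_ac)
      qed
      also have "\<dots> = (\<Sum>b\<in>Basis. (h \<bullet> b) *\<^sub>R (\<Sum>i<N. q b i (s *\<^sub>R h)))"
        by (subst sum.swap) (simp add: scaleR_sum_right)
      finally show ?thesis .
    qed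
    have der: "(\<phi> has_vector_derivative \<phi>' s) (at s within {0..1})" if s: "s \<in> {0..1}" for s
    proof -
      have "x0 + s *\<^sub>R h \<in> U" using sh[OF s] r0 \<rho> by (auto simp: dist_norm)
      then have "(G has_derivative frechet_derivative G (at (x0 + s *\<^sub>R h))) (at (x0 + s *\<^sub>R h))"
        using diff frechet_derivative_works by blast
      then have "((\<lambda>s. G (x0 + s *\<^sub>R h)) has_vector_derivative dG h (x0 + s *\<^sub>R h)) (at s within {0..1})"
      proof -
        assume G: "(G has_derivative frechet_derivative G (at (x0 + s *\<^sub>R h))) (at (x0 + s *\<^sub>R h))"
        have "((\<lambda>s. x0 + s *\<^sub>R h) has_derivative (\<lambda>s. s *\<^sub>R h)) (at s within {0..1})"
          by (auto intro!: derivative_eq_intros)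
        from has_derivative_compose[OF this G] show ?thesis
          using linear_scale[OF has_derivative_linear[OF G]]
          by (simp add: has_vector_derivative_def dG_def)
      qed
      moreover have "((\<lambda>s. \<Sum>i<Suc N. s ^ i *\<^sub>R Q i h) has_vector_derivative
          (\<Sum>i<Suc N. (real i * s ^ (i - 1)) *\<^sub>R Q i h)) (at s within {0..1})"
        by (intro has_vector_derivative_sum
            bounded_linear.has_vector_derivative[OF bounded_linear_scaleR_left])
          (auto simp: has_real_derivative_iff_has_vector_derivative[symmetric]
            intro!: derivative_eq_intros)
      ultimately have "(\<phi> has_vector_derivative
          (dG h (x0 + s *\<^sub>R h) - (\<Sum>i<Suc N. (real i * s ^ (i - 1)) *\<^sub>R Q i h))) (at s within {0..1})"
        unfolding \<phi>_def by (rule has_vector_derivative_diff)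
      moreover have "dG h (x0 + s *\<^sub>R h) = (\<Sum>b\<in>Basis. (h \<bullet> b) *\<^sub>R dG b (x0 + s *\<^sub>R h))"
        unfolding dG_def by (rule frechet_expand[OF diff]) fact
      ultimately show ?thesis
        unfolding \<phi>'_def sum_eq by (simp add: scaleR_diff_right sum_subtractf)
    qed
    have bound: "norm (\<phi>' s) \<le> K * norm h ^ Suc N" if s: "s \<in> {0..1}" for s
    proof -
      have "norm (\<phi>' s) \<le> (\<Sum>b\<in>Basis. norm ((h \<bullet> b) *\<^sub>R (dG b (x0 + s *\<^sub>R h) - (\<Sum>i<N. q b i (s *\<^sub>R h)))))"
        unfolding \<phi>'_def by (rule norm_sum)
      also have "\<dots> \<le> (\<Sum>b\<in>Basis. norm h * (\<bar>C b\<bar> * norm h ^ N))"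
      proof (rule sum_mono)
        fix b :: 'a assume b: "b \<in> Basis"
        have "norm (dG b (x0 + s *\<^sub>R h) - (\<Sum>i<N. q b i (s *\<^sub>R h))) \<le> C b * norm (s *\<^sub>R h) ^ N"
          using sh[OF s] r0(3)[OF b] by (intro C) auto
        also have "\<dots> \<le> \<bar>C b\<bar> * norm h ^ N"
          using s by (intro mult_mono power_mono) (auto simp: mult_left_le_one_le)
        finally show "norm ((h \<bullet> b) *\<^sub>R (dG b (x0 + s *\<^sub>R h) - (\<Sum>i<N. q b i (s *\<^sub>R h))))
            \<le> norm h * (\<bar>C b\<bar> * norm h ^ N)"
          unfolding norm_scaleR using Basis_le_norm[OF b, of h] by (intro mult_mono) auto
      qed
      also have "\<dots> = K * norm h ^ Suc N"
        by (simp add: K_def sum_distrib_left[symmetric] sum_distrib_right[symmetric] mult_ac)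
      finally show ?thesis .
    qed
    have "norm (\<phi> 1 - \<phi> 0) \<le> (K * norm h ^ Suc N) * norm (1 - 0 :: real)"
    proof (rule differentiable_bound[of "{0..1}" \<phi> "\<lambda>s x. x *\<^sub>R \<phi>' s"])
      show "(\<phi> has_derivative (\<lambda>x. x *\<^sub>R \<phi>' s)) (at s within {0..1})" if "s \<in> {0..1}" for s
        using der[OF that] by (simp add: has_vector_derivative_def)
      show "onorm (\<lambda>x. x *\<^sub>R \<phi>' s) \<le> K * norm h ^ Suc N" if "s \<in> {0..1}" for s
      proof (rule onorm_le)
        show "norm (x *\<^sub>R \<phi>' s) \<le> K * norm h ^ Suc N * norm x" for x
          unfolding norm_scaleR using mult_left_mono[OF bound[OF that], of "\<bar>x\<bar>"] by (simp add: mult.commute)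
      qed
    qed auto
    moreover have "\<phi> 0 = 0"
      unfolding \<phi>_def by (subst sum.lessThan_Suc_shift) (simp add: Q_def)
    ultimately show ?thesis by (simp add: \<phi>_def)
  qed
  with r0(1) show ?case unfolding Q_def by (intro exI[of _ K] exI[of _ r0] conjI allI impI)
qed

lemma homogeneous_zero:
  assumes "G \<in> pos_homogeneous \<beta>" "\<beta> > 0"
  shows "G 0 = 0"
proof -
  have "G (t *\<^sub>R x) = (t powr \<beta>) *\<^sub>R G x" if "t > 0" for t x
    using assms(1) that by (simp add: pos_homogeneous_def)
  from this[of 2 0] have "G 0 = (2 powr \<beta>) *\<^sub>R G 0" by simp
  then have "(2 powr \<beta> - 1) *\<^sub>R G 0 = 0" by (simp add: scaleR_diff_left)
  moreover have "2 powr \<beta> \<noteq> (1::real)" using assms(2) by (simp add: powr_eq_one_iff)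
  ultimately show ?thesis by simp
qed

text \<open>C is a bound on the compact unit sphere, carried to all x by homogeneity.\<close>

lemma homogeneous_bound:
  fixes G :: "'a::euclidean_space \<Rightarrow> 'b::real_normed_vector"
  assumes "G \<in> pos_homogeneous \<beta>" "\<beta> > 0" "continuous_on (- {0}) G"
  shows "\<exists>C\<ge>0. \<forall>x. norm (G x) \<le> C * norm x powr \<beta>"
proof -
  have "continuous_on (sphere 0 1) G" using assms(3) by (rule continuous_on_subset) auto
  then have "compact (G ` sphere 0 1)" by (intro compact_continuous_image) auto
  then obtain C where C: "C > 0" "\<And>x. norm x = 1 \<Longrightarrow> norm (G x) \<le> C"
    using compact_imp_bounded bounded_pos by (metis dist_0_norm image_eqI mem_sphere)
  have "norm (G x) \<le> C * norm x powr \<beta>" for x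
  proof (cases "x = 0")
    case True
    then show ?thesis using homogeneous_zero[OF assms(1,2)] by simp
  next
    case False
    then have "G (norm x *\<^sub>R ((1 / norm x) *\<^sub>R x)) = (norm x powr \<beta>) *\<^sub>R G ((1 / norm x) *\<^sub>R x)"
      using assms(1) unfolding pos_homogeneous_def by (metis (mono_tags, lifting) mem_Collect_eq zero_less_norm_iff)
    with False have "norm (G x) = norm x powr \<beta> * norm (G ((1 / norm x) *\<^sub>R x))" by simp
    also have "\<dots> \<le> norm x powr \<beta> * C" using False by (intro mult_left_mono C(2)) simp_all
    finally show ?thesis by (simp add: mult.commute)
  qed
  with C show ?thesis by (intro exI[of _ C]) auto
qed

text \<open>Differentiate the identity G z = t^\<beta> G (z / t) at z = t x. The value 0 at the
  origin makes homogeneity hold there as well.\<close>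

lemma homogeneous_derivative:
  fixes G :: "'a::euclidean_space \<Rightarrow> 'b::real_normed_vector"
  assumes "G \<in> pos_homogeneous \<beta>" "\<And>x. x \<noteq> 0 \<Longrightarrow> G differentiable (at x)"
  shows "(\<lambda>x. if x = 0 then 0 else frechet_derivative G (at x) b) \<in> pos_homogeneous (\<beta> - 1)"
  unfolding pos_homogeneous_def
proof (safe)
  fix x :: 'a and t :: real assume t: "t > 0"
  show "(if t *\<^sub>R x = 0 then 0 else frechet_derivative G (at (t *\<^sub>R x)) b)
      = t powr (\<beta> - 1) *\<^sub>R (if x = 0 then 0 else frechet_derivative G (at x) b)"
  proof (cases "x = 0")
    case False
    have d: "(G has_derivative frechet_derivative G (at (inverse t *\<^sub>R (t *\<^sub>R x)))) (at (inverse t *\<^sub>R (t *\<^sub>R x)))"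
      using assms(2)[OF False] t frechet_derivative_works by auto
    have "((\<lambda>z. inverse t *\<^sub>R z) has_derivative (\<lambda>z. inverse t *\<^sub>R z)) (at (t *\<^sub>R x))"
      by (auto intro!: derivative_eq_intros)
    from has_derivative_compose[OF this d]
    have "((\<lambda>z. t powr \<beta> *\<^sub>R G (inverse t *\<^sub>R z)) has_derivative
        (\<lambda>z. t powr \<beta> *\<^sub>R frechet_derivative G (at x) (inverse t *\<^sub>R z))) (at (t *\<^sub>R x))"
      using t by (intro has_derivative_scaleR_right) simp
    moreover have "(\<lambda>z. t powr \<beta> *\<^sub>R G (inverse t *\<^sub>R z)) = G"
    proof
      fix z
      have "G (t *\<^sub>R (inverse t *\<^sub>R z)) = t powr \<beta> *\<^sub>R G (inverse t *\<^sub>R z)"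
        using assms(1) t unfolding pos_homogeneous_def by blast
      then show "t powr \<beta> *\<^sub>R G (inverse t *\<^sub>R z) = G z" using t by simp
    qed
    ultimately have "frechet_derivative G (at (t *\<^sub>R x))
        = (\<lambda>z. t powr \<beta> *\<^sub>R frechet_derivative G (at x) (inverse t *\<^sub>R z))"
      by (metis frechet_derivative_at)
    moreover have "linear (frechet_derivative G (at x))"
      using assms(2)[OF False] by (rule linear_frechet_derivative)
    ultimately show ?thesis
      using False t by (simp add: linear_scale powr_diff divide_inverse)
  qed simp
qed

text \<open>A positively homogeneous function of degree above one has derivative \<open>0\<close> at the origin, and its
  derivative is homogeneous of positive degree elsewhere.\<close>

lemma homogeneous_small_lipschitz:
  fixes G :: "'a::euclidean_space \<Rightarrow> 'b::real_normed_vector"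
  assumes G: "G \<in> pos_homogeneous \<beta>" and \<beta>: "\<beta> > 1" and sm: "smooth_on (- {0}) G" and \<epsilon>: "\<epsilon> > 0"
  shows "\<exists>r>0. \<forall>x y. norm x < r \<longrightarrow> norm y < r \<longrightarrow> norm (G x - G y) \<le> \<epsilon> * norm (x - y)"
proof -
  have C1: "Ck_on (Suc 0) (- {0}) G" using sm unfolding smooth_on_def by blast
  have diff: "G differentiable (at x)" if "x \<noteq> 0" for x using C1 that by simp
  define dG where "dG b x = (if x = 0 then 0 else frechet_derivative G (at x) b)" for b x
  have cont: "continuous_on (- {0}) (dG b)" for b
  proof -
    have "continuous_on (- {0}) (\<lambda>x. frechet_derivative G (at x) b)" using C1 by simp
    then show ?thesis by (rule continuous_on_eq) (auto simp: dG_def)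
  qed
  have hom: "dG b \<in> pos_homogeneous (\<beta> - 1)" for b
    unfolding dG_def by (rule homogeneous_derivative[OF G diff])
  obtain C where C: "\<And>b x. norm (dG b x) \<le> C b * norm x powr (\<beta> - 1)" "\<And>b. C b \<ge> 0"
    using homogeneous_bound[OF hom _ cont] \<beta> by (metis diff_gt_0_iff_gt)
  define K where "K = (\<Sum>b\<in>(Basis::'a set). C b)"
  have K: "K \<ge> 0" unfolding K_def using C(2) by (intro sum_nonneg)
  define G' where "G' x h = (if x = 0 then 0 else frechet_derivative G (at x) h)" for x h
  have G'_bound: "norm (G' x h) \<le> (K * norm x powr (\<beta> - 1)) * norm h" for x h
  proof (cases "x = 0")
    case False
    have "norm (G' x h) \<le> (\<Sum>b\<in>Basis. norm ((h \<bullet> b) *\<^sub>R dG b x))"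
      unfolding G'_def dG_def using False
      by (simp only: if_False frechet_expand[OF diff[OF False], of h] norm_sum)
    also have "\<dots> \<le> (\<Sum>b\<in>Basis. norm h * (C b * norm x powr (\<beta> - 1)))"
      unfolding norm_scaleR
      by (intro sum_mono mult_mono C) (auto simp: Basis_le_norm)
    also have "\<dots> = (K * norm x powr (\<beta> - 1)) * norm h"
      by (simp add: K_def sum_distrib_left sum_distrib_right mult_ac)
    finally show ?thesis .
  qed (simp add: G'_def)
  obtain C0 where C0: "C0 \<ge> 0" "\<And>x. norm (G x) \<le> C0 * norm x powr \<beta>"
    using homogeneous_bound[OF G _ Ck_on_continuous[OF C1]] \<beta> by (metis less_trans zero_less_one)
  have G0: "G 0 = 0" using homogeneous_zero[OF G] \<beta> by simp
  \<comment> \<open>A segment between two points of the ball may pass through the origin, so the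
    mean value inequality requires the derivative there too; it exists because \<beta> > 1.\<close>
  have d0: "(G has_derivative (\<lambda>h. 0)) (at 0)"
  proof (rule has_derivativeI)
    have "((\<lambda>y::'a. C0 * norm y powr (\<beta> - 1)) \<longlongrightarrow> C0 * 0 powr (\<beta> - 1)) (at 0)"
      using \<beta> by (intro tendsto_mult tendsto_powr' tendsto_norm_zero tendsto_ident_at tendsto_const) auto
    then have lim: "((\<lambda>y::'a. C0 * norm y powr (\<beta> - 1)) \<longlongrightarrow> 0) (at 0)" by simp
    have "norm (G y /\<^sub>R norm y) \<le> C0 * norm y powr (\<beta> - 1)" for y
    proof (cases "y = 0")
      case False
      then show ?thesis using C0(2)[of y] by (simp add: powr_diff field_simps)
    qed (simp add: G0)
    then have "((\<lambda>y. G y /\<^sub>R norm y) \<longlongrightarrow> 0) (at 0)"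
      by (intro Lim_null_comparison[OF _ lim]) auto
    then show "((\<lambda>y. (G y - G 0 - 0) /\<^sub>R norm (y - 0)) \<longlongrightarrow> 0) (at 0)"
      by (simp add: G0)
  qed simp
  have der: "(G has_derivative G' x) (at x)" for x
  proof (cases "x = 0")
    case True
    then show ?thesis using d0 by (simp add: G'_def[abs_def])
  next
    case False
    then show ?thesis using diff[OF False] by (simp add: G'_def[abs_def] frechet_derivative_works)
  qed
  have "((\<lambda>x. K * x powr (\<beta> - 1)) \<longlongrightarrow> K * 0 powr (\<beta> - 1)) (at_right 0)"
    using \<beta> by (intro tendsto_mult tendsto_powr' tendsto_ident_at tendsto_const)
      (auto simp: eventually_at_right_less eventually_at_filter)
  then have "((\<lambda>x. K * x powr (\<beta> - 1)) \<longlongrightarrow> 0) (at_right 0)" by simp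
  then have "\<forall>\<^sub>F x in at_right 0. K * x powr (\<beta> - 1) < \<epsilon>" using \<epsilon> by (rule order_tendstoD)
  then obtain r where r: "r > 0" "\<And>x. 0 < x \<Longrightarrow> x < r \<Longrightarrow> K * x powr (\<beta> - 1) < \<epsilon>"
    unfolding eventually_at_right_field by auto
  have r': "K * norm x powr (\<beta> - 1) \<le> \<epsilon>" if "norm x < r" for x :: 'a
    using r(2)[of "norm x"] that \<epsilon> by (cases "x = 0") auto
  have "norm (G x - G y) \<le> \<epsilon> * norm (x - y)" if xy: "norm x < r" "norm y < r" for x y
  proof (rule differentiable_bound[of "ball 0 r" G G'])
    show "(G has_derivative G' z) (at z within ball 0 r)" for z
      using der by (rule has_derivative_at_withinI)
    show "onorm (G' z) \<le> \<epsilon>" if "z \<in> ball 0 r" for z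
    proof (rule onorm_le)
      fix h
      show "norm (G' z h) \<le> \<epsilon> * norm h"
        using G'_bound[of z h] r'[of z] that
        by (meson mem_ball_0 mult_right_mono norm_ge_zero order_trans)
    qed
  qed (use xy in auto)
  with r(1) show ?thesis by blast
qed

subsection \<open>Decay estimates\<close>

text \<open>The weight L_m^a turns the inhomogeneity into a constant, at the price of the
  logarithmic derivative of the weight, which is small compared with the rate l for large t.\<close>

lemma gronwall_Lg:
  fixes v v' :: "real \<Rightarrow> real"
  assumes der: "\<forall>\<^sub>F t in at_top. (v has_real_derivative v' t) (at t)"
    and ineq: "\<forall>\<^sub>F t in at_top. v' t \<le> - l * v t + C * Lg m t powr (- a)"
    and pos: "\<forall>\<^sub>F t in at_top. 0 \<le> v t" and l: "l > 0"
  shows "\<exists>K. \<forall>\<^sub>F t in at_top. v t \<le> K * Lg m t powr (- a)"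
proof -
  define u where "u t = v t * Lg m t powr a" for t
  define u' where "u' t = v' t * Lg m t powr a + (a * Lg m t powr (a - 1) * dLg m t) * v t" for t
  have lg1: "\<forall>\<^sub>F t in at_top. \<forall>i\<in>{..<m}. 1 < Lg i t"
    by (intro eventually_ball_finite) (auto intro: eventually_Lg_gt)
  have "\<forall>\<^sub>F t in at_top. (u has_real_derivative u' t) (at t)"
    using der Lg_has_derivative[of m] eventually_Lg_gt[of 0 m]
  proof eventually_elim
    case (elim t)
    have "((\<lambda>t. Lg m t powr a) has_real_derivative a * Lg m t powr (a - 1) * dLg m t) (at t)"
      using elim by (auto intro!: derivative_eq_intros simp: powr_diff)
    from DERIV_mult[OF elim(1) this] show ?case unfolding u_def u'_def .
  qed
  \<comment> \<open>Beyond the threshold 2 |a| / l for L_m, differentiating the weight uses up at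
    most half of the rate l.\<close>
  moreover have "\<forall>\<^sub>F t in at_top. u' t \<le> - (l / 2) * u t + C"
    using ineq pos eventually_Lg_gt[of "max 1 (2 * \<bar>a\<bar> / l)" m] lg1
  proof eventually_elim
    case (elim t)
    then have Lpos: "Lg m t > 0" and La: "\<bar>a\<bar> \<le> l / 2 * Lg m t"
      using l by (auto simp: field_simps)
    have i: "0 \<le> Lg i t" "1 \<le> Lg i t" if "i < m" for i
      using elim(4) that by (force dest: bspec[of _ _ i])+
    have "0 \<le> dLg m t" "dLg m t \<le> 1"
      unfolding dLg_def by (auto intro!: prod_nonneg prod_le_1 simp: i inverse_le_1_iff)
    then have "a * dLg m t \<le> \<bar>a\<bar>" by (metis abs_ge_self abs_ge_zero abs_mult abs_of_nonneg mult_left_le order_trans)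
    with La have 1: "a * dLg m t \<le> l / 2 * Lg m t" by simp
    have "u' t \<le> (- l * v t + C * Lg m t powr (- a)) * Lg m t powr a
         + (a * dLg m t) * (Lg m t powr (a - 1) * v t)"
      unfolding u'_def using elim by (simp add: mult_ac mult_left_mono)
    also have "\<dots> \<le> (- l * v t + C * Lg m t powr (- a)) * Lg m t powr a
         + (l / 2 * Lg m t) * (Lg m t powr (a - 1) * v t)"
      using 1 elim by (intro add_left_mono mult_right_mono) auto
    also have "\<dots> = - (l / 2) * u t + C"
      using Lpos by (simp add: u_def powr_minus powr_diff field_simps)
    finally show ?case .
  qed
  ultimately have "\<forall>\<^sub>F t in at_top. (u has_real_derivative u' t) (at t) \<and> u' t \<le> - (l / 2) * u t + C"
    by eventually_elim simp
  then obtain t0 where t0: "\<And>t. t \<ge> t0 \<Longrightarrow> (u has_real_derivative u' t) (at t) \<and> u' t \<le> - (l / 2) * u t + C"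
    unfolding eventually_at_top_linorder by blast
  \<comment> \<open>The equilibrium 2 C / l of u' = - (l / 2) u + C is subtracted and the
    integrating factor applied, so that w is nonincreasing.\<close>
  define w where "w t = (u t - 2 * C / l) * exp (l / 2 * t)" for t
  have w: "w t \<le> w t0" if "t \<ge> t0" for t
  proof (rule DERIV_nonpos_imp_nonincreasing[OF that])
    fix x assume "t0 \<le> x"
    with t0 have d: "(u has_real_derivative u' x) (at x)" "u' x \<le> - (l / 2) * u x + C" by auto
    have "(w has_real_derivative (u' x + l / 2 * u x - C) * exp (l / 2 * x)) (at x)"
      unfolding w_def using d(1) l by (auto intro!: derivative_eq_intros simp: field_simps)
    moreover have "(u' x + l / 2 * u x - C) * exp (l / 2 * x) \<le> 0"
      using d(2) by (intro mult_nonpos_nonneg) auto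
    ultimately show "\<exists>y. (w has_real_derivative y) (at x) \<and> y \<le> 0" by blast
  qed
  have "\<forall>\<^sub>F t in at_top. v t \<le> (2 * C / l + \<bar>w t0\<bar>) * Lg m t powr (- a)"
    using eventually_ge_at_top[of t0] eventually_ge_at_top[of 0] eventually_Lg_gt[of 0 m]
  proof eventually_elim
    case (elim t)
    have "u t - 2 * C / l = w t * exp (- (l / 2 * t))" by (simp add: w_def exp_minus field_simps)
    also have "\<dots> \<le> \<bar>w t0\<bar> * exp (- (l / 2 * t))"
      using w[OF elim(1)] by (intro mult_right_mono) auto
    also have "\<dots> \<le> \<bar>w t0\<bar>" using elim l by (simp add: mult_left_le)
    finally have "u t \<le> 2 * C / l + \<bar>w t0\<bar>" by simp
    moreover have "v t = u t * Lg m t powr (- a)" using elim by (simp add: u_def powr_minus)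
    ultimately show ?case by (simp add: mult_right_mono)
  qed
  then show ?thesis by blast
qed

text \<open>B is an inner product that dominates the Euclidean one and for which A is
  coercive.\<close>

locale lyapunov =
  fixes A :: "'v::euclidean_space \<Rightarrow> 'v" and B :: "'v \<Rightarrow> 'v \<Rightarrow> real" and \<kappa> :: real
  assumes A_linear: "bounded_linear A"
    and B_bilinear: "bounded_bilinear B" and B_sym: "B x y = B y x"
    and B_norm: "(norm x)\<^sup>2 \<le> B x x"
    and B_coercive: "\<kappa> * B x x \<le> B x (A x)" and \<kappa>_pos: "\<kappa> > 0"
begin

text \<open>Testing the equations for a and b with B a and B b cancels the two coupling terms by
  symmetry. Coercivity then makes the block operator injective, hence surjective in finite
  dimension.\<close>

lemma A_cos_sin_solvable: "\<exists>a b. A a + w *\<^sub>R b = \<xi> \<and> A b = w *\<^sub>R a"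
proof -
  interpret A: bounded_linear A by (rule A_linear)
  interpret B: bounded_bilinear B by (rule B_bilinear)
  define L where "L = (\<lambda>(a, b). (A a + w *\<^sub>R b, A b - w *\<^sub>R a))"
  have lin: "linear L"
    by (rule linearI) (auto simp: L_def A.add A.scaleR algebra_simps)
  have "inj L"
  proof (subst linear_injective_0[OF lin], clarify)
    fix a b assume "L (a, b) = 0"
    then have 0: "A a + w *\<^sub>R b = 0" "A b - w *\<^sub>R a = 0" by (auto simp: L_def zero_prod_def)
    have "B a (A a + w *\<^sub>R b) + B b (A b - w *\<^sub>R a) = 0" unfolding 0 by (simp add: B.zero_right)
    then have "B a (A a) + B b (A b) = 0"
      by (simp add: B.add_right B.diff_right B.scaleR_right B_sym[of b a])
    with B_coercive[of a] B_coercive[of b] have "\<kappa> * (B a a + B b b) \<le> 0"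
      by (simp add: distrib_left)
    then have "B a a + B b b \<le> 0" using \<kappa>_pos by (simp add: mult_le_0_iff)
    then have "(norm a)\<^sup>2 + (norm b)\<^sup>2 \<le> 0" using B_norm[of a] B_norm[of b] by linarith
    then show "(a, b) = 0" by (simp add: sum_power2_le_zero_iff zero_prod_def)
  qed
  with lin have "surj L" by (intro linear_injective_imp_surjective) simp_all
  then obtain p where "L p = (\<xi>, 0)" by (metis surjD)
  then show ?thesis by (cases p) (auto simp: L_def)
qed

text \<open>An energy estimate for B w w. The number \<epsilon> depends only on B and \<kappa>, so
  it can be fixed before the truncation of F whose Lipschitz constant has to stay below it.\<close>

lemma decay:
  "\<exists>\<epsilon>>0. \<forall>w w' e a. (\<forall>\<^sub>F t in at_top. (w has_vector_derivative w' t) (at t)) \<longrightarrow>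
     (\<forall>\<^sub>F t in at_top. norm (w' t + A (w t)) \<le> \<epsilon> * norm (w t) + norm (e t :: 'v)) \<longrightarrow>
     log_bigo m a e \<longrightarrow> log_bigo m a w"
proof -
  interpret B: bounded_bilinear B by (rule B_bilinear)
  obtain K where K: "K > 0" "\<And>x y. norm (B x y) \<le> norm x * norm y * K"
    using B.pos_bounded by blast
  \<comment> \<open>The term \<epsilon> |w| then costs \<kappa>/2 |w|^2 in the derivative of the
    energy, and Young's inequality for the term with e costs as much again. Together they take
    \<kappa> B w w of the available 2 \<kappa> B w w.\<close>
  define \<epsilon> where "\<epsilon> = \<kappa> / (4 * K)"
  have \<epsilon>: "\<epsilon> > 0" using K \<kappa>_pos by (simp add: \<epsilon>_def)
  have "log_bigo m a w" if der: "\<forall>\<^sub>F t in at_top. (w has_vector_derivative w' t) (at t)"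
    and bd: "\<forall>\<^sub>F t in at_top. norm (w' t + A (w t)) \<le> \<epsilon> * norm (w t) + norm (e t)"
    and e: "log_bigo m a e" for w w' :: "real \<Rightarrow> 'v" and e :: "real \<Rightarrow> 'v" and a
  proof -
    obtain C where C: "C > 0" "\<forall>\<^sub>F t in at_top. norm (e t) \<le> C * Lg m t powr (- a)"
      using log_bigo_E[OF e] by blast
    have "\<forall>\<^sub>F t in at_top. ((\<lambda>t. B (w t) (w t)) has_real_derivative 2 * B (w t) (w' t)) (at t)"
      using der
    proof eventually_elim
      case (elim t)
      from B.has_vector_derivative[OF elim elim] show ?case
        by (simp add: has_real_derivative_iff_has_vector_derivative B_sym[of "w' t"])
    qed
    moreover have "\<forall>\<^sub>F t in at_top. 2 * B (w t) (w' t)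
        \<le> - \<kappa> * B (w t) (w t) + (2 * K\<^sup>2 / \<kappa> * C\<^sup>2) * Lg m t powr (- (2 * a))"
      using bd C(2)
    proof eventually_elim
      case (elim t)
      let ?n = "norm (w t)" and ?E = "C * Lg m t powr (- a)"
      have n2: "?n\<^sup>2 \<le> B (w t) (w t)" by (rule B_norm)
      have "B (w t) (w' t) = B (w t) (w' t + A (w t)) - B (w t) (A (w t))"
        by (simp add: B.add_right)
      also have "B (w t) (w' t + A (w t)) \<le> ?n * norm (w' t + A (w t)) * K"
        using K(2)[of "w t" "w' t + A (w t)"] by simp
      also have "\<dots> \<le> ?n * (\<epsilon> * ?n + ?E) * K"
        using elim K(1) by (intro mult_right_mono mult_left_mono) auto
      also have "\<dots> = \<kappa> / 4 * ?n\<^sup>2 + K * ?n * ?E"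
        using K(1) by (simp add: \<epsilon>_def field_simps power2_eq_square)
      finally have 1: "2 * B (w t) (w' t) \<le> \<kappa> / 2 * ?n\<^sup>2 + 2 * K * ?n * ?E - 2 * \<kappa> * B (w t) (w t)"
        using B_coercive[of "w t"] by simp
      have "0 \<le> (\<kappa> * ?n - 2 * K * ?E)\<^sup>2 / (2 * \<kappa>)" using \<kappa>_pos by simp
      also have "\<dots> = \<kappa> / 2 * ?n\<^sup>2 + 2 * K\<^sup>2 / \<kappa> * ?E\<^sup>2 - 2 * K * ?n * ?E"
        using \<kappa>_pos by (simp add: power2_diff power_mult_distrib field_simps power2_eq_square)
      finally have 2: "2 * K * ?n * ?E \<le> \<kappa> / 2 * ?n\<^sup>2 + 2 * K\<^sup>2 / \<kappa> * ?E\<^sup>2" by simp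
      have 3: "?E\<^sup>2 = C\<^sup>2 * Lg m t powr (- (2 * a))"
        by (simp add: power_mult_distrib power2_eq_square flip: powr_add)
      have "\<kappa> * ?n\<^sup>2 \<le> \<kappa> * B (w t) (w t)" using n2 \<kappa>_pos by simp
      with 1 2 show ?case unfolding 3 by simp
    qed
    moreover have nn: "0 \<le> B x x" for x using B_norm[of x] by (meson order_trans zero_le_power2)
    ultimately have "\<exists>K'. \<forall>\<^sub>F t in at_top. B (w t) (w t) \<le> K' * Lg m t powr (- (2 * a))"
      by (intro gronwall_Lg[where l = \<kappa> and C = "2 * K\<^sup>2 / \<kappa> * C\<^sup>2"]) (simp_all add: \<kappa>_pos)
    then obtain K' where K': "\<forall>\<^sub>F t in at_top. B (w t) (w t) \<le> K' * Lg m t powr (- (2 * a))" ..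
    have "\<forall>\<^sub>F t in at_top. norm (w t) \<le> sqrt \<bar>K'\<bar> * Lg m t powr (- a)"
      using K'
    proof eventually_elim
      case (elim t)
      have "(norm (w t))\<^sup>2 \<le> K' * Lg m t powr (- (2 * a))" using B_norm elim order_trans by blast
      also have "\<dots> \<le> \<bar>K'\<bar> * Lg m t powr (- (2 * a))" by (intro mult_right_mono) auto
      also have "\<dots> = (sqrt \<bar>K'\<bar> * Lg m t powr (- a))\<^sup>2"
        by (simp add: power_mult_distrib) (simp add: power2_eq_square flip: powr_add)
      finally show ?case by (rule power2_le_imp_le) simp
    qed
    then show ?thesis by (rule log_bigo_I)
  qed
  with \<epsilon> show ?thesis by blast
qed

end

section \<open>Taylor polynomials along graded functions\<close>

context log_scale
begin

lemma taylor_poly_graded: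
  assumes "H \<in> graded m \<zeta> \<delta>"
  shows "(\<lambda>t. taylor_poly x0 i G (H t)) \<in> graded m \<zeta> (real i * \<delta>)"
proof (induction i arbitrary: G)
  case 0
  show ?case using graded_amplitudes[OF amplitudes.one, of "G x0"] by simp
next
  case (Suc i)
  have 1: "(\<lambda>t. inverse (real (Suc i)) * (H t \<bullet> b)) \<in> graded m \<zeta> \<delta>" for b
    by (rule graded_bounded_linear[OF bounded_linear_const_mult[OF bounded_linear_inner_left] assms])
  show ?case unfolding taylor_poly.simps
  proof (rule graded_sum)
    fix b :: 'a
    from graded_scaleR[OF 1 Suc] show "(\<lambda>t. (inverse (real (Suc i)) * (H t \<bullet> b)) *\<^sub>R
        taylor_poly x0 i (\<lambda>x. frechet_derivative G (at x) b) (H t)) \<in> graded m \<zeta> (real (Suc i) * \<delta>)"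
      by (simp add: distrib_right)
  qed simp
qed

text \<open>Telescoping over the linear factors: each term contains one difference, of order M, and
  the remaining factors have nonnegative order.\<close>

lemma taylor_poly_graded_diff:
  assumes "H \<in> graded m \<zeta> \<delta>" "H' \<in> graded m \<zeta> \<delta>" "(\<lambda>t. H' t - H t) \<in> graded m \<zeta> M" "\<delta> \<ge> 0"
  shows "(\<lambda>t. taylor_poly x0 i G (H' t) - taylor_poly x0 i G (H t)) \<in> graded m \<zeta> M"
proof (induction i arbitrary: G)
  case 0
  show ?case by (simp add: graded_zero)
next
  case (Suc i)
  let ?c = "\<lambda>x b. inverse (real (Suc i)) * (x \<bullet> b)"
  let ?G = "\<lambda>b x. frechet_derivative G (at x) b"
  have 1: "(\<lambda>t. ?c (H' t - H t) b) \<in> graded m \<zeta> M" for b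
    by (rule graded_bounded_linear[OF bounded_linear_const_mult[OF bounded_linear_inner_left] assms(3)])
  have 2: "(\<lambda>t. ?c (H t) b) \<in> graded m \<zeta> \<delta>" for b
    by (rule graded_bounded_linear[OF bounded_linear_const_mult[OF bounded_linear_inner_left] assms(1)])
  have "taylor_poly x0 (Suc i) G (H' t) - taylor_poly x0 (Suc i) G (H t) =
    (\<Sum>b\<in>Basis. ?c (H' t - H t) b *\<^sub>R taylor_poly x0 i (?G b) (H' t) +
       ?c (H t) b *\<^sub>R (taylor_poly x0 i (?G b) (H' t) - taylor_poly x0 i (?G b) (H t)))" for t
    unfolding taylor_poly.simps sum_subtractf[symmetric]
    by (intro sum.cong refl) (simp add: inner_diff_left algebra_simps del: of_nat_Suc)
  moreover have "(\<lambda>t. \<Sum>b\<in>Basis. ?c (H' t - H t) b *\<^sub>R taylor_poly x0 i (?G b) (H' t) +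
       ?c (H t) b *\<^sub>R (taylor_poly x0 i (?G b) (H' t) - taylor_poly x0 i (?G b) (H t))) \<in> graded m \<zeta> M"
  proof (intro graded_sum graded.add finite_Basis)
    fix b :: 'a
    show "(\<lambda>t. ?c (H' t - H t) b *\<^sub>R taylor_poly x0 i (?G b) (H' t)) \<in> graded m \<zeta> M"
      by (rule graded_mono[OF graded_scaleR[OF 1 taylor_poly_graded[OF assms(2)]]]) (use assms(4) in simp)
    show "(\<lambda>t. ?c (H t) b *\<^sub>R (taylor_poly x0 i (?G b) (H' t) - taylor_poly x0 i (?G b) (H t))) \<in> graded m \<zeta> M"
      by (rule graded_mono[OF graded_scaleR[OF 2 Suc]]) (use assms(4) in simp)
  qed
  ultimately show ?case by simp
qed

end

subsection \<open>The formal solution\<close>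

text \<open>The expansions of F and f are required for all large N only, since for finite expansions
  padded with zeros they are derived beyond the number of given terms.\<close>

locale newton = slow_log_scale m \<zeta> + lyapunov A B \<kappa>
  for m \<zeta> and A :: "'v::euclidean_space \<Rightarrow> 'v" and B \<kappa> +
  fixes F :: "'v \<Rightarrow> 'v" and Fk :: "nat \<Rightarrow> 'v \<Rightarrow> 'v" and \<beta> :: "nat \<Rightarrow> real"
    and f :: "real \<Rightarrow> 'v" and fk :: "nat \<Rightarrow> real \<Rightarrow> 'v" and \<gamma> :: "nat \<Rightarrow> real"
    and x0 :: 'v and \<delta> :: real
  assumes F_zero: "F 0 = 0"
    and Fk_hom: "k \<ge> 1 \<Longrightarrow> Fk k \<in> pos_homogeneous (\<beta> k)"
    and Fk_smooth: "k \<ge> 1 \<Longrightarrow> smooth_on (- {0}) (Fk k)"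
    and \<beta>_gt: "k \<ge> 1 \<Longrightarrow> \<beta> k > 1"
    and \<beta>_lim: "filterlim \<beta> at_top sequentially"
    and F_expansion: "\<forall>\<^sub>F N in sequentially. \<exists>C r. r > 0 \<and>
      (\<forall>x. norm x < r \<longrightarrow> norm (F x - (\<Sum>k=1..N. Fk k x)) \<le> C * norm x powr \<beta> N)"
    and fk_graded: "k \<ge> 1 \<Longrightarrow> fk k \<in> graded m \<zeta> (\<gamma> k)"
    and fk_1: "\<forall>\<^sub>F t in at_top. fk 1 t = (Lg m t powr (- \<gamma> 1) * \<zeta> t) *\<^sub>R A x0"
    and \<gamma>_1: "\<gamma> 1 > 0"
    and \<gamma>_lim: "filterlim \<gamma> at_top sequentially"
    and f_expansion: "\<forall>\<^sub>F N in sequentially. log_bigo m (\<gamma> N) (\<lambda>t. f t - (\<Sum>k=1..N. fk k t))"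
    and x0: "x0 \<noteq> 0"
    and \<delta>: "\<delta> > 0" "\<delta> \<le> 1" "k \<ge> 1 \<Longrightarrow> \<delta> \<le> \<gamma> 1 * (\<beta> k - 1)" "k \<ge> 2 \<Longrightarrow> \<gamma> 1 + \<delta> \<le> \<gamma> k"
begin

sublocale A: bounded_linear A
  by (rule A_linear)

text \<open>The b-th power of the leading size L_m^(-\<gamma>_1) \<zeta>, written as a monomial so
  that it belongs to the algebra for every real b, including b = -1.\<close>

definition P :: "real \<Rightarrow> real \<Rightarrow> real" where
  "P b t = Lg m t powr (- (\<gamma> 1 * b)) * \<zeta> t powr b"

lemma P_graded: "P b \<in> graded m \<zeta> (\<gamma> 1 * b)"
  using graded_mult[OF graded_powr[of m "\<gamma> 1 * b"] graded_amplitudes_real[OF amplitudes_zeta[where b = b]]] by (simp add: P_def[abs_def])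

lemma P_1_eq: "\<forall>\<^sub>F t in at_top. P 1 t = Lg m t powr (- \<gamma> 1) * \<zeta> t"
  using zeta_pos by eventually_elim (simp add: P_def)

lemma P_eq: "\<forall>\<^sub>F t in at_top. P 1 t > 0 \<and> P (- 1) t = inverse (P 1 t) \<and> P b t = P 1 t powr b"
  using zeta_pos eventually_Lg_gt[of 0 m] P_1_eq
proof eventually_elim
  case (elim t)
  have "P b t = P 1 t powr b" using elim by (simp add: P_def powr_mult powr_powr)
  moreover have "P (- 1) t = inverse (P 1 t)" using elim by (simp add: P_def powr_minus)
  ultimately show ?case using elim by simp
qed

definition H :: "(real \<Rightarrow> 'v) \<Rightarrow> real \<Rightarrow> 'v" where
  "H S t = P (- 1) t *\<^sub>R S t - x0"

definition Fpart :: "nat \<Rightarrow> 'v \<Rightarrow> 'v" where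
  "Fpart N x = (\<Sum>k=1..N. Fk k x)"

definition fpart :: "nat \<Rightarrow> real \<Rightarrow> 'v" where
  "fpart N t = (\<Sum>k=1..N. fk k t)"

text \<open>The stand-in for F(S) inside the algebra: homogeneity extracts the power of P, and the
  Taylor parts at x0 replace the smooth factor. The one parameter N truncates both sums.\<close>

definition \<Phi> :: "nat \<Rightarrow> (real \<Rightarrow> 'v) \<Rightarrow> real \<Rightarrow> 'v" where
  "\<Phi> N S t = (\<Sum>(k, i)\<in>{1..N} \<times> {..<N}. P (\<beta> k) t *\<^sub>R taylor_poly x0 i (Fk k) (H S t))"

text \<open>The residual uses the truncations \<open>\<Phi> N\<close> and \<open>fpart N\<close> in
  place of F and f, so that it lies in the algebra and no solution enters. Terms added by enlarging
  N are of high order, which is why all large N are asked for at once.\<close>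

definition approx_sol :: "real \<Rightarrow> (real \<Rightarrow> 'v) \<Rightarrow> bool" where
  "approx_sol M S \<longleftrightarrow> H S \<in> graded m \<zeta> \<delta> \<and> (\<exists>S'.
     (\<forall>\<^sub>F t in at_top. (S has_vector_derivative S' t) (at t)) \<and>
     (\<forall>\<^sub>F N in sequentially. (\<lambda>t. S' t + A (S t) - \<Phi> N S t - fpart N t) \<in> graded m \<zeta> M))"

lemma \<Phi>_term_graded:
  assumes "H S \<in> graded m \<zeta> \<delta>"
  shows "(\<lambda>t. P b t *\<^sub>R taylor_poly x0 i G (H S t)) \<in> graded m \<zeta> (\<gamma> 1 * b + real i * \<delta>)"
  by (rule graded_scaleR[OF P_graded taylor_poly_graded[OF assms]])

text \<open>Applying A to P x0 reproduces the first term of the forcing. What is left is the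
  derivative of P, the nonlinear terms, and the later terms of the forcing; each gains at least
  \<delta> over \<gamma>_1.\<close>

lemma approx_sol_base: "approx_sol (\<gamma> 1 + \<delta>) (\<lambda>t. P 1 t *\<^sub>R x0)"
  unfolding approx_sol_def
proof (intro conjI)
  let ?S = "\<lambda>t. P 1 t *\<^sub>R x0"
  show H: "H ?S \<in> graded m \<zeta> \<delta>"
  proof (rule graded_cong[OF graded_zero])
    show "\<forall>\<^sub>F t in at_top. H ?S t = 0"
      using P_eq[of 0] by eventually_elim (simp add: H_def)
  qed
  obtain v' where v': "\<forall>\<^sub>F t in at_top. (P 1 has_real_derivative v' t) (at t)" "v' \<in> graded m \<zeta> (\<gamma> 1 + 1)"
    using amplitude_derivative[OF amplitudes_zeta[of \<zeta> 1 m], of "\<gamma> 1 * 1"] unfolding P_def by auto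
  show "\<exists>S'. (\<forall>\<^sub>F t in at_top. (?S has_vector_derivative S' t) (at t)) \<and>
     (\<forall>\<^sub>F N in sequentially. (\<lambda>t. S' t + A (?S t) - \<Phi> N ?S t - fpart N t) \<in> graded m \<zeta> (\<gamma> 1 + \<delta>))"
  proof (intro exI conjI)
    show "\<forall>\<^sub>F t in at_top. (?S has_vector_derivative v' t *\<^sub>R x0) (at t)"
      using v'(1)
      by eventually_elim (rule bounded_linear.has_vector_derivative[OF bounded_linear_scaleR_left],
          simp add: has_real_derivative_iff_has_vector_derivative)
    show "\<forall>\<^sub>F N in sequentially. (\<lambda>t. v' t *\<^sub>R x0 + A (?S t) - \<Phi> N ?S t - fpart N t) \<in> graded m \<zeta> (\<gamma> 1 + \<delta>)"
      using eventually_ge_at_top[of 1]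
    proof eventually_elim
      case (elim N)
      have 1: "(\<lambda>t. v' t *\<^sub>R x0) \<in> graded m \<zeta> (\<gamma> 1 + \<delta>)"
        by (rule graded_mono[OF graded_bounded_linear[OF bounded_linear_scaleR_left v'(2)]]) (use \<delta> in simp)
      have 2: "\<Phi> N ?S \<in> graded m \<zeta> (\<gamma> 1 + \<delta>)"
        unfolding \<Phi>_def[abs_def]
      proof (rule graded_sum, simp, clarify)
        fix k i assume k: "k \<in> {1..N}"
        have "\<gamma> 1 + \<delta> \<le> \<gamma> 1 * \<beta> k + real i * \<delta>"
        proof -
          have "0 \<le> real i * \<delta>" using \<delta>(1) by simp
          with \<delta>(3)[of k] k show ?thesis by (simp add: right_diff_distrib)
        qed
        then show "(\<lambda>t. P (\<beta> k) t *\<^sub>R taylor_poly x0 i (Fk k) (H ?S t)) \<in> graded m \<zeta> (\<gamma> 1 + \<delta>)"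
          by (rule graded_mono[OF \<Phi>_term_graded[OF H]])
      qed
      have 3: "(\<lambda>t. \<Sum>k=2..N. fk k t) \<in> graded m \<zeta> (\<gamma> 1 + \<delta>)"
      proof (intro graded_sum finite_atLeastAtMost)
        fix k assume "k \<in> {2..N}"
        then show "fk k \<in> graded m \<zeta> (\<gamma> 1 + \<delta>)" using graded_mono[OF fk_graded \<delta>(4), of k] by simp
      qed
      have "(\<lambda>t. v' t *\<^sub>R x0 - \<Phi> N ?S t - (\<Sum>k=2..N. fk k t)) \<in> graded m \<zeta> (\<gamma> 1 + \<delta>)"
        by (intro graded_diff 1 2 3)
      then show ?case
      proof (rule graded_cong)
        show "\<forall>\<^sub>F t in at_top. v' t *\<^sub>R x0 + A (?S t) - \<Phi> N ?S t - fpart N t =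
            v' t *\<^sub>R x0 - \<Phi> N ?S t - (\<Sum>k=2..N. fk k t)"
          using fk_1 P_1_eq
        proof eventually_elim
          case (elim t)
          have "fpart N t = fk 1 t + (\<Sum>k=2..N. fk k t)"
            unfolding fpart_def using \<open>1 \<le> N\<close> by (subst sum.atLeast_Suc_atMost) (auto simp: numeral_2_eq_2)
          with elim show ?case by (simp add: A.scaleR)
        qed
      qed
    qed
  qed
qed

text \<open>\<open>W\<close> solves W' + A W = - R up to order M + 1, R being the residual of
  \<open>S\<close>. The new residual collects this error, the effect of \<open>W\<close> on the
  nonlinear terms, and the terms between the truncations at \<open>N1\<close> and N. The lower bound
  on M keeps the relative correction \<open>H\<close> of order \<delta>.\<close>

lemma approx_sol_step:
  assumes S: "approx_sol M S" and M: "\<gamma> 1 + \<delta> \<le> M"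
  shows "\<exists>W. W \<in> graded m \<zeta> M \<and> approx_sol (M + \<delta>) (\<lambda>t. S t + W t)"
proof -
  from S obtain S' where H: "H S \<in> graded m \<zeta> \<delta>"
    and S': "\<forall>\<^sub>F t in at_top. (S has_vector_derivative S' t) (at t)"
    and res: "\<forall>\<^sub>F N in sequentially. (\<lambda>t. S' t + A (S t) - \<Phi> N S t - fpart N t) \<in> graded m \<zeta> M"
    unfolding approx_sol_def by blast
  have "\<forall>\<^sub>F N in sequentially. (M + \<delta>) / \<gamma> 1 \<le> \<beta> N"
    using \<beta>_lim by (simp add: filterlim_at_top)
  moreover have "\<forall>\<^sub>F N in sequentially. M + \<delta> \<le> \<gamma> N"
    using \<gamma>_lim by (simp add: filterlim_at_top)
  moreover have "\<forall>\<^sub>F N in sequentially. (M + \<delta>) / \<delta> \<le> real N"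
    using filterlim_real_sequentially by (simp add: filterlim_at_top)
  ultimately have "\<forall>\<^sub>F N in sequentially. M + \<delta> \<le> \<gamma> 1 * \<beta> N \<and> M + \<delta> \<le> \<gamma> N \<and> M + \<delta> \<le> real N * \<delta> \<and>
      (\<lambda>t. S' t + A (S t) - \<Phi> N S t - fpart N t) \<in> graded m \<zeta> M"
    using res by eventually_elim (use \<gamma>_1 \<delta>(1) in \<open>simp add: field_simps\<close>)
  then obtain N1 where N1: "\<And>N. N \<ge> N1 \<Longrightarrow> M + \<delta> \<le> \<gamma> 1 * \<beta> N \<and> M + \<delta> \<le> \<gamma> N \<and> M + \<delta> \<le> real N * \<delta> \<and>
      (\<lambda>t. S' t + A (S t) - \<Phi> N S t - fpart N t) \<in> graded m \<zeta> M"
    unfolding eventually_sequentially by blast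
  define R where "R t = S' t + A (S t) - \<Phi> N1 S t - fpart N1 t" for t
  have "(\<lambda>t. - R t) \<in> graded m \<zeta> M" using N1[of N1] by (intro graded_minus) (simp add: R_def)
  from graded_solve[OF A_linear A_cos_sin_solvable this] obtain W W' where W: "W \<in> graded m \<zeta> M"
    "\<forall>\<^sub>F t in at_top. (W has_vector_derivative W' t) (at t)"
    "(\<lambda>t. W' t + A (W t) - (- R t)) \<in> graded m \<zeta> (M + 1)" by blast
  let ?S2 = "\<lambda>t. S t + W t"
  have H2_eq: "H ?S2 t - H S t = P (- 1) t *\<^sub>R W t" for t
    by (simp add: H_def scaleR_add_right)
  have dH: "(\<lambda>t. H ?S2 t - H S t) \<in> graded m \<zeta> (M - \<gamma> 1)"
    unfolding H2_eq using graded_scaleR[OF P_graded[of "- 1"] W(1)] by simp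
  have "(\<lambda>t. H S t + (H ?S2 t - H S t)) \<in> graded m \<zeta> \<delta>"
    by (intro graded.add H graded_mono[OF dH]) (use M in simp)
  then have H2: "H ?S2 \<in> graded m \<zeta> \<delta>" by simp
  have "approx_sol (M + \<delta>) ?S2"
    unfolding approx_sol_def
  proof (intro conjI exI[of _ "\<lambda>t. S' t + W' t"] H2)
    show "\<forall>\<^sub>F t in at_top. (?S2 has_vector_derivative S' t + W' t) (at t)"
      using S' W(2) by eventually_elim (rule has_vector_derivative_add)
    show "\<forall>\<^sub>F N in sequentially. (\<lambda>t. S' t + W' t + A (?S2 t) - \<Phi> N ?S2 t - fpart N t) \<in> graded m \<zeta> (M + \<delta>)"
      using eventually_ge_at_top[of N1]
    proof eventually_elim
      case (elim N)
      have 1: "(\<lambda>t. W' t + A (W t) - (- R t)) \<in> graded m \<zeta> (M + \<delta>)"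
        by (rule graded_mono[OF W(3)]) (use \<delta>(2) in simp)
      have 2: "(\<lambda>t. \<Phi> N ?S2 t - \<Phi> N S t) \<in> graded m \<zeta> (M + \<delta>)"
      proof -
        have "\<Phi> N ?S2 t - \<Phi> N S t = (\<Sum>(k, i)\<in>{1..N} \<times> {..<N}. P (\<beta> k) t *\<^sub>R
            (taylor_poly x0 i (Fk k) (H ?S2 t) - taylor_poly x0 i (Fk k) (H S t)))" for t
          by (simp add: \<Phi>_def sum_subtractf[symmetric] split_def scaleR_diff_right)
        moreover have "(\<lambda>t. \<Sum>(k, i)\<in>{1..N} \<times> {..<N}. P (\<beta> k) t *\<^sub>R
            (taylor_poly x0 i (Fk k) (H ?S2 t) - taylor_poly x0 i (Fk k) (H S t))) \<in> graded m \<zeta> (M + \<delta>)"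
        proof (rule graded_sum, simp, clarify)
          fix k i assume k: "k \<in> {1..N}"
          \<comment> \<open>Dividing by P inside \<open>H\<close> costs \<gamma>_1, and the factor
            P^\<beta>_k returns \<gamma>_1 \<beta>_k, a net gain of at least \<delta>.\<close>
          have "(\<lambda>t. taylor_poly x0 i (Fk k) (H ?S2 t) - taylor_poly x0 i (Fk k) (H S t)) \<in> graded m \<zeta> (M - \<gamma> 1)"
            using taylor_poly_graded_diff[OF H H2 dH] \<delta>(1) by simp
          from graded_scaleR[OF P_graded[of "\<beta> k"] this]
          show "(\<lambda>t. P (\<beta> k) t *\<^sub>R (taylor_poly x0 i (Fk k) (H ?S2 t) -
              taylor_poly x0 i (Fk k) (H S t))) \<in> graded m \<zeta> (M + \<delta>)"
            by (rule graded_mono) (use \<delta>(3)[of k] k in \<open>simp add: algebra_simps\<close>)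
        qed
        ultimately show ?thesis by simp
      qed
      have 3: "(\<lambda>t. \<Phi> N S t - \<Phi> N1 S t) \<in> graded m \<zeta> (M + \<delta>)"
      proof -
        let ?I = "{1..N} \<times> {..<N} - {1..N1} \<times> {..<N1}"
        have "\<Phi> N S t - \<Phi> N1 S t = (\<Sum>(k, i)\<in>?I. P (\<beta> k) t *\<^sub>R taylor_poly x0 i (Fk k) (H S t))" for t
          unfolding \<Phi>_def using elim by (subst sum.subset_diff[of "{1..N1} \<times> {..<N1}"]) auto
        moreover have "(\<lambda>t. \<Sum>(k, i)\<in>?I. P (\<beta> k) t *\<^sub>R taylor_poly x0 i (Fk k) (H S t)) \<in> graded m \<zeta> (M + \<delta>)"
        proof (rule graded_sum, simp, unfold split_paired_all case_prod_conv)
          fix k i assume k0: "(k, i) \<in> ?I"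
          then have k: "k \<in> {1..N}" "i \<in> {..<N}" "(k, i) \<notin> {1..N1} \<times> {..<N1}" by auto
          have g: "\<gamma> 1 * \<beta> k \<ge> 0" using \<gamma>_1 \<beta>_gt[of k] k by simp
          have "M + \<delta> \<le> \<gamma> 1 * \<beta> k + real i * \<delta>"
          \<comment> \<open>An index pair outside the smaller rectangle has high Taylor degree i or
            high degree of homogeneity \<beta>_k; by the choice of \<open>N1\<close> either one
            suffices.\<close>
          proof (cases "k \<le> N1")
            case True
            with k have "N1 \<le> i" by auto
            then show ?thesis using N1[of i] g by simp
          next
            case False
            then show ?thesis using N1[of k] \<delta>(1) by (simp add: add_increasing2)
          qed
          then show "(\<lambda>t. P (\<beta> k) t *\<^sub>R taylor_poly x0 i (Fk k) (H S t)) \<in> graded m \<zeta> (M + \<delta>)"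
            by (rule graded_mono[OF \<Phi>_term_graded[OF H]])
        qed
        ultimately show ?thesis by simp
      qed
      have 4: "(\<lambda>t. fpart N t - fpart N1 t) \<in> graded m \<zeta> (M + \<delta>)"
      proof -
        have "fpart N t - fpart N1 t = (\<Sum>k\<in>{1..N} - {1..N1}. fk k t)" for t
          unfolding fpart_def using elim by (subst sum.subset_diff[of "{1..N1}"]) auto
        moreover have "(\<lambda>t. \<Sum>k\<in>{1..N} - {1..N1}. fk k t) \<in> graded m \<zeta> (M + \<delta>)"
        proof (rule graded_sum)
          fix k assume "k \<in> {1..N} - {1..N1}"
          then show "fk k \<in> graded m \<zeta> (M + \<delta>)" using N1[of k] by (intro graded_mono[OF fk_graded]) auto
        qed simp
        ultimately show ?thesis by simp
      qed
      have "(\<lambda>t. (W' t + A (W t) - (- R t)) - (\<Phi> N ?S2 t - \<Phi> N S t) - (\<Phi> N S t - \<Phi> N1 S t)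
          - (fpart N t - fpart N1 t)) \<in> graded m \<zeta> (M + \<delta>)"
        by (intro graded_diff 1 2 3 4)
      moreover have "(W' t + A (W t) - (- R t)) - (\<Phi> N ?S2 t - \<Phi> N S t) - (\<Phi> N S t - \<Phi> N1 S t)
          - (fpart N t - fpart N1 t) = S' t + W' t + A (?S2 t) - \<Phi> N ?S2 t - fpart N t" for t
        by (simp add: R_def A.add algebra_simps)
      ultimately show ?case by (simp only:)
    qed
  qed
  with W(1) show ?thesis by blast
qed

section \<open>Comparison of approximate and true solutions\<close>

lemma Fpart_lipschitz:
  assumes "\<epsilon> > 0"
  shows "\<exists>r>0. \<forall>x y. norm x < r \<longrightarrow> norm y < r \<longrightarrow> norm (Fpart N x - Fpart N y) \<le> \<epsilon> * norm (x - y)"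
proof -
  \<comment> \<open>Each of the N terms gets an equal share of \<epsilon>; the denominator N + 1
    also covers the empty sum.\<close>
  have "\<exists>r>0. \<forall>x y. norm x < r \<longrightarrow> norm y < r \<longrightarrow>
      norm (Fk k x - Fk k y) \<le> (\<epsilon> / (real N + 1)) * norm (x - y)" if "k \<ge> 1" for k
    using that assms by (intro homogeneous_small_lipschitz[OF Fk_hom \<beta>_gt Fk_smooth]) auto
  then obtain r where r: "\<And>k. k \<ge> 1 \<Longrightarrow> r k > 0"
    "\<And>k x y. k \<ge> 1 \<Longrightarrow> norm x < r k \<Longrightarrow> norm y < r k \<Longrightarrow>
      norm (Fk k x - Fk k y) \<le> (\<epsilon> / (real N + 1)) * norm (x - y)" by metis
  define r0 where "r0 = Min (insert 1 (r ` {1..N}))"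
  have r0: "r0 > 0" "\<And>k. k \<in> {1..N} \<Longrightarrow> r0 \<le> r k"
    using r(1) by (auto simp: r0_def simp del: Min_insert intro!: Min_le)
  have "norm (Fpart N x - Fpart N y) \<le> \<epsilon> * norm (x - y)" if xy: "norm x < r0" "norm y < r0" for x y
  proof -
    have "norm (Fpart N x - Fpart N y) \<le> (\<Sum>k=1..N. norm (Fk k x - Fk k y))"
      unfolding Fpart_def sum_subtractf[symmetric] by (rule norm_sum)
    also have "\<dots> \<le> (\<Sum>k=1..N. (\<epsilon> / (real N + 1)) * norm (x - y))"
      using xy r0(2) by (intro sum_mono r(2)) fastforce+
    also have "\<dots> = (real N / (real N + 1)) * (\<epsilon> * norm (x - y))" by simp
    also have "\<dots> \<le> 1 * (\<epsilon> * norm (x - y))"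
      using assms by (intro mult_right_mono) auto
    finally show ?thesis by simp
  qed
  with r0(1) show ?thesis by blast
qed

lemma Fpart_zero: "Fpart N 0 = 0"
  unfolding Fpart_def
proof (rule sum.neutral, safe)
  fix k assume "k \<in> {1..N}"
  then show "Fk k 0 = 0" using \<beta>_gt[of k] by (intro homogeneous_zero[OF Fk_hom]) auto
qed

lemma F_remainder_log_bigo:
  assumes "\<exists>C r. r > 0 \<and> (\<forall>x. norm x < r \<longrightarrow> norm (F x - Fpart N x) \<le> C * norm x powr b)"
    and "log_bigo m a u" "a > 0" "b \<ge> 0"
  shows "log_bigo m (a * b) (\<lambda>t. F (u t) - Fpart N (u t))"
proof -
  obtain C r where r: "r > 0" "\<And>x. norm x < r \<Longrightarrow> norm (F x - Fpart N x) \<le> C * norm x powr b"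
    using assms(1) by blast
  have "\<forall>\<^sub>F t in at_top. norm (u t) < r"
    using log_bigo_tendsto_0[OF assms(2,3)] r(1) by (metis order_tendstoD(2) tendsto_norm_zero)
  then have "\<forall>\<^sub>F t in at_top. norm (F (u t) - Fpart N (u t)) \<le> \<bar>C\<bar> * norm (norm (u t) powr b)"
  proof eventually_elim
    case (elim t)
    then have "norm (F (u t) - Fpart N (u t)) \<le> C * norm (u t) powr b" by (rule r(2))
    also have "\<dots> \<le> \<bar>C\<bar> * norm (u t) powr b" by (intro mult_right_mono) auto
    finally show ?case by simp
  qed
  then show ?thesis by (intro log_bigo_le[OF log_bigo_norm_powr[OF assms(2,4)]]) auto
qed

text \<open>Any exponent below \<gamma>_1 would do; half of it leaves room for the growth of
  amplitudes.\<close>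

lemma approx_sol_log_bigo:
  assumes "approx_sol M S"
  shows "log_bigo m (\<gamma> 1 / 2) S"
proof -
  have "(\<lambda>t. P 1 t *\<^sub>R (x0 + H S t)) \<in> graded m \<zeta> (\<gamma> 1 * 1 + 0)"
  proof (intro graded_scaleR P_graded graded.add)
    show "(\<lambda>t. x0) \<in> graded m \<zeta> 0" using graded_amplitudes[OF amplitudes.one, of x0] by simp
    show "H S \<in> graded m \<zeta> 0" using assms \<delta>(1) by (auto simp: approx_sol_def intro: graded_mono)
  qed
  moreover have "\<forall>\<^sub>F t in at_top. S t = P 1 t *\<^sub>R (x0 + H S t)"
    using P_eq[of 0] by eventually_elim (simp add: H_def)
  ultimately have "S \<in> graded m \<zeta> (\<gamma> 1 * 1 + 0)" by (rule graded_cong)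
  then show ?thesis by (rule graded_log_bigo) (use \<gamma>_1 in simp)
qed

text \<open>The error splits into F - Fpart, small because S decays, and the Taylor error of the
  factors Fk (x0 + H), small because H decays and x0 lies in the region of smoothness. The halved
  rates are the loss in passing from the grading to bounds.\<close>

lemma F_approx:
  assumes S: "approx_sol M S" and N: "a \<le> real N * (\<delta> / 2)" "a \<le> \<gamma> 1 / 2 * \<beta> N" "N \<ge> 1"
    and rem: "\<exists>C r. r > 0 \<and> (\<forall>x. norm x < r \<longrightarrow> norm (F x - Fpart N x) \<le> C * norm x powr \<beta> N)"
  shows "log_bigo m a (\<lambda>t. F (S t) - \<Phi> N S t)"
proof -
  have H: "H S \<in> graded m \<zeta> \<delta>" using S by (simp add: approx_sol_def)
  have HO: "log_bigo m (\<delta> / 2) (H S)" by (rule graded_log_bigo[OF H]) (use \<delta>(1) in simp)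
  have H0: "(H S \<longlongrightarrow> 0) at_top" by (rule log_bigo_tendsto_0[OF HO]) (use \<delta>(1) in simp)
  have 1: "log_bigo m a (\<lambda>t. F (S t) - Fpart N (S t))"
    using F_remainder_log_bigo[OF rem approx_sol_log_bigo[OF S]] \<gamma>_1 \<beta>_gt[OF N(3)] N(2) by (auto intro: log_bigo_mono)
  have 2: "log_bigo m a (\<lambda>t. P (\<beta> k) t *\<^sub>R (Fk k (x0 + H S t) - (\<Sum>i<N. taylor_poly x0 i (Fk k) (H S t))))"
    if k: "k \<ge> 1" for k
  proof -
    have "Ck_on N (- {0}) (Fk k)" using Fk_smooth[OF k] by (simp add: smooth_on_def)
    then obtain C r where r: "r > 0" "\<And>h. norm h < r \<Longrightarrow>
        norm (Fk k (x0 + h) - (\<Sum>i<N. taylor_poly x0 i (Fk k) h)) \<le> C * norm h ^ N"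
      using taylor_remainder[of "- {0}" x0 N "Fk k"] x0 by auto
    have "\<forall>\<^sub>F t in at_top. norm (H S t) < r"
      using H0 r(1) by (metis order_tendstoD(2) tendsto_norm_zero)
    then have "\<forall>\<^sub>F t in at_top. norm (Fk k (x0 + H S t) - (\<Sum>i<N. taylor_poly x0 i (Fk k) (H S t)))
        \<le> \<bar>C\<bar> * norm (norm (H S t) powr real N)"
    proof eventually_elim
      case (elim t)
      then have "norm (Fk k (x0 + H S t) - (\<Sum>i<N. taylor_poly x0 i (Fk k) (H S t))) \<le> C * norm (H S t) ^ N"
        by (rule r(2))
      also have "\<dots> \<le> \<bar>C\<bar> * norm (H S t) ^ N" by (intro mult_right_mono) auto
      also have "norm (H S t) ^ N = norm (norm (H S t) powr real N)"
        using N(3) by (simp add: powr_realpow')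
      finally show ?case .
    qed
    then have "log_bigo m (\<delta> / 2 * real N) (\<lambda>t. Fk k (x0 + H S t) - (\<Sum>i<N. taylor_poly x0 i (Fk k) (H S t)))"
      by (intro log_bigo_le[OF log_bigo_norm_powr[OF HO]]) auto
    then have "log_bigo m a (\<lambda>t. Fk k (x0 + H S t) - (\<Sum>i<N. taylor_poly x0 i (Fk k) (H S t)))"
      using N(1) by (auto intro: log_bigo_mono simp: mult.commute)
    moreover have "log_bigo m 0 (P (\<beta> k))"
      by (rule graded_log_bigo[OF P_graded]) (use \<gamma>_1 \<beta>_gt[OF k] in simp)
    ultimately show ?thesis using log_bigo_scaleR[of m 0 "P (\<beta> k)" a] by simp
  qed
  have "log_bigo m a (\<lambda>t. \<Sum>k=1..N. P (\<beta> k) t *\<^sub>R (Fk k (x0 + H S t) - (\<Sum>i<N. taylor_poly x0 i (Fk k) (H S t))))"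
    by (rule log_bigo_sum) (auto intro: 2)
  then have "log_bigo m a (\<lambda>t. Fpart N (S t) - \<Phi> N S t)"
  proof (rule log_bigo_cong)
    have "\<forall>\<^sub>F t in at_top. \<forall>k\<in>{1..N}. P 1 t > 0 \<and> P (- 1) t = inverse (P 1 t) \<and> P (\<beta> k) t = P 1 t powr \<beta> k"
      by (intro eventually_ball_finite ballI) (use P_eq in \<open>auto elim: eventually_mono\<close>)
    then show "\<forall>\<^sub>F t in at_top. Fpart N (S t) - \<Phi> N S t = (\<Sum>k=1..N. P (\<beta> k) t *\<^sub>R
        (Fk k (x0 + H S t) - (\<Sum>i<N. taylor_poly x0 i (Fk k) (H S t))))"
    proof eventually_elim
      case (elim t)
      have "Fk k (S t) = P (\<beta> k) t *\<^sub>R Fk k (x0 + H S t)" if k: "k \<in> {1..N}" for k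
      proof -
        have "P 1 t > 0" "P (- 1) t = inverse (P 1 t)" "P (\<beta> k) t = P 1 t powr \<beta> k" using elim k by auto
        moreover from this have "S t = P 1 t *\<^sub>R (x0 + H S t)" by (simp add: H_def)
        moreover have "Fk k (P 1 t *\<^sub>R (x0 + H S t)) = P 1 t powr \<beta> k *\<^sub>R Fk k (x0 + H S t)"
          using Fk_hom[of k] k \<open>P 1 t > 0\<close> by (simp add: pos_homogeneous_def)
        ultimately show ?thesis by metis
      qed
      then show ?case
        unfolding Fpart_def \<Phi>_def sum.cartesian_product[symmetric] scaleR_diff_right sum_subtractf
        by (simp add: scaleR_sum_right)
    qed
  qed
  from log_bigo_add[OF 1 this] show ?thesis by simp
qed

text \<open>The a priori rate: once y is small, F(y) is at most \<epsilon> |y|, so y decays like f.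
  Without a rate for y the remainder of F at y could not be given a high order.\<close>

lemma solution_log_bigo:
  assumes y: "\<forall>\<^sub>F t in at_top. (y has_vector_derivative y' t) (at t)"
    and eq: "\<forall>\<^sub>F t in at_top. y' t + A (y t) = F (y t) + f t" and lim: "(y \<longlongrightarrow> 0) at_top"
  shows "log_bigo m (\<gamma> 1 / 2) y"
proof -
  obtain \<epsilon> where \<epsilon>: "\<epsilon> > 0" and dec: "\<And>w w' e a. \<lbrakk>\<forall>\<^sub>F t in at_top. (w has_vector_derivative w' t) (at t);
     \<forall>\<^sub>F t in at_top. norm (w' t + A (w t)) \<le> \<epsilon> * norm (w t) + norm (e t :: 'v); log_bigo m a e\<rbrakk> \<Longrightarrow> log_bigo m a w"
    using decay[of m] by blast
  have "\<forall>\<^sub>F N in sequentially. \<gamma> 1 / 2 \<le> \<gamma> N"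
    using \<gamma>_lim unfolding filterlim_at_top by blast
  from eventually_happens'[OF sequentially_bot eventually_conj[OF this eventually_conj[OF
      f_expansion eventually_conj[OF F_expansion eventually_ge_at_top[of 1]]]]]
  obtain N C r where N: "\<gamma> 1 / 2 \<le> \<gamma> N" "log_bigo m (\<gamma> N) (\<lambda>t. f t - fpart N t)" "N \<ge> 1"
    and r: "r > 0" "\<And>x. norm x < r \<Longrightarrow> norm (F x - Fpart N x) \<le> C * norm x powr \<beta> N"
    unfolding Fpart_def fpart_def by blast
  have "log_bigo m (\<gamma> 1 / 2) (fpart N)"
    unfolding fpart_def
  proof (rule log_bigo_sum, simp)
    fix k assume k: "k \<in> {1..N}"
    have "\<gamma> 1 \<le> \<gamma> k" using k \<delta>(1) \<delta>(4)[of k] by (cases "k = 1") auto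
    then show "log_bigo m (\<gamma> 1 / 2) (fk k)" using k \<gamma>_1 by (intro graded_log_bigo[OF fk_graded]) auto
  qed
  from log_bigo_add[OF log_bigo_mono[OF N(2,1)] this] have f: "log_bigo m (\<gamma> 1 / 2) f" by simp
  obtain r1 where r1: "r1 > 0" "\<And>x y. norm x < r1 \<Longrightarrow> norm y < r1 \<Longrightarrow>
      norm (Fpart N x - Fpart N y) \<le> (\<epsilon> / 2) * norm (x - y)"
    using Fpart_lipschitz[of "\<epsilon> / 2" N] \<epsilon> by auto
  \<comment> \<open>One factor |y| is split off from |y|^\<beta>_N; the remaining power tends to 0
    since \<beta>_N > 1.\<close>
  have "((\<lambda>t. \<bar>C\<bar> * norm (y t) powr (\<beta> N - 1)) \<longlongrightarrow> \<bar>C\<bar> * 0 powr (\<beta> N - 1)) at_top"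
    using \<beta>_gt[OF N(3)]
    by (intro tendsto_mult tendsto_powr' tendsto_norm_zero lim tendsto_const) auto
  then have "\<forall>\<^sub>F t in at_top. \<bar>C\<bar> * norm (y t) powr (\<beta> N - 1) < \<epsilon> / 2"
    using \<epsilon> by (intro order_tendstoD(2)[where y = "\<bar>C\<bar> * 0 powr (\<beta> N - 1)"]) auto
  moreover have "\<forall>\<^sub>F t in at_top. norm (y t) < min r r1"
    using tendsto_norm_zero[OF lim] r(1) r1(1) by (intro order_tendstoD(2)) auto
  ultimately have "\<forall>\<^sub>F t in at_top. norm (y' t + A (y t)) \<le> \<epsilon> * norm (y t) + norm (f t)"
    using eq
  proof eventually_elim
    case (elim t)
    have 1: "norm (Fpart N (y t)) \<le> \<epsilon> / 2 * norm (y t)"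
      using r1(2)[of "y t" 0] elim r1(1) by (simp add: Fpart_zero)
    have "norm (F (y t) - Fpart N (y t)) \<le> C * norm (y t) powr \<beta> N" using elim by (intro r(2)) simp
    also have "\<dots> \<le> \<bar>C\<bar> * norm (y t) powr \<beta> N" by (intro mult_right_mono) auto
    also have "\<dots> = (\<bar>C\<bar> * norm (y t) powr (\<beta> N - 1)) * norm (y t)"
      by (cases "y t = 0") (simp_all add: powr_diff)
    also have "\<dots> \<le> \<epsilon> / 2 * norm (y t)" using elim by (intro mult_right_mono) auto
    finally have "norm (F (y t)) \<le> \<epsilon> * norm (y t)"
      using 1 norm_triangle_ineq[of "F (y t) - Fpart N (y t)" "Fpart N (y t)"] by simp
    then show ?case using elim norm_triangle_ineq[of "F (y t)" "f t"] by simp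
  qed
  then show ?thesis by (rule dec[OF y _ f])
qed

text \<open>The difference w = y - S satisfies w' + A w = Fpart y - Fpart S + e. Taking N large
  makes every part of e of order a, and the Lipschitz term is absorbed by the Lyapunov form.\<close>

lemma approx_sol_error:
  assumes S: "approx_sol M S" and a: "a < M"
    and y: "\<forall>\<^sub>F t in at_top. (y has_vector_derivative y' t) (at t)"
    and eq: "\<forall>\<^sub>F t in at_top. y' t + A (y t) = F (y t) + f t" and lim: "(y \<longlongrightarrow> 0) at_top"
  shows "log_bigo m a (\<lambda>t. y t - S t)"
proof -
  obtain \<epsilon> where \<epsilon>: "\<epsilon> > 0" and dec: "\<And>w w' e a. \<lbrakk>\<forall>\<^sub>F t in at_top. (w has_vector_derivative w' t) (at t);
     \<forall>\<^sub>F t in at_top. norm (w' t + A (w t)) \<le> \<epsilon> * norm (w t) + norm (e t :: 'v); log_bigo m a e\<rbrakk> \<Longrightarrow> log_bigo m a w"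
    using decay[of m] by blast
  from S obtain S' where
    S': "\<forall>\<^sub>F t in at_top. (S has_vector_derivative S' t) (at t)"
    and res: "\<forall>\<^sub>F N in sequentially. (\<lambda>t. S' t + A (S t) - \<Phi> N S t - fpart N t) \<in> graded m \<zeta> M"
    unfolding approx_sol_def by blast
  have "\<forall>\<^sub>F N in sequentially. a \<le> \<gamma> N"
    using \<gamma>_lim by (simp add: filterlim_at_top)
  moreover have "\<forall>\<^sub>F N in sequentially. a / (\<gamma> 1 / 2) \<le> \<beta> N"
    using \<beta>_lim unfolding filterlim_at_top by blast
  moreover have "\<forall>\<^sub>F N in sequentially. a / (\<delta> / 2) \<le> real N"
    using filterlim_real_sequentially unfolding filterlim_at_top by blast
  ultimately have "\<forall>\<^sub>F N in sequentially. a \<le> \<gamma> N \<and> a \<le> \<gamma> 1 / 2 * \<beta> N \<and> a \<le> real N * (\<delta> / 2) \<and> N \<ge> 1 \<and>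
     (\<lambda>t. S' t + A (S t) - \<Phi> N S t - fpart N t) \<in> graded m \<zeta> M \<and>
     log_bigo m (\<gamma> N) (\<lambda>t. f t - fpart N t) \<and>
     (\<exists>C r. r > 0 \<and> (\<forall>x. norm x < r \<longrightarrow> norm (F x - Fpart N x) \<le> C * norm x powr \<beta> N))"
    using res f_expansion F_expansion eventually_ge_at_top[of 1] unfolding Fpart_def fpart_def
    by eventually_elim (use \<gamma>_1 \<delta>(1) in \<open>simp add: field_simps\<close>)
  from eventually_happens'[OF sequentially_bot this]
  obtain N where N: "a \<le> \<gamma> N" "a \<le> \<gamma> 1 / 2 * \<beta> N" "a \<le> real N * (\<delta> / 2)" "N \<ge> 1"
    and res: "(\<lambda>t. S' t + A (S t) - \<Phi> N S t - fpart N t) \<in> graded m \<zeta> M"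
    and f: "log_bigo m (\<gamma> N) (\<lambda>t. f t - fpart N t)"
    and rem: "\<exists>C r. r > 0 \<and> (\<forall>x. norm x < r \<longrightarrow> norm (F x - Fpart N x) \<le> C * norm x powr \<beta> N)"
    by blast
  have yO: "log_bigo m (\<gamma> 1 / 2) y" by (rule solution_log_bigo[OF y eq lim])
  have SO: "log_bigo m (\<gamma> 1 / 2) S" by (rule approx_sol_log_bigo[OF S])
  have FO: "log_bigo m a (\<lambda>t. F (u t) - Fpart N (u t))" if "log_bigo m (\<gamma> 1 / 2) u" for u
    using F_remainder_log_bigo[OF rem that] \<gamma>_1 \<beta>_gt[OF N(4)] N(2) by (auto intro: log_bigo_mono)
  define e where "e t = (F (y t) - Fpart N (y t)) - (F (S t) - Fpart N (S t)) + (F (S t) - \<Phi> N S t)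
     + (f t - fpart N t) - (S' t + A (S t) - \<Phi> N S t - fpart N t)" for t
  have e: "log_bigo m a e" unfolding e_def
    by (intro log_bigo_add log_bigo_diff FO yO SO F_approx[OF S N(3,2,4) rem] log_bigo_mono[OF f N(1)] graded_log_bigo[OF res a])
  \<comment> \<open>N is already fixed by the order a; the radius may depend on it because y and S
    both tend to 0.\<close>
  obtain r where r: "r > 0" "\<And>x y. norm x < r \<Longrightarrow> norm y < r \<Longrightarrow>
      norm (Fpart N x - Fpart N y) \<le> \<epsilon> * norm (x - y)"
    using Fpart_lipschitz[OF \<epsilon>] by blast
  have small: "\<forall>\<^sub>F t in at_top. norm (u t) < r" if "log_bigo m (\<gamma> 1 / 2) u" for u :: "real \<Rightarrow> 'v"
    using log_bigo_tendsto_0[OF that] \<gamma>_1 r(1) by (metis half_gt_zero order_tendstoD(2) tendsto_norm_zero)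
  have ineq: "\<forall>\<^sub>F t in at_top. norm ((y' t - S' t) + A (y t - S t)) \<le> \<epsilon> * norm (y t - S t) + norm (e t)"
    using eq small[OF yO] small[OF SO]
  proof eventually_elim
    case (elim t)
    have "(y' t - S' t) + A (y t - S t) = (y' t + A (y t)) - (S' t + A (S t))" by (simp add: A.diff)
    also have "\<dots> = (Fpart N (y t) - Fpart N (S t)) + e t"
      unfolding elim(1) by (simp add: e_def)
    also have "norm \<dots> \<le> \<epsilon> * norm (y t - S t) + norm (e t)"
      using r(2)[OF elim(2,3)] by (rule norm_triangle_mono) simp
    finally show ?case .
  qed
  have "\<forall>\<^sub>F t in at_top. ((\<lambda>t. y t - S t) has_vector_derivative y' t - S' t) (at t)"
    using y S' by eventually_elim (rule has_vector_derivative_diff)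
  from dec[OF this ineq e] show ?thesis .
qed

text \<open>The \<open>W j\<close> are the successive corrections and are chosen before any solution
  y. The approximation \<open>S j\<close> is accurate to order \<gamma>_1 + (j + 1) \<delta>, which
  is why the sum of the first j corrections reaches \<gamma>_1 + j \<delta>.\<close>

lemma expansion_sequence:
  "\<exists>W. (\<forall>j. W j \<in> graded m \<zeta> (\<gamma> 1 + real j * \<delta>)) \<and>
     (\<forall>y y' a j. (\<forall>\<^sub>F t in at_top. (y has_vector_derivative y' t) (at t)) \<longrightarrow>
        (\<forall>\<^sub>F t in at_top. y' t + A (y t) = F (y t) + f t) \<longrightarrow> (y \<longlongrightarrow> 0) at_top \<longrightarrow>
        a < \<gamma> 1 + real j * \<delta> \<longrightarrow> log_bigo m a (\<lambda>t. y t - (\<Sum>i<j. W i t)))"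
proof -
  define Q where "Q j S \<longleftrightarrow> approx_sol (\<gamma> 1 + real (Suc j) * \<delta>) S" for j S
  have "\<exists>S. (\<forall>j. Q j (S j)) \<and> (\<forall>j. (\<lambda>t. S (Suc j) t - S j t) \<in> graded m \<zeta> (\<gamma> 1 + real (Suc j) * \<delta>)) \<and>
      S 0 = (\<lambda>t. P 1 t *\<^sub>R x0)"
  proof -
    define st where "st j S = (\<lambda>t. S t + (SOME W. W \<in> graded m \<zeta> (\<gamma> 1 + real (Suc j) * \<delta>) \<and>
       Q (Suc j) (\<lambda>t. S t + W t)) t)" for j S
    have st: "(\<lambda>t. st j S t - S t) \<in> graded m \<zeta> (\<gamma> 1 + real (Suc j) * \<delta>) \<and> Q (Suc j) (st j S)" if "Q j S" for j S
    proof -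
      have "\<exists>W. W \<in> graded m \<zeta> (\<gamma> 1 + real (Suc j) * \<delta>) \<and> Q (Suc j) (\<lambda>t. S t + W t)"
        using approx_sol_step[OF that[unfolded Q_def]] \<delta>(1) by (simp add: Q_def algebra_simps)
      from someI_ex[OF this] show ?thesis by (simp add: st_def)
    qed
    define S where "S = rec_nat (\<lambda>t. P 1 t *\<^sub>R x0) st"
    have Suc: "S (Suc j) = st j (S j)" for j by (simp add: S_def)
    have Q: "Q j (S j)" for j
    proof (induction j)
      case 0
      show ?case using approx_sol_base by (simp add: Q_def S_def)
    next
      case (Suc j)
      then show ?case unfolding \<open>S (Suc j) = st j (S j)\<close> using st by blast
    qed
    have "(\<lambda>t. S (Suc j) t - S j t) \<in> graded m \<zeta> (\<gamma> 1 + real (Suc j) * \<delta>)" for j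
      unfolding Suc using st[OF Q] by blast
    with Q show ?thesis by (intro exI[of _ S]) (simp add: S_def)
  qed
  then obtain S where S: "\<And>j. Q j (S j)" "\<And>j. (\<lambda>t. S (Suc j) t - S j t) \<in> graded m \<zeta> (\<gamma> 1 + real (Suc j) * \<delta>)"
    "S 0 = (\<lambda>t. P 1 t *\<^sub>R x0)" by blast
  define W where "W j = (case j of 0 \<Rightarrow> S 0 | Suc i \<Rightarrow> (\<lambda>t. S (Suc i) t - S i t))" for j
  have W: "W j \<in> graded m \<zeta> (\<gamma> 1 + real j * \<delta>)" for j
  proof (cases j)
    case 0
    have "(\<lambda>t. P 1 t *\<^sub>R x0) \<in> graded m \<zeta> (\<gamma> 1 * 1)"
      by (rule graded_bounded_linear[OF bounded_linear_scaleR_left P_graded])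
    with 0 show ?thesis by (simp add: W_def S(3))
  next
    case (Suc i)
    then show ?thesis using S(2) by (simp add: W_def)
  qed
  have sum: "(\<Sum>i<Suc j. W i t) = S j t" for j t
    by (induction j) (simp_all add: W_def)
  have "log_bigo m a (\<lambda>t. y t - (\<Sum>i<j. W i t))"
    if y: "\<forall>\<^sub>F t in at_top. (y has_vector_derivative y' t) (at t)"
      "\<forall>\<^sub>F t in at_top. y' t + A (y t) = F (y t) + f t" "(y \<longlongrightarrow> 0) at_top" and a: "a < \<gamma> 1 + real j * \<delta>" for y y' a j
  proof (cases j)
    \<comment> \<open>The empty sum is none of the \<open>S j\<close>; here y itself is bounded
      through \<open>S 0\<close>.\<close>
    case 0
    have "a < \<gamma> 1 + real (Suc 0) * \<delta>" using a 0 \<delta>(1) by simp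
    from approx_sol_error[OF S(1)[unfolded Q_def] this y]
    have "log_bigo m a (\<lambda>t. y t - S 0 t)" .
    moreover have "log_bigo m a (S 0)" using W[of 0] a 0 by (auto intro: graded_log_bigo simp: W_def)
    ultimately have "log_bigo m a (\<lambda>t. (y t - S 0 t) + S 0 t)" by (rule log_bigo_add)
    then show ?thesis using 0 by simp
  next
    case (Suc i)
    have "a < \<gamma> 1 + real (Suc i) * \<delta>" using a Suc by simp
    from approx_sol_error[OF S(1)[unfolded Q_def] this y] show ?thesis
      unfolding Suc sum .
  qed
  with W show ?thesis by blast
qed

end

subsection \<open>Normal form of the monomials\<close>

text \<open>Local finiteness gives every real a next element of E; iterating from 0 starts at the
  least element. An element missed by the iteration would bound all iterates, although they are
  unbounded.\<close>

lemma exists_strict_mono_enumeration: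
  fixes E :: "real set"
  assumes inf: "infinite E" and pos: "\<And>x. x \<in> E \<Longrightarrow> x > 0" and fin: "\<And>M. finite (E \<inter> {..M})"
  shows "\<exists>e::nat \<Rightarrow> real. strict_mono e \<and> range e = E \<and> filterlim e at_top sequentially"
proof -
  have "\<exists>y\<in>E. x < y \<and> (\<forall>z\<in>E. x < z \<longrightarrow> y \<le> z)" for x
  proof -
    have "infinite (E - (E \<inter> {..x}))" by (rule Diff_infinite_finite[OF fin inf])
    then have "E - (E \<inter> {..x}) \<noteq> {}" by (rule infinite_imp_nonempty)
    then obtain y0 where "y0 \<in> E - (E \<inter> {..x})" by blast
    then have y0: "y0 \<in> E" "x < y0" by auto
    let ?S = "E \<inter> {x<..y0}"
    have S: "finite ?S" "?S \<noteq> {}" using y0 by (auto intro: finite_subset[OF _ fin[of y0]])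
    have "Min ?S \<in> ?S" using S by (rule Min_in)
    moreover have "Min ?S \<le> z" if z: "z \<in> E" "x < z" for z
    proof (cases "z \<le> y0")
      case True
      then show ?thesis using S z by (intro Min_le) auto
    next
      case False
      then show ?thesis using \<open>Min ?S \<in> ?S\<close> by auto
    qed
    ultimately show ?thesis by (intro bexI[of _ "Min ?S"]) auto
  qed
  then obtain nx where nx: "\<And>x. nx x \<in> E" "\<And>x. x < nx x" "\<And>x z. z \<in> E \<Longrightarrow> x < z \<Longrightarrow> nx x \<le> z"
    by metis
  define e where "e = rec_nat (nx 0) (\<lambda>_. nx)"
  have e_Suc: "e (Suc n) = nx (e n)" for n by (simp add: e_def)
  have e_0: "e 0 = nx 0" by (simp add: e_def)
  have sm: "strict_mono e" by (rule strict_monoI_Suc) (simp add: e_Suc nx)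
  have eE: "e n \<in> E" for n by (cases n) (simp_all add: e_0 e_Suc nx)
  have unb: "\<exists>n. Z < e n" for Z
  proof (rule ccontr)
    assume "\<nexists>n. Z < e n"
    then have "range e \<subseteq> E \<inter> {..Z}" using eE by (auto simp: not_less)
    then have "finite (range e)" using fin finite_subset by blast
    then show False using strict_mono_imp_inj_on[OF sm] finite_imageD infinite_UNIV_nat by blast
  qed
  have "E \<subseteq> range e"
  proof (rule ccontr)
    assume "\<not> E \<subseteq> range e"
    then obtain z where z: "z \<in> E" "z \<notin> range e" by auto
    have "e n < z" for n
    proof (induction n)
      case 0
      then show ?case using nx(3)[of z 0] z pos by (fastforce simp: e_0[symmetric] order.strict_iff_order)
    next
      case (Suc n)
      then show ?case using nx(3)[of z "e n"] z by (fastforce simp: e_Suc[symmetric] order.strict_iff_order)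
    qed
    with unb[of z] show False by (meson less_asym)
  qed
  moreover have "filterlim e at_top sequentially"
    unfolding filterlim_at_top_dense
  proof
    fix Z
    obtain n0 where "Z < e n0" using unb by blast
    then have "Z < e n" if "n \<ge> n0" for n
      using that strict_mono_less_eq[OF sm, of n0 n] by linarith
    then show "\<forall>\<^sub>F n in sequentially. Z < e n" unfolding eventually_sequentially by blast
  qed
  ultimately show ?thesis using sm eE by blast
qed

section \<open>Evaluation of the function classes along the iterated logarithms\<close>

lemma iter_log_pos: "\<forall>\<^sub>F t in at_top. 0 < iter_log j t"
proof (cases "j = - 1")
  case False
  then have "iter_log j t = Lg (nat j) t" for t by (simp add: iter_log_def Lg_def)
  then show ?thesis using eventually_Lg_gt by simp
qed (simp add: iter_log_def)

lemma log_tuple_pos: "\<forall>\<^sub>F t in at_top. \<forall>j\<in>{-1..int k}. 0 < iter_log j t"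
  by (intro eventually_ball_finite ballI iter_log_pos) simp

lemma log_tuple_in_pos_tuples: "\<forall>\<^sub>F t in at_top. log_tuple k t \<in> pos_tuples k"
  using log_tuple_pos[of k] by eventually_elim (auto simp: log_tuple_def pos_tuples_def)

lemma log_tuple_apply: "j \<in> {-1..int k} \<Longrightarrow> log_tuple k t j = iter_log j t"
  by (simp add: log_tuple_def)

definition monom_fn :: "(real \<Rightarrow> real) \<Rightarrow> nat \<Rightarrow> (int \<Rightarrow> real) \<Rightarrow> real \<Rightarrow> (int \<Rightarrow> real \<Rightarrow> real) \<Rightarrow>
    (int \<Rightarrow> real) \<Rightarrow> real \<Rightarrow> real" where
  "monom_fn \<zeta> k \<alpha> b \<sigma> \<omega> t =
     tuple_powr k (log_tuple k t) \<alpha> * \<zeta> t powr b * trig_prod k \<sigma> \<omega> (log_tuple k t)"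

text \<open>Members of \<open>P1hat\<close> are prescribed at positive arguments only, which the
  logarithms and \<zeta> attain eventually; so the representation is asked for large t.\<close>

definition is_P1hat_fn :: "nat \<Rightarrow> (real \<Rightarrow> real) \<Rightarrow> nat \<Rightarrow> (real \<Rightarrow> 'x::real_vector) \<Rightarrow> bool" where
  "is_P1hat_fn m \<zeta> k u \<longleftrightarrow> (\<exists>h\<in>P1hat m k. \<forall>\<^sub>F t in at_top. u t = h (log_tuple k t) (\<zeta> t))"

text \<open>A bijection with an initial segment frees the index set, so that two sums can be joined
  over a disjoint union.\<close>

lemma is_P1hat_fn_I:
  fixes \<xi> :: "'i \<Rightarrow> 'x::real_vector"
  assumes "finite I" "\<And>i. i \<in> I \<Longrightarrow> \<alpha> i \<in> exponents m k \<and> trig_choice k (\<sigma> i)"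
    and "\<forall>\<^sub>F t in at_top. u t = (\<Sum>i\<in>I. monom_fn \<zeta> k (\<alpha> i) (b i) (\<sigma> i) (\<omega> i) t *\<^sub>R \<xi> i)"
  shows "is_P1hat_fn m \<zeta> k u"
proof -
  obtain \<phi> where "bij_betw \<phi> {0..<card I} I"
    using ex_bij_betw_nat_finite[OF assms(1)] by blast
  then have \<phi>: "bij_betw \<phi> {..<card I} I" by (simp add: atLeast0LessThan)
  define h where "h z x = (\<Sum>i<card I. (tuple_powr k z (\<alpha> (\<phi> i)) * x powr b (\<phi> i)
      * trig_prod k (\<sigma> (\<phi> i)) (\<omega> (\<phi> i)) z) *\<^sub>R \<xi> (\<phi> i))" for z x
  have "h \<in> P1hat m k"
    unfolding P1hat_def mem_Collect_eq h_def
    by (rule exI[of _ "card I"], rule exI[of _ "\<lambda>i. \<alpha> (\<phi> i)"], rule exI[of _ "\<lambda>i. b (\<phi> i)"],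
        rule exI[of _ "\<lambda>i. \<sigma> (\<phi> i)"], rule exI[of _ "\<lambda>i. \<omega> (\<phi> i)"], rule exI[of _ "\<lambda>i. \<xi> (\<phi> i)"])
      (use assms(2) \<phi> in \<open>auto simp: bij_betw_def\<close>)
  moreover have "h (log_tuple k t) (\<zeta> t) = (\<Sum>i\<in>I. monom_fn \<zeta> k (\<alpha> i) (b i) (\<sigma> i) (\<omega> i) t *\<^sub>R \<xi> i)" for t
    unfolding h_def monom_fn_def by (rule sum.reindex_bij_betw[OF \<phi>])
  ultimately show ?thesis
    using assms(3) unfolding is_P1hat_fn_def by (intro bexI[of _ h]) simp_all
qed

lemma is_P1hat_fn_E:
  assumes "is_P1hat_fn m \<zeta> k u" and "\<forall>\<^sub>F t in at_top. 0 < \<zeta> t"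
  shows "\<exists>(M::nat) \<alpha> b \<sigma> \<omega> \<xi>. (\<forall>i<M. \<alpha> i \<in> exponents m k \<and> trig_choice k (\<sigma> i)) \<and>
    (\<forall>\<^sub>F t in at_top. u t = (\<Sum>i<M. monom_fn \<zeta> k (\<alpha> i) (b i) (\<sigma> i) (\<omega> i) t *\<^sub>R \<xi> i))"
proof -
  obtain h where h: "h \<in> P1hat m k" "\<forall>\<^sub>F t in at_top. u t = h (log_tuple k t) (\<zeta> t)"
    using assms(1) unfolding is_P1hat_fn_def by blast
  obtain M :: nat and \<alpha> b \<sigma> \<omega> \<xi> where 1: "\<forall>i<M. \<alpha> i \<in> exponents m k \<and> trig_choice k (\<sigma> i)"
    and 2: "\<forall>z\<in>pos_tuples k. \<forall>x>0. h z x = (\<Sum>i<M. (tuple_powr k z (\<alpha> i) * x powr b i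
                            * trig_prod k (\<sigma> i) (\<omega> i) z) *\<^sub>R \<xi> i)"
    using h(1) unfolding P1hat_def mem_Collect_eq by (elim exE conjE) (rule that; assumption)
  have "\<forall>\<^sub>F t in at_top. u t = (\<Sum>i<M. monom_fn \<zeta> k (\<alpha> i) (b i) (\<sigma> i) (\<omega> i) t *\<^sub>R \<xi> i)"
    using h(2) assms(2) log_tuple_in_pos_tuples[of k]
    by eventually_elim (simp add: 2 monom_fn_def)
  with 1 show ?thesis by (intro exI conjI)
qed

lemma is_P1hat_fn_cong:
  assumes "is_P1hat_fn m \<zeta> k u" "\<forall>\<^sub>F t in at_top. v t = u t"
  shows "is_P1hat_fn m \<zeta> k v"
proof -
  obtain h where h: "h \<in> P1hat m k" "\<forall>\<^sub>F t in at_top. u t = h (log_tuple k t) (\<zeta> t)"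
    using assms(1) unfolding is_P1hat_fn_def by blast
  from assms(2) h(2) have "\<forall>\<^sub>F t in at_top. v t = h (log_tuple k t) (\<zeta> t)"
    by eventually_elim simp
  with h(1) show ?thesis unfolding is_P1hat_fn_def by blast
qed

lemma is_P1hat_fn_single:
  assumes "\<alpha> \<in> exponents m k" "trig_choice k \<sigma>"
  shows "is_P1hat_fn m \<zeta> k (\<lambda>t. monom_fn \<zeta> k \<alpha> b \<sigma> \<omega> t *\<^sub>R \<xi>)"
  by (rule is_P1hat_fn_I[of "{()}" "\<lambda>_. \<alpha>" m k "\<lambda>_. \<sigma>" _ \<zeta> "\<lambda>_. b" "\<lambda>_. \<omega>" "\<lambda>_. \<xi>"])
    (use assms in auto)

lemma is_P1hat_fn_zero: "is_P1hat_fn m \<zeta> k (\<lambda>t. 0)"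
  by (rule is_P1hat_fn_I[where I = "{}::unit set"]) auto

lemma is_P1hat_fn_add:
  assumes u: "is_P1hat_fn m \<zeta> k u" and v: "is_P1hat_fn m \<zeta> k v" and \<zeta>: "\<forall>\<^sub>F t in at_top. 0 < \<zeta> t"
  shows "is_P1hat_fn m \<zeta> k (\<lambda>t. u t + v t)"
proof -
  obtain M :: nat and \<alpha> b \<sigma> \<omega> \<xi> where 1:
    "\<forall>i<M. \<alpha> i \<in> exponents m k \<and> trig_choice k (\<sigma> i)"
    "\<forall>\<^sub>F t in at_top. u t = (\<Sum>i<M. monom_fn \<zeta> k (\<alpha> i) (b i) (\<sigma> i) (\<omega> i) t *\<^sub>R \<xi> i)"
    using is_P1hat_fn_E[OF u \<zeta>] by (elim exE conjE) (rule that; assumption)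
  obtain M' :: nat and \<alpha>' b' \<sigma>' \<omega>' \<xi>' where 2:
    "\<forall>i<M'. \<alpha>' i \<in> exponents m k \<and> trig_choice k (\<sigma>' i)"
    "\<forall>\<^sub>F t in at_top. v t = (\<Sum>i<M'. monom_fn \<zeta> k (\<alpha>' i) (b' i) (\<sigma>' i) (\<omega>' i) t *\<^sub>R \<xi>' i)"
    using is_P1hat_fn_E[OF v \<zeta>] by (elim exE conjE) (rule that; assumption)
  have "\<forall>\<^sub>F t in at_top. u t + v t = (\<Sum>i\<in>{..<M} <+> {..<M'}. monom_fn \<zeta> k (case_sum \<alpha> \<alpha>' i)
      (case_sum b b' i) (case_sum \<sigma> \<sigma>' i) (case_sum \<omega> \<omega>' i) t *\<^sub>R case_sum \<xi> \<xi>' i)"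
    using 1(2) 2(2) by eventually_elim (simp add: sum.Plus)
  then show ?thesis by (rule is_P1hat_fn_I[rotated 2]) (use 1(1) 2(1) in auto)
qed

lemma is_P1hat_fn_sum:
  assumes "finite I" "\<And>i. i \<in> I \<Longrightarrow> is_P1hat_fn m \<zeta> k (u i)" and \<zeta>: "\<forall>\<^sub>F t in at_top. 0 < \<zeta> t"
  shows "is_P1hat_fn m \<zeta> k (\<lambda>t. \<Sum>i\<in>I. u i t)"
  using assms(1,2)
proof (induction I rule: finite_induct)
  case (insert i I)
  then show ?case by (simp add: is_P1hat_fn_add \<zeta>)
qed (simp add: is_P1hat_fn_zero)

text \<open>Reduces multiplication by g to single monomials. The bound k' may differ from k, so g =
  1 covers the passage to longer tuples.\<close>

lemma is_P1hat_fn_mult_I: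
  fixes u :: "real \<Rightarrow> 'x::real_vector"
  assumes u: "is_P1hat_fn m \<zeta> k u" and \<zeta>: "\<forall>\<^sub>F t in at_top. 0 < \<zeta> t"
    and g: "\<And>\<alpha> b \<sigma> \<omega> (\<xi>::'x). \<alpha> \<in> exponents m k \<Longrightarrow> trig_choice k \<sigma> \<Longrightarrow>
      is_P1hat_fn m \<zeta> k' (\<lambda>t. (g t * monom_fn \<zeta> k \<alpha> b \<sigma> \<omega> t) *\<^sub>R \<xi>)"
  shows "is_P1hat_fn m \<zeta> k' (\<lambda>t. g t *\<^sub>R u t)"
proof -
  obtain M :: nat and \<alpha> b \<sigma> \<omega> \<xi> where 1:
    "\<forall>i<M. \<alpha> i \<in> exponents m k \<and> trig_choice k (\<sigma> i)"
    "\<forall>\<^sub>F t in at_top. u t = (\<Sum>i<M. monom_fn \<zeta> k (\<alpha> i) (b i) (\<sigma> i) (\<omega> i) t *\<^sub>R \<xi> i)"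
    using is_P1hat_fn_E[OF u \<zeta>] by (elim exE conjE) (rule that; assumption)
  have "is_P1hat_fn m \<zeta> k' (\<lambda>t. \<Sum>i<M. (g t * monom_fn \<zeta> k (\<alpha> i) (b i) (\<sigma> i) (\<omega> i) t) *\<^sub>R \<xi> i)"
    by (intro is_P1hat_fn_sum g \<zeta>) (use 1(1) in auto)
  then show ?thesis
    by (rule is_P1hat_fn_cong) (use 1(2) in \<open>auto elim!: eventually_mono simp: scaleR_sum_right\<close>)
qed

lemma is_P1hat_fn_log:
  assumes u: "is_P1hat_fn m \<zeta> k u" and \<zeta>: "\<forall>\<^sub>F t in at_top. 0 < \<zeta> t" and j: "m < j" "j \<le> k"
  shows "is_P1hat_fn m \<zeta> k (\<lambda>t. Lg j t powr a *\<^sub>R u t)"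
proof (rule is_P1hat_fn_mult_I[OF u \<zeta>])
  fix \<alpha> b \<sigma> and \<omega> :: \<open>int \<Rightarrow> real\<close> and \<xi> :: 'a
  assume *: "\<alpha> \<in> exponents m k" "trig_choice k \<sigma>"
  let ?\<alpha> = "\<alpha>(int j := \<alpha> (int j) + a)"
  have \<alpha>: "?\<alpha> \<in> exponents m k" using *(1) j by (auto simp: exponents_def PiE_def extensional_def)
  have "Lg j t powr a * monom_fn \<zeta> k \<alpha> b \<sigma> \<omega> t = monom_fn \<zeta> k ?\<alpha> b \<sigma> \<omega> t" for t
  proof -
    let ?z = "log_tuple k t"
    have z: "?z (int j) = Lg j t" using j by (simp add: log_tuple_apply)
    have "tuple_powr k ?z ?\<alpha> = ?z (int j) powr ?\<alpha> (int j) * (\<Prod>i\<in>{-1..int k} - {int j}. ?z i powr ?\<alpha> i)"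
      unfolding tuple_powr_def using j by (subst prod.remove[of _ "int j"]) auto
    also have "(\<Prod>i\<in>{-1..int k} - {int j}. ?z i powr ?\<alpha> i) = (\<Prod>i\<in>{-1..int k} - {int j}. ?z i powr \<alpha> i)"
      by (intro prod.cong) auto
    also have "?z (int j) powr ?\<alpha> (int j) = Lg j t powr a * ?z (int j) powr \<alpha> (int j)"
      by (simp add: powr_add z)
    also have "Lg j t powr a * ?z (int j) powr \<alpha> (int j) * (\<Prod>i\<in>{-1..int k} - {int j}. ?z i powr \<alpha> i)
        = Lg j t powr a * tuple_powr k ?z \<alpha>"
      unfolding tuple_powr_def using j by (subst (2) prod.remove[of _ "int j"]) auto
    finally have T: "tuple_powr k ?z ?\<alpha> = Lg j t powr a * tuple_powr k ?z \<alpha>" .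
    show ?thesis unfolding monom_fn_def T by (simp only: mult.assoc)
  qed
  then show "is_P1hat_fn m \<zeta> k (\<lambda>t. (Lg j t powr a * monom_fn \<zeta> k \<alpha> b \<sigma> \<omega> t) *\<^sub>R \<xi>)"
    using is_P1hat_fn_single[OF \<alpha> *(2)] by simp
qed

lemma is_P1hat_fn_zeta:
  assumes u: "is_P1hat_fn m \<zeta> k u" and \<zeta>: "\<forall>\<^sub>F t in at_top. 0 < \<zeta> t"
  shows "is_P1hat_fn m \<zeta> k (\<lambda>t. \<zeta> t powr a *\<^sub>R u t)"
proof (rule is_P1hat_fn_mult_I[OF u \<zeta>])
  fix \<alpha> b \<sigma> and \<omega> :: \<open>int \<Rightarrow> real\<close> and \<xi> :: 'a
  assume *: "\<alpha> \<in> exponents m k" "trig_choice k \<sigma>"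
  have "\<zeta> t powr a * monom_fn \<zeta> k \<alpha> b \<sigma> \<omega> t = monom_fn \<zeta> k \<alpha> (a + b) \<sigma> \<omega> t" for t
    by (simp add: monom_fn_def powr_add)
  then show "is_P1hat_fn m \<zeta> k (\<lambda>t. (\<zeta> t powr a * monom_fn \<zeta> k \<alpha> b \<sigma> \<omega> t) *\<^sub>R \<xi>)"
    using is_P1hat_fn_single[OF *] by simp
qed

lemma trig_prod_upd:
  assumes "j \<le> k"
  shows "trig_prod k (\<sigma>(int j := s)) (fun_upd \<omega> (int j) w) z =
    s (w * z (int j)) * (\<Prod>i\<in>{0..int k} - {int j}. \<sigma> i (\<omega> i * z i))"
proof -
  have "(\<Prod>i\<in>{0..int k} - {int j}. (\<sigma>(int j := s)) i ((fun_upd \<omega> (int j) w) i * z i))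
      = (\<Prod>i\<in>{0..int k} - {int j}. \<sigma> i (\<omega> i * z i))"
    by (intro prod.cong) auto
  then show ?thesis
    unfolding trig_prod_def using assms by (subst prod.remove[of _ "int j"]) auto
qed

lemma trig_choice_shift:
  assumes "trig_choice k \<sigma>" "j \<le> k"
  shows "\<exists>\<psi>. \<forall>x. \<sigma> (int j) x = cos (x + \<psi>)"
proof -
  have "\<sigma> (int j) = cos \<or> \<sigma> (int j) = sin" using assms by (simp add: trig_choice_def)
  then show ?thesis
  proof
    assume "\<sigma> (int j) = cos"
    then show ?thesis by (intro exI[of _ 0]) simp
  next
    assume "\<sigma> (int j) = sin"
    then show ?thesis by (intro exI[of _ "- pi / 2"]) (simp add: cos_add cos_diff)
  qed
qed

text \<open>The monomial may already oscillate in L_j. The product formula merges the two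
  oscillations, and the addition theorem then removes the phases, leaving four monomials with pure
  cosines and sines.\<close>

lemma is_P1hat_fn_trig:
  assumes u: "is_P1hat_fn m \<zeta> k u" and \<zeta>: "\<forall>\<^sub>F t in at_top. 0 < \<zeta> t" and j: "j \<le> k"
  shows "is_P1hat_fn m \<zeta> k (\<lambda>t. cos (w * Lg j t + \<phi>) *\<^sub>R u t)"
proof (rule is_P1hat_fn_mult_I[OF u \<zeta>])
  fix \<alpha> b \<sigma> and \<omega> :: \<open>int \<Rightarrow> real\<close> and \<xi> :: 'a
  assume *: "\<alpha> \<in> exponents m k" "trig_choice k \<sigma>"
  obtain \<psi> where \<psi>: "\<And>x. \<sigma> (int j) x = cos (x + \<psi>)"
    using trig_choice_shift[OF *(2) j] by blast
  let ?o = "\<omega> (int j)"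
  let ?mono = "\<lambda>s w. monom_fn \<zeta> k \<alpha> b (\<sigma>(int j := s)) (fun_upd \<omega> (int j) w)"
  have rep: "is_P1hat_fn m \<zeta> k (\<lambda>t. ?mono s w t *\<^sub>R \<xi>)" if "s = cos \<or> s = sin" for s w \<xi>
    by (rule is_P1hat_fn_single) (use * that in \<open>auto simp: trig_choice_def\<close>)
  have "is_P1hat_fn m \<zeta> k (\<lambda>t. ?mono cos (w - ?o) t *\<^sub>R ((cos (\<phi> - \<psi>) / 2) *\<^sub>R \<xi>)
      + ?mono sin (w - ?o) t *\<^sub>R ((- sin (\<phi> - \<psi>) / 2) *\<^sub>R \<xi>)
      + ?mono cos (w + ?o) t *\<^sub>R ((cos (\<phi> + \<psi>) / 2) *\<^sub>R \<xi>)
      + ?mono sin (w + ?o) t *\<^sub>R ((- sin (\<phi> + \<psi>) / 2) *\<^sub>R \<xi>))"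
    by (intro is_P1hat_fn_add rep \<zeta>) auto
  moreover have "(cos (w * Lg j t + \<phi>) * monom_fn \<zeta> k \<alpha> b \<sigma> \<omega> t) *\<^sub>R \<xi> =
      ?mono cos (w - ?o) t *\<^sub>R ((cos (\<phi> - \<psi>) / 2) *\<^sub>R \<xi>)
      + ?mono sin (w - ?o) t *\<^sub>R ((- sin (\<phi> - \<psi>) / 2) *\<^sub>R \<xi>)
      + ?mono cos (w + ?o) t *\<^sub>R ((cos (\<phi> + \<psi>) / 2) *\<^sub>R \<xi>)
      + ?mono sin (w + ?o) t *\<^sub>R ((- sin (\<phi> + \<psi>) / 2) *\<^sub>R \<xi>)" for t
  proof -
    define x where "x = Lg j t"
    define r where "r = tuple_powr k (log_tuple k t) \<alpha> * \<zeta> t powr b *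
        (\<Prod>i\<in>{0..int k} - {int j}. \<sigma> i (\<omega> i * log_tuple k t i))"
    have z: "log_tuple k t (int j) = x" using j by (simp add: log_tuple_apply x_def)
    have m1: "?mono s w t = r * s (w * x)" for s w
      unfolding monom_fn_def trig_prod_upd[OF j] z r_def by simp
    have m2: "monom_fn \<zeta> k \<alpha> b \<sigma> \<omega> t = r * cos (?o * x + \<psi>)"
      using m1[of "\<sigma> (int j)" ?o] by (simp add: \<psi>)
    have c: "cos (w * x + \<phi>) * cos (?o * x + \<psi>) =
        (cos ((w - ?o) * x + (\<phi> - \<psi>)) + cos ((w + ?o) * x + (\<phi> + \<psi>))) / 2"
      unfolding cos_times_cos by (simp add: algebra_simps)
    have "cos (w * x + \<phi>) * (r * cos (?o * x + \<psi>)) = r * (cos (w * x + \<phi>) * cos (?o * x + \<psi>))" by simp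
    also have "\<dots> = (r * cos ((w - ?o) * x)) * (cos (\<phi> - \<psi>) / 2)
        + (r * sin ((w - ?o) * x)) * (- sin (\<phi> - \<psi>) / 2)
        + (r * cos ((w + ?o) * x)) * (cos (\<phi> + \<psi>) / 2)
        + (r * sin ((w + ?o) * x)) * (- sin (\<phi> + \<psi>) / 2)"
      unfolding c cos_add[of "(w - ?o) * x"] cos_add[of "(w + ?o) * x"] by (simp add: field_simps)
    finally have e: "cos (w * x + \<phi>) * (r * cos (?o * x + \<psi>)) = (r * cos ((w - ?o) * x)) * (cos (\<phi> - \<psi>) / 2)
        + (r * sin ((w - ?o) * x)) * (- sin (\<phi> - \<psi>) / 2)
        + (r * cos ((w + ?o) * x)) * (cos (\<phi> + \<psi>) / 2)
        + (r * sin ((w + ?o) * x)) * (- sin (\<phi> + \<psi>) / 2)" .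
    show ?thesis unfolding m1 m2 x_def[symmetric] e by (simp only: scaleR_left_distrib scaleR_scaleR)
  qed
  ultimately show "is_P1hat_fn m \<zeta> k (\<lambda>t. (cos (w * Lg j t + \<phi>) * monom_fn \<zeta> k \<alpha> b \<sigma> \<omega> t) *\<^sub>R \<xi>)"
    by simp
qed

text \<open>The additional variables receive exponent 0 and a cosine of frequency 0, which
  contribute the factor 1 as soon as the logarithms are positive.\<close>

lemma is_P1hat_fn_mono:
  assumes u: "is_P1hat_fn m \<zeta> k u" and \<zeta>: "\<forall>\<^sub>F t in at_top. 0 < \<zeta> t" and k: "m \<le> k" "k \<le> k'"
  shows "is_P1hat_fn m \<zeta> k' u"
proof -
  have "is_P1hat_fn m \<zeta> k' (\<lambda>t. 1 *\<^sub>R u t)"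
  proof (rule is_P1hat_fn_mult_I[OF u \<zeta>])
    fix \<alpha> b \<sigma> and \<omega> :: \<open>int \<Rightarrow> real\<close> and \<xi> :: 'a
    assume *: "\<alpha> \<in> exponents m k" "trig_choice k \<sigma>"
    let ?\<alpha> = "\<lambda>j\<in>{-1..int k'}. if j \<le> int k then \<alpha> j else 0"
    let ?\<sigma> = "\<lambda>j. if j \<le> int k then \<sigma> j else cos"
    let ?\<omega> = "\<lambda>j. if j \<le> int k then \<omega> j else 0"
    have \<alpha>: "?\<alpha> \<in> exponents m k'" using *(1) k by (auto simp: exponents_def)
    have \<sigma>: "trig_choice k' ?\<sigma>" using *(2) by (auto simp: trig_choice_def)
    have "\<forall>\<^sub>F t in at_top. (1 * monom_fn \<zeta> k \<alpha> b \<sigma> \<omega> t) *\<^sub>R \<xi> = monom_fn \<zeta> k' ?\<alpha> b ?\<sigma> ?\<omega> t *\<^sub>R \<xi>"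
      using log_tuple_pos[of k']
    proof eventually_elim
      case (elim t)
      have "tuple_powr k' (log_tuple k' t) ?\<alpha> = tuple_powr k (log_tuple k t) \<alpha>"
        unfolding tuple_powr_def
      proof (rule prod.mono_neutral_cong_right)
        show "\<forall>i\<in>{-1..int k'} - {-1..int k}. log_tuple k' t i powr ?\<alpha> i = 1"
          using elim by (auto simp: log_tuple_apply dest!: bspec)
      qed (use k in \<open>auto simp: log_tuple_def\<close>)
      moreover have "trig_prod k' ?\<sigma> ?\<omega> (log_tuple k' t) = trig_prod k \<sigma> \<omega> (log_tuple k t)"
        unfolding trig_prod_def
        by (rule prod.mono_neutral_cong_right) (use k in \<open>auto simp: log_tuple_def\<close>)
      ultimately show ?case by (simp add: monom_fn_def)
    qed
    with is_P1hat_fn_single[OF \<alpha> \<sigma>]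
    show "is_P1hat_fn m \<zeta> k' (\<lambda>t. (1 * monom_fn \<zeta> k \<alpha> b \<sigma> \<omega> t) *\<^sub>R \<xi>)"
      by (rule is_P1hat_fn_cong)
  qed
  then show ?thesis by simp
qed

context log_scale
begin

text \<open>The length k is uniform in \<xi>, so that a constant factor can be moved into \<xi> in
  the induction.\<close>

lemma amplitudes_is_P1hat_fn:
  fixes \<xi> :: "'x::real_vector"
  assumes "s \<in> amplitudes m \<zeta>"
  shows "\<exists>k\<ge>m. \<forall>\<xi>::'x. is_P1hat_fn m \<zeta> k (\<lambda>t. s t *\<^sub>R \<xi>)"
  using assms
proof (induction s rule: amplitudes.induct)
  case one
  let ?\<alpha> = "\<lambda>j\<in>{-1..int m}. 0" and ?\<sigma> = "\<lambda>j. cos" and ?\<omega> = "\<lambda>j. 0"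
  have "is_P1hat_fn m \<zeta> m (\<lambda>t. 1 *\<^sub>R \<xi>)" for \<xi> :: 'x
  proof (rule is_P1hat_fn_cong[OF is_P1hat_fn_single[of ?\<alpha> m m ?\<sigma>]])
    show "\<forall>\<^sub>F t in at_top. 1 *\<^sub>R \<xi> = monom_fn \<zeta> m ?\<alpha> 0 ?\<sigma> ?\<omega> t *\<^sub>R \<xi>"
      using log_tuple_pos[of m] zeta_pos
    proof eventually_elim
      case (elim t)
      have "tuple_powr m (log_tuple m t) ?\<alpha> = 1"
        unfolding tuple_powr_def by (rule prod.neutral) (use elim in \<open>auto simp: log_tuple_apply dest!: bspec\<close>)
      then show ?case using elim by (simp add: monom_fn_def trig_prod_def)
    qed
  qed (auto simp: exponents_def trig_choice_def)
  then show ?case by auto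
next
  case (const s c)
  then obtain k where k: "k \<ge> m" "\<And>\<xi>::'x. is_P1hat_fn m \<zeta> k (\<lambda>t. s t *\<^sub>R \<xi>)" by auto
  have "is_P1hat_fn m \<zeta> k (\<lambda>t. (c * s t) *\<^sub>R \<xi>)" for \<xi> :: 'x
    using k(2)[of "c *\<^sub>R \<xi>"] by (simp add: mult.commute)
  with k show ?case by auto
next
  case (log j s a)
  then obtain k where k: "k \<ge> m" "\<And>\<xi>::'x. is_P1hat_fn m \<zeta> k (\<lambda>t. s t *\<^sub>R \<xi>)" by auto
  have "is_P1hat_fn m \<zeta> (max k j) (\<lambda>t. (Lg j t powr a * s t) *\<^sub>R \<xi>)" for \<xi> :: 'x
    using is_P1hat_fn_log[OF is_P1hat_fn_mono[OF k(2) zeta_pos k(1), of "max k j" \<xi>] zeta_pos log(1), of a]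
    by simp
  with k show ?case by (intro exI[of _ "max k j"]) auto
next
  case (zeta s b)
  then obtain k where k: "k \<ge> m" "\<And>\<xi>::'x. is_P1hat_fn m \<zeta> k (\<lambda>t. s t *\<^sub>R \<xi>)" by auto
  have "is_P1hat_fn m \<zeta> k (\<lambda>t. (\<zeta> t powr b * s t) *\<^sub>R \<xi>)" for \<xi> :: 'x
    using is_P1hat_fn_zeta[OF k(2) zeta_pos, of b \<xi>] by simp
  with k show ?case by auto
next
  case (trig j s w \<phi>)
  then obtain k where k: "k \<ge> m" "\<And>\<xi>::'x. is_P1hat_fn m \<zeta> k (\<lambda>t. s t *\<^sub>R \<xi>)" by auto
  have "is_P1hat_fn m \<zeta> (max k j) (\<lambda>t. (cos (w * Lg j t + \<phi>) * s t) *\<^sub>R \<xi>)" for \<xi> :: 'x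
    using is_P1hat_fn_trig[OF is_P1hat_fn_mono[OF k(2) zeta_pos k(1), of "max k j" \<xi>] zeta_pos, of j w \<phi>]
    by simp
  with k show ?case by (intro exI[of _ "max k j"]) auto
qed

text \<open>Sorts the monomials by their power of L_m. The coefficients \<open>v\<close> are defined
  for all real \<nu> and vanish off E, so decompositions with different sets of exponents are added
  pointwise.\<close>

lemma graded_graded:
  fixes u :: "real \<Rightarrow> 'x::real_normed_vector"
  assumes "u \<in> graded m \<zeta> M"
  shows "\<exists>E v k. finite E \<and> E \<subseteq> {M..} \<and> m \<le> k \<and>
    (\<forall>\<nu>. v \<nu> \<in> graded m \<zeta> 0 \<and> is_P1hat_fn m \<zeta> k (v \<nu>)) \<and> (\<forall>\<nu>. \<nu> \<notin> E \<longrightarrow> v \<nu> = (\<lambda>t. 0)) \<and>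
    negligible_fn m (\<lambda>t. u t - (\<Sum>\<nu>\<in>E. Lg m t powr (- \<nu>) *\<^sub>R v \<nu> t))"
  using assms
proof (induction u rule: graded.induct)
  case (trm s a w \<phi> \<xi>)
  obtain k where k: "k \<ge> m" "\<And>\<xi>::'x. is_P1hat_fn m \<zeta> k (\<lambda>t. s t *\<^sub>R \<xi>)"
    using amplitudes_is_P1hat_fn[OF trm(1)] by blast
  define c where "c t = (cos (w * t + \<phi>) * s t) *\<^sub>R \<xi>" for t
  have c1: "is_P1hat_fn m \<zeta> k c"
    using is_P1hat_fn_trig[OF k(2) zeta_pos, of 0 w \<phi> \<xi>] by (simp add: c_def[abs_def])
  have c2: "c \<in> graded m \<zeta> 0"
  proof (rule graded_cong[OF graded.trm[OF trm(1), where M = 0 and a = 0 and w = w and \<phi> = \<phi> and \<xi> = \<xi>]])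
    show "\<forall>\<^sub>F t in at_top. c t = (Lg m t powr - 0 * cos (w * t + \<phi>) * s t) *\<^sub>R \<xi>"
      using eventually_Lg_gt[of 0 m] by eventually_elim (simp add: c_def)
  qed simp
  have "(Lg m t powr (- a) * cos (w * t + \<phi>) * s t) *\<^sub>R \<xi>
      - (\<Sum>\<nu>\<in>{a}. Lg m t powr (- \<nu>) *\<^sub>R (if \<nu> = a then c else (\<lambda>t. 0)) t) = 0" for t
    by (simp add: c_def mult.assoc)
  then show ?case
    by (intro exI[of _ "{a}"] exI[of _ "\<lambda>\<nu>. if \<nu> = a then c else (\<lambda>t. 0)"] exI[of _ k])
      (use c1 c2 k(1) trm(2) in \<open>auto simp: graded_zero is_P1hat_fn_zero negligible_eventually_0\<close>)
next
  case (add u1 u2)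
  obtain E1 v1 k1 where
    1: "finite E1" "E1 \<subseteq> {M..}" "m \<le> k1" "\<forall>\<nu>. v1 \<nu> \<in> graded m \<zeta> 0 \<and> is_P1hat_fn m \<zeta> k1 (v1 \<nu>)"
      "\<forall>\<nu>. \<nu> \<notin> E1 \<longrightarrow> v1 \<nu> = (\<lambda>t. 0)"
      "negligible_fn m (\<lambda>t. u1 t - (\<Sum>\<nu>\<in>E1. Lg m t powr (- \<nu>) *\<^sub>R v1 \<nu> t))"
    using add.IH(1) by (elim exE conjE) (rule that; assumption)
  obtain E2 v2 k2 where
    2: "finite E2" "E2 \<subseteq> {M..}" "m \<le> k2" "\<forall>\<nu>. v2 \<nu> \<in> graded m \<zeta> 0 \<and> is_P1hat_fn m \<zeta> k2 (v2 \<nu>)"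
      "\<forall>\<nu>. \<nu> \<notin> E2 \<longrightarrow> v2 \<nu> = (\<lambda>t. 0)"
      "negligible_fn m (\<lambda>t. u2 t - (\<Sum>\<nu>\<in>E2. Lg m t powr (- \<nu>) *\<^sub>R v2 \<nu> t))"
    using add.IH(2) by (elim exE conjE) (rule that; assumption)
  define v where "v \<nu> t = v1 \<nu> t + v2 \<nu> t" for \<nu> t
  have "v \<nu> \<in> graded m \<zeta> 0 \<and> is_P1hat_fn m \<zeta> (max k1 k2) (v \<nu>)" for \<nu>
    unfolding v_def
    by (intro conjI graded.add is_P1hat_fn_add zeta_pos is_P1hat_fn_mono[OF conjunct2[OF spec[OF 1(4)]] zeta_pos 1(3)]
        is_P1hat_fn_mono[OF conjunct2[OF spec[OF 2(4)]] zeta_pos 2(3)] conjunct1[OF spec[OF 1(4)]] conjunct1[OF spec[OF 2(4)]]) auto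
  moreover have "v \<nu> = (\<lambda>t. 0)" if "\<nu> \<notin> E1 \<union> E2" for \<nu>
    using that 1(5) 2(5) by (simp add: v_def[abs_def])
  moreover have "(\<Sum>\<nu>\<in>E1 \<union> E2. Lg m t powr (- \<nu>) *\<^sub>R v \<nu> t) =
      (\<Sum>\<nu>\<in>E1. Lg m t powr (- \<nu>) *\<^sub>R v1 \<nu> t) + (\<Sum>\<nu>\<in>E2. Lg m t powr (- \<nu>) *\<^sub>R v2 \<nu> t)" for t
  proof -
    have "(\<Sum>\<nu>\<in>E1 \<union> E2. Lg m t powr (- \<nu>) *\<^sub>R v1 \<nu> t) = (\<Sum>\<nu>\<in>E1. Lg m t powr (- \<nu>) *\<^sub>R v1 \<nu> t)"
      by (rule sum.mono_neutral_right) (use 1 2 in auto)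
    moreover have "(\<Sum>\<nu>\<in>E1 \<union> E2. Lg m t powr (- \<nu>) *\<^sub>R v2 \<nu> t) = (\<Sum>\<nu>\<in>E2. Lg m t powr (- \<nu>) *\<^sub>R v2 \<nu> t)"
      by (rule sum.mono_neutral_right) (use 1 2 in auto)
    ultimately show ?thesis by (simp add: v_def scaleR_add_right sum.distrib)
  qed
  moreover have "negligible_fn m (\<lambda>t. (u1 t - (\<Sum>\<nu>\<in>E1. Lg m t powr (- \<nu>) *\<^sub>R v1 \<nu> t)) +
      (u2 t - (\<Sum>\<nu>\<in>E2. Lg m t powr (- \<nu>) *\<^sub>R v2 \<nu> t)))"
    using 1(6) 2(6) unfolding negligible_fn_def by (intro allI log_bigo_add) simp_all
  ultimately show ?case
    using 1(1-3) 2(1-3)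
    by (intro exI[of _ "E1 \<union> E2"] exI[of _ v] exI[of _ "max k1 k2"]) (auto simp: algebra_simps)
next
  case (neg u1 u2)
  obtain E v k where
    1: "finite E" "E \<subseteq> {M..}" "m \<le> k" "\<forall>\<nu>. v \<nu> \<in> graded m \<zeta> 0 \<and> is_P1hat_fn m \<zeta> k (v \<nu>)"
      "\<forall>\<nu>. \<nu> \<notin> E \<longrightarrow> v \<nu> = (\<lambda>t. 0)"
      "negligible_fn m (\<lambda>t. u1 t - (\<Sum>\<nu>\<in>E. Lg m t powr (- \<nu>) *\<^sub>R v \<nu> t))"
    using neg.IH by (elim exE conjE) (rule that; assumption)
  have "log_bigo m a (\<lambda>t. (u2 t - u1 t) + (u1 t - (\<Sum>\<nu>\<in>E. Lg m t powr (- \<nu>) *\<^sub>R v \<nu> t)))" for a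
    using neg(2) 1(6) unfolding negligible_fn_def by (intro log_bigo_add) auto
  then have "negligible_fn m (\<lambda>t. u2 t - (\<Sum>\<nu>\<in>E. Lg m t powr (- \<nu>) *\<^sub>R v \<nu> t))"
    by (simp add: negligible_fn_def)
  with 1 show ?case by blast
qed

end

subsection \<open>Regrouping by powers\<close>

context log_scale
begin

lemma log_bigo_remainder_bound:
  assumes "log_bigo m a (\<lambda>t. u t - (\<Sum>k=1..N. Lg m t powr (- \<mu> k) *\<^sub>R w k t))"
    and "\<And>k. k \<in> {1..N} \<Longrightarrow> \<forall>\<^sub>F t in at_top. w k t = v k t"
  shows "remainder_bound m u v \<mu> N a"
proof -
  have "\<forall>\<^sub>F t in at_top. \<forall>k\<in>{1..N}. w k t = v k t"
    by (intro eventually_ball_finite ballI assms(2)) auto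
  then have "\<forall>\<^sub>F t in at_top. u t - (\<Sum>k=1..N. Lg m t powr (- \<mu> k) *\<^sub>R v k t) =
      u t - (\<Sum>k=1..N. Lg m t powr (- \<mu> k) *\<^sub>R w k t)"
    by eventually_elim simp
  from log_bigo_cong[OF assms(1) this] obtain C where
    "\<forall>\<^sub>F t in at_top. norm (u t - (\<Sum>k=1..N. Lg m t powr (- \<mu> k) *\<^sub>R v k t)) \<le> C * Lg m t powr (- a)"
    by (rule log_bigo_E)
  then show ?thesis
    unfolding remainder_bound_def iter_log_int by (intro bigoI[of _ C]) simp
qed

text \<open>A series of \<open>graded\<close>-functions of increasing order becomes an expansion with strictly increasing
  powers: all exponents that occur form a locally finite set (to which the positive integers are added to make
  it infinite), and only finitely many of the functions contribute to each power.\<close>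

lemma regroup_expansion:
  fixes W :: "nat \<Rightarrow> real \<Rightarrow> 'x::real_normed_vector"
  assumes W: "\<And>j. W j \<in> graded m \<zeta> (M j)" and M_pos: "\<And>j. M j > 0"
    and M_lim: "filterlim M at_top sequentially"
  shows "\<exists>\<mu> n h. (\<forall>k\<ge>1. \<mu> k > 0) \<and> strict_mono_on {1..} \<mu> \<and> filterlim \<mu> at_top sequentially \<and>
    mono n \<and> n 0 = n0 \<and> (\<forall>k\<ge>1. h k \<in> P1hat m (n k)) \<and>
    (\<forall>y. (\<forall>a. \<forall>\<^sub>F j in sequentially. log_bigo m a (\<lambda>t. y t - (\<Sum>i<j. W i t))) \<longrightarrow>
       asymp_expansion m y (\<lambda>k t. h k (log_tuple (n k) t) (\<zeta> t)) \<mu>)"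
proof -
  define good where "good j E v k \<longleftrightarrow> finite E \<and> E \<subseteq> {M j..} \<and> m \<le> k \<and>
    (\<forall>\<nu>. v \<nu> \<in> graded m \<zeta> 0 \<and> is_P1hat_fn m \<zeta> k (v \<nu>)) \<and> (\<forall>\<nu>. \<nu> \<notin> E \<longrightarrow> v \<nu> = (\<lambda>t. 0)) \<and>
    negligible_fn m (\<lambda>t. W j t - (\<Sum>\<nu>\<in>E. Lg m t powr (- \<nu>) *\<^sub>R v \<nu> t))" for j E v k
  have "\<forall>j. \<exists>E v k. good j E v k" using graded_graded[OF W] unfolding good_def by blast
  then obtain E v \<kappa> where good: "\<And>j. good j (E j) (v j) (\<kappa> j)" by metis
  have E: "finite (E j)" "E j \<subseteq> {M j..}" and \<kappa>: "m \<le> \<kappa> j"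
    and v: "v j \<nu> \<in> graded m \<zeta> 0" "is_P1hat_fn m \<zeta> (\<kappa> j) (v j \<nu>)" "\<nu> \<notin> E j \<Longrightarrow> v j \<nu> = (\<lambda>t. 0)"
    and negl: "negligible_fn m (\<lambda>t. W j t - (\<Sum>\<nu>\<in>E j. Lg m t powr (- \<nu>) *\<^sub>R v j \<nu> t))" for j \<nu>
    using good[of j] unfolding good_def by blast+
  define EE where "EE = (\<Union>j. E j) \<union> real ` {1..}"
  have "infinite (real ` {1..})" by (metis finite_imageD infinite_Ici inj_on_of_nat)
  then have inf: "infinite EE" by (simp add: EE_def)
  have pos: "x > 0" if x: "x \<in> EE" for x
  proof (cases "x \<in> real ` {1..}")
    case False
    then obtain j where "x \<in> E j" using x by (auto simp: EE_def)
    then have "M j \<le> x" using E(2)[of j] by auto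
    then show ?thesis using M_pos[of j] by simp
  qed auto
  have large: "\<exists>J. \<forall>j\<ge>J. Z < M j" for Z
    using M_lim unfolding filterlim_at_top_dense eventually_sequentially by blast
  have fin: "finite (EE \<inter> {..Z})" for Z
  proof -
    obtain J where J: "\<And>j. j \<ge> J \<Longrightarrow> Z < M j" using large by blast
    have "EE \<inter> {..Z} \<subseteq> (\<Union>j<J. E j) \<union> real ` {..nat \<lceil>Z\<rceil>}"
    proof
      fix x assume x: "x \<in> EE \<inter> {..Z}"
      show "x \<in> (\<Union>j<J. E j) \<union> real ` {..nat \<lceil>Z\<rceil>}"
      proof (cases "x \<in> real ` {1..}")
        case True
        then obtain i where "x = real i" by auto
        with x have "i \<le> nat \<lceil>Z\<rceil>" by (auto simp: le_nat_iff) linarith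
        with \<open>x = real i\<close> show ?thesis by auto
      next
        case False
        then obtain j where j: "x \<in> E j" using x by (auto simp: EE_def)
        then have "M j \<le> Z" using E(2)[of j] x by auto
        then have "j < J" using J[of j] by (meson leD leI)
        with j show ?thesis by auto
      qed
    qed
    then show ?thesis by (rule finite_subset) (auto intro: E)
  qed
  obtain e where e: "strict_mono e" "range e = EE" "filterlim e at_top sequentially"
    using exists_strict_mono_enumeration[OF inf pos fin] by blast
  obtain J where J: "\<And>x j. j \<ge> J x \<Longrightarrow> x < M j" using large by metis
  have v_zero: "v j x = (\<lambda>t. 0)" if "x < M j" for j x
    using E(2)[of j] that by (intro v(3)) auto
  define \<mu> where "\<mu> k = e (k - 1)" for k
  define w where "w k t = (\<Sum>j<J (\<mu> k). v j (\<mu> k) t)" for k t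
  define \<kappa>' where "\<kappa>' k = Max (insert m (\<kappa> ` {..<J (\<mu> k)}))" for k
  \<comment> \<open>Partial sums make \<open>n\<close> monotone and at least \<kappa>' k. The start
    \<open>n0\<close> is prescribed because the value at 0 is the tuple length for \<zeta>.\<close>
  define n where "n k = n0 + (\<Sum>i=1..k. \<kappa>' i)" for k
  have n: "\<kappa>' k \<le> n k" if "k \<ge> 1" for k
    unfolding n_def using that by (intro trans_le_add2 member_le_sum) auto
  have w_rep: "is_P1hat_fn m \<zeta> (n k) (w k)" if k: "k \<ge> 1" for k
    unfolding w_def
  proof (rule is_P1hat_fn_sum[OF _ _ zeta_pos])
    fix j assume "j \<in> {..<J (\<mu> k)}"
    then have "\<kappa> j \<le> \<kappa>' k" by (auto simp: \<kappa>'_def simp del: Max_insert intro!: Max_ge)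
    then show "is_P1hat_fn m \<zeta> (n k) (v j (\<mu> k))"
      using n[OF k] by (intro is_P1hat_fn_mono[OF v(2) zeta_pos \<kappa>]) simp
  qed simp
  then have "\<forall>k. \<exists>h. k \<ge> 1 \<longrightarrow> h \<in> P1hat m (n k) \<and> (\<forall>\<^sub>F t in at_top. w k t = h (log_tuple (n k) t) (\<zeta> t))"
    unfolding is_P1hat_fn_def by blast
  then obtain h where h: "\<And>k. k \<ge> 1 \<Longrightarrow> h k \<in> P1hat m (n k)"
    "\<And>k. k \<ge> 1 \<Longrightarrow> \<forall>\<^sub>F t in at_top. w k t = h k (log_tuple (n k) t) (\<zeta> t)" by metis
  have "\<mu> k > 0" for k unfolding \<mu>_def using e(2) pos by auto
  moreover have "strict_mono_on {1..} \<mu>"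
    using e(1) by (auto simp: \<mu>_def strict_mono_on_def strict_mono_def)
  moreover have "filterlim \<mu> at_top sequentially"
  proof -
    have "filterlim (\<lambda>k. \<mu> (Suc k)) at_top sequentially" using e(3) by (simp add: \<mu>_def)
    then show ?thesis by (simp only: filterlim_sequentially_Suc)
  qed
  moreover have "mono n"
    unfolding n_def by (intro monoI add_left_mono sum_mono2) auto
  moreover have "asymp_expansion m y (\<lambda>k t. h k (log_tuple (n k) t) (\<zeta> t)) \<mu>"
    if y: "\<And>a. \<forall>\<^sub>F j in sequentially. log_bigo m a (\<lambda>t. y t - (\<Sum>i<j. W i t))" for y
    unfolding asymp_expansion_def
  proof (intro allI impI)
    fix N :: nat assume N: "N \<ge> 1"
    have lt: "\<mu> N < \<mu> (Suc N)" using e(1) N by (simp add: \<mu>_def strict_mono_def)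
    \<comment> \<open>The midpoint exceeds \<mu> N, as an expansion demands, and stays below the
      next exponent, which leaves room for the growth of the coefficients.\<close>
    define a where "a = (\<mu> N + \<mu> (Suc N)) / 2"
    have a: "\<mu> N < a" "a < \<mu> (Suc N)" using lt by (auto simp: a_def)
    have "\<forall>\<^sub>F j in sequentially. \<forall>k\<in>{1..N}. J (\<mu> k) \<le> j"
      by (intro eventually_ball_finite ballI eventually_ge_at_top) simp
    from eventually_happens'[OF sequentially_bot eventually_conj[OF this y[of a]]]
    obtain L where L: "\<And>k. k \<in> {1..N} \<Longrightarrow> J (\<mu> k) \<le> L" and yL: "log_bigo m a (\<lambda>t. y t - (\<Sum>i<L. W i t))" by blast
    \<comment> \<open>\<open>L\<close> exceeds every \<open>J (\<mu> k)\<close>, so the first N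
      coefficients are already complete in this partial sum.\<close>
    have wL: "w k t = (\<Sum>j<L. v j (\<mu> k) t)" if k: "k \<in> {1..N}" for k t
      unfolding w_def
      by (rule sum.mono_neutral_left) (use L[OF k] J in \<open>auto simp: v_zero\<close>)
    have inj: "inj_on \<mu> {1..N}"
      using e(1) by (auto simp: \<mu>_def inj_on_def strict_mono_eq)
    have EN: "E j \<inter> {..\<mu> N} \<subseteq> \<mu> ` {1..N}" for j
    proof
      fix x assume x: "x \<in> E j \<inter> {..\<mu> N}"
      then have "x \<in> range e" by (auto simp: e(2) EE_def)
      then obtain i where i: "x = e i" by auto
      with x have "e i \<le> e (N - 1)" by (simp add: \<mu>_def)
      then have "i \<le> N - 1" by (simp add: strict_mono_less_eq[OF e(1)])
      with N i show "x \<in> \<mu> ` {1..N}" by (intro image_eqI[of _ _ "Suc i"]) (auto simp: \<mu>_def)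
    qed
    have split: "(\<Sum>\<nu>\<in>E j. Lg m t powr (- \<nu>) *\<^sub>R v j \<nu> t) - (\<Sum>k=1..N. Lg m t powr (- \<mu> k) *\<^sub>R v j (\<mu> k) t)
       = (\<Sum>\<nu>\<in>E j - {..\<mu> N}. Lg m t powr (- \<nu>) *\<^sub>R v j \<nu> t)" for j t
    proof -
      have le: "\<mu> k \<le> \<mu> N" if "k \<in> {1..N}" for k
        using that e(1) by (simp add: \<mu>_def strict_mono_less_eq diff_le_mono)
      have "(\<Sum>k=1..N. Lg m t powr (- \<mu> k) *\<^sub>R v j (\<mu> k) t) = (\<Sum>\<nu>\<in>\<mu> ` {1..N}. Lg m t powr (- \<nu>) *\<^sub>R v j \<nu> t)"
        by (subst sum.reindex[OF inj]) (simp add: o_def)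
      also have "\<dots> = (\<Sum>\<nu>\<in>E j \<inter> {..\<mu> N}. Lg m t powr (- \<nu>) *\<^sub>R v j \<nu> t)"
      proof (rule sum.mono_neutral_right)
        show "\<forall>x\<in>\<mu> ` {1..N} - E j \<inter> {..\<mu> N}. Lg m t powr (- x) *\<^sub>R v j x t = 0"
        proof
          fix x assume "x \<in> \<mu> ` {1..N} - E j \<inter> {..\<mu> N}"
          then have "x \<notin> E j" using le by auto
          then show "Lg m t powr (- x) *\<^sub>R v j x t = 0" by (simp add: v(3))
        qed
      qed (use EN[of j] in auto)
      finally show ?thesis
        using sum.Int_Diff[OF E(1)[of j], of "\<lambda>\<nu>. Lg m t powr (- \<nu>) *\<^sub>R v j \<nu> t" "{..\<mu> N}"] by simp
    qed
    have tail: "log_bigo m a (\<lambda>t. \<Sum>\<nu>\<in>E j - {..\<mu> N}. Lg m t powr (- \<nu>) *\<^sub>R v j \<nu> t)" for j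
    proof (rule log_bigo_sum)
      fix \<nu> assume \<nu>: "\<nu> \<in> E j - {..\<mu> N}"
      then have "\<nu> \<in> range e" by (auto simp: e(2) EE_def)
      then obtain i where i: "\<nu> = e i" by auto
      with \<nu> have "e (N - 1) < e i" by (simp add: \<mu>_def)
      then have "N - 1 < i" by (simp add: strict_mono_less[OF e(1)])
      then have "\<mu> (Suc N) \<le> \<nu>" using i by (simp add: \<mu>_def strict_mono_less_eq[OF e(1)])
      with a have "a - \<nu> < 0" by simp
      from log_bigo_scaleR[OF log_bigo_powr[of m \<nu>] graded_log_bigo[OF v(1) this]]
      show "log_bigo m a (\<lambda>t. Lg m t powr (- \<nu>) *\<^sub>R v j \<nu> t)" by simp
    qed (use E in auto)
    have "log_bigo m a (\<lambda>t. (y t - (\<Sum>i<L. W i t))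
        + (\<Sum>j<L. (W j t - (\<Sum>\<nu>\<in>E j. Lg m t powr (- \<nu>) *\<^sub>R v j \<nu> t)))
        + (\<Sum>j<L. (\<Sum>\<nu>\<in>E j - {..\<mu> N}. Lg m t powr (- \<nu>) *\<^sub>R v j \<nu> t)))"
      using negl unfolding negligible_fn_def by (intro log_bigo_add log_bigo_sum yL tail) auto
    moreover have "(y t - (\<Sum>i<L. W i t))
        + (\<Sum>j<L. (W j t - (\<Sum>\<nu>\<in>E j. Lg m t powr (- \<nu>) *\<^sub>R v j \<nu> t)))
        + (\<Sum>j<L. (\<Sum>\<nu>\<in>E j - {..\<mu> N}. Lg m t powr (- \<nu>) *\<^sub>R v j \<nu> t))
        = y t - (\<Sum>k=1..N. Lg m t powr (- \<mu> k) *\<^sub>R w k t)" for t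
    proof -
      have "(\<Sum>k=1..N. Lg m t powr (- \<mu> k) *\<^sub>R w k t) = (\<Sum>j<L. \<Sum>k=1..N. Lg m t powr (- \<mu> k) *\<^sub>R v j (\<mu> k) t)"
        by (subst sum.swap) (simp add: wL scaleR_sum_right)
      then show ?thesis by (simp add: split[symmetric] sum_subtractf)
    qed
    ultimately have "log_bigo m a (\<lambda>t. y t - (\<Sum>k=1..N. Lg m t powr (- \<mu> k) *\<^sub>R w k t))" by simp
    then have "remainder_bound m y (\<lambda>k t. h k (log_tuple (n k) t) (\<zeta> t)) \<mu> N a"
      by (rule log_bigo_remainder_bound) (use h(2) in auto)
    with a show "\<exists>b>\<mu> N. remainder_bound m y (\<lambda>k t. h k (log_tuple (n k) t) (\<zeta> t)) \<mu> N b" by blast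
  qed
  ultimately show ?thesis using h(1)
    by (intro exI[of _ \<mu>] exI[of _ n] exI[of _ h]) (simp add: n_def)
qed

section \<open>Products of later logarithms and the leading term of the forcing\<close>

lemma log_prod_amplitudes: "(\<lambda>t. \<Prod>j\<in>{m<..k}. Lg j t powr \<alpha> j) \<in> amplitudes m \<zeta>"
  by (rule amplitudes_prod) (auto intro: amplitudes_log)

lemma slow_log_prod: "slow (\<lambda>t. \<Prod>j\<in>{m<..k}. Lg j t powr \<alpha> j)"
  by (rule slow_prod) (auto intro: slow_log amplitudes_log)

end

text \<open>The growth of products of logarithms is needed to show that \<open>g0\<close> defines a
  scale at all; the constant scale provides it without circularity.\<close>

lemma log_scale_one: "log_scale m (\<lambda>t. 1)"
proof
  fix \<epsilon> b :: real assume "\<epsilon> > 0"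
  have "log_bigo m 0 (\<lambda>t. 1 powr b)"
    by (rule log_bigo_I[of _ 1]) (use eventually_Lg_gt[of 0 m] in \<open>auto elim: eventually_mono\<close>)
  then show "log_bigo m (- \<epsilon>) (\<lambda>t. 1 powr b)" using \<open>\<epsilon> > 0\<close> by (auto intro: log_bigo_mono)
qed simp

lemma log_bigo_log_prod: "\<epsilon> > 0 \<Longrightarrow> log_bigo m (- \<epsilon>) (\<lambda>t. \<Prod>j\<in>{m<..k}. Lg j t powr \<alpha> j)"
  by (rule log_scale.amplitudes_log_bigo[OF log_scale_one log_scale.log_prod_amplitudes[OF log_scale_one]])

lemma tuple_powr_log_tuple:
  assumes \<alpha>: "\<alpha> \<in> exponents m k"
  shows "\<forall>\<^sub>F t in at_top. tuple_powr k (log_tuple k t) \<alpha> = (\<Prod>j\<in>{m<..k}. Lg j t powr \<alpha> (int j))"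
  using log_tuple_pos[of k]
proof eventually_elim
  case (elim t)
  have "tuple_powr k (log_tuple k t) \<alpha> = (\<Prod>j\<in>int ` {m<..k}. log_tuple k t j powr \<alpha> j)"
    unfolding tuple_powr_def
  proof (rule prod.mono_neutral_right)
    show "\<forall>i\<in>{-1..int k} - int ` {m<..k}. log_tuple k t i powr \<alpha> i = 1"
    proof
      fix i assume i: "i \<in> {-1..int k} - int ` {m<..k}"
      have "i \<le> int m"
      proof (rule ccontr)
        assume "\<not> i \<le> int m"
        with i have "i = int (nat i)" "nat i \<in> {m<..k}" by auto
        with i show False by blast
      qed
      with i \<alpha> have "\<alpha> i = 0" by (auto simp: exponents_def)
      moreover have "log_tuple k t i > 0" using i elim by (simp add: log_tuple_apply)
      ultimately show "log_tuple k t i powr \<alpha> i = 1" by simp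
    qed
  qed auto
  also have "\<dots> = (\<Prod>j\<in>{m<..k}. Lg j t powr \<alpha> (int j))"
    by (subst prod.reindex) (auto simp: log_tuple_apply)
  finally show ?case .
qed

text \<open>At the first index j0 where the exponents differ, a negative power of L_j0 remains.
  Taken as the base scale, L_j0 outweighs all powers of later logarithms.\<close>

lemma lex_less_powr_tendsto_0:
  assumes \<alpha>: "\<alpha> \<in> exponents m k" and \<alpha>': "\<alpha>' \<in> exponents m k" and less: "lex_less k \<alpha> \<alpha>'"
  shows "((\<lambda>t. \<Prod>j\<in>{m<..k}. Lg j t powr (\<alpha> (int j) - \<alpha>' (int j))) \<longlongrightarrow> 0) at_top"
proof -
  obtain j0' where j0': "j0' \<in> {-1..int k}" "\<alpha> j0' < \<alpha>' j0'" "\<forall>i\<in>{-1..<j0'}. \<alpha> i = \<alpha>' i"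
    using less unfolding lex_less_def by blast
  have "j0' > int m"
  proof (rule ccontr)
    assume "\<not> j0' > int m"
    then have "\<alpha> j0' = 0" "\<alpha>' j0' = 0" using \<alpha> \<alpha>' j0' by (auto simp: exponents_def)
    with j0' show False by simp
  qed
  define j0 where "j0 = nat j0'"
  have j0: "m < j0" "j0 \<le> k" "\<alpha> (int j0) < \<alpha>' (int j0)" "\<And>i. i < j0 \<Longrightarrow> \<alpha> (int i) = \<alpha>' (int i)"
    using j0' \<open>j0' > int m\<close> by (auto simp: j0_def)
  define d where "d = \<alpha>' (int j0) - \<alpha> (int j0)"
  have d: "d > 0" using j0 by (simp add: d_def)
  have "log_bigo j0 (d + - (d / 2)) (\<lambda>t. Lg j0 t powr (- d) *\<^sub>R (\<Prod>j\<in>{j0<..k}. Lg j t powr (\<alpha> (int j) - \<alpha>' (int j))))"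
    using d by (intro log_bigo_scaleR log_bigo_powr log_bigo_log_prod) simp
  then have O: "log_bigo j0 (d / 2) (\<lambda>t. Lg j0 t powr (- d) * (\<Prod>j\<in>{j0<..k}. Lg j t powr (\<alpha> (int j) - \<alpha>' (int j))))"
    by simp
  have "\<forall>\<^sub>F t in at_top. \<forall>j\<in>{..k}. 0 < Lg j t"
    by (intro eventually_ball_finite ballI eventually_Lg_gt) simp
  then have "\<forall>\<^sub>F t in at_top. (\<Prod>j\<in>{m<..k}. Lg j t powr (\<alpha> (int j) - \<alpha>' (int j))) =
      Lg j0 t powr (- d) * (\<Prod>j\<in>{j0<..k}. Lg j t powr (\<alpha> (int j) - \<alpha>' (int j)))"
  proof eventually_elim
    case (elim t)
    have "(\<Prod>j\<in>{m<..k}. Lg j t powr (\<alpha> (int j) - \<alpha>' (int j))) =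
        (\<Prod>j\<in>insert j0 {j0<..k}. Lg j t powr (\<alpha> (int j) - \<alpha>' (int j)))"
    proof (rule prod.mono_neutral_right)
      show "\<forall>i\<in>{m<..k} - insert j0 {j0<..k}. Lg i t powr (\<alpha> (int i) - \<alpha>' (int i)) = 1"
      proof
        fix i assume "i \<in> {m<..k} - insert j0 {j0<..k}"
        then have "i < j0" "i \<le> k" by auto
        moreover have "0 < Lg i t" using elim \<open>i \<le> k\<close> by simp
        ultimately show "Lg i t powr (\<alpha> (int i) - \<alpha>' (int i)) = 1" using j0(4)[of i] by simp
      qed
    qed (use j0 in auto)
    then show ?case by (simp add: d_def)
  qed
  from log_bigo_cong[OF O this] show ?thesis by (rule log_bigo_tendsto_0) (use d in simp)
qed

text \<open>The factor in z_0 = t is split off because amplitudes oscillate only in L_j with j >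
  0.\<close>

lemma trig_prod_log_tuple:
  assumes "trig_choice k \<sigma>"
  shows "\<exists>\<psi>. \<forall>t. trig_prod k \<sigma> \<omega> (log_tuple k t) = cos (\<omega> 0 * t + \<psi> 0) *
    (\<Prod>j\<in>{1..k}. cos (\<omega> (int j) * Lg j t + \<psi> j))"
proof -
  obtain \<psi> where \<psi>: "\<And>j x. j \<le> k \<Longrightarrow> \<sigma> (int j) x = cos (x + \<psi> j)"
    using trig_choice_shift[OF assms] by metis
  have "trig_prod k \<sigma> \<omega> (log_tuple k t) = cos (\<omega> 0 * t + \<psi> 0) *
    (\<Prod>j\<in>{1..k}. cos (\<omega> (int j) * Lg j t + \<psi> j))" for t
  proof -
    have "{0..int k} = int ` {0..k}" by (simp add: image_int_atLeastAtMost)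
    then have "trig_prod k \<sigma> \<omega> (log_tuple k t) = (\<Prod>j\<in>{0..k}. \<sigma> (int j) (\<omega> (int j) * log_tuple k t (int j)))"
      unfolding trig_prod_def by (simp add: prod.reindex)
    also have "\<dots> = (\<Prod>j\<in>{0..k}. cos (\<omega> (int j) * Lg j t + \<psi> j))"
      by (rule prod.cong) (auto simp: \<psi> log_tuple_apply)
    finally show ?thesis by (simp add: prod.atLeast_Suc_atMost)
  qed
  then show ?thesis by blast
qed

lemma P1_in_graded:
  fixes p :: "(int \<Rightarrow> real) \<Rightarrow> 'x::real_normed_vector"
  assumes "p \<in> P1 m k"
  shows "(\<lambda>t. Lg m t powr (- a) *\<^sub>R p (log_tuple k t)) \<in> graded m \<zeta> a"
proof -
  obtain N :: nat and \<alpha> \<sigma> \<omega> \<xi> where 1: "\<forall>i<N. \<alpha> i \<in> exponents m k \<and> trig_choice k (\<sigma> i)"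
    and 2: "\<forall>z\<in>pos_tuples k. p z = (\<Sum>i<N. (tuple_powr k z (\<alpha> i) * trig_prod k (\<sigma> i) (\<omega> i) z) *\<^sub>R \<xi> i)"
    using assms unfolding P1_def mem_Collect_eq by (elim exE conjE) (rule that; assumption)
  have "\<exists>\<psi>. \<forall>t. trig_prod k (\<sigma> i) (\<omega> i) (log_tuple k t) = cos (\<omega> i 0 * t + \<psi> 0) *
    (\<Prod>j\<in>{1..k}. cos (\<omega> i (int j) * Lg j t + \<psi> j))" if "i < N" for i
    using 1 that by (intro trig_prod_log_tuple) simp
  then obtain \<psi> where \<psi>: "\<And>i t. i < N \<Longrightarrow> trig_prod k (\<sigma> i) (\<omega> i) (log_tuple k t) = cos (\<omega> i 0 * t + \<psi> i 0) *
    (\<Prod>j\<in>{1..k}. cos (\<omega> i (int j) * Lg j t + \<psi> i j))" by metis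
  let ?s = "\<lambda>i t. (\<Prod>j\<in>{m<..k}. Lg j t powr \<alpha> i (int j)) * (\<Prod>j\<in>{1..k}. cos (\<omega> i (int j) * Lg j t + \<psi> i j))"
  have "(\<lambda>t. \<Sum>i<N. (Lg m t powr (- a) * cos (\<omega> i 0 * t + \<psi> i 0) * ?s i t) *\<^sub>R \<xi> i) \<in> graded m \<zeta> a"
    by (intro graded_sum graded.trm amplitudes_mult amplitudes_prod amplitudes_log amplitudes_trig) auto
  moreover have "\<forall>\<^sub>F t in at_top. \<forall>i\<in>{..<N}. tuple_powr k (log_tuple k t) (\<alpha> i) =
      (\<Prod>j\<in>{m<..k}. Lg j t powr \<alpha> i (int j))"
    by (intro eventually_ball_finite ballI tuple_powr_log_tuple) (use 1 in auto)
  then have "\<forall>\<^sub>F t in at_top. Lg m t powr (- a) *\<^sub>R p (log_tuple k t) =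
      (\<Sum>i<N. (Lg m t powr (- a) * cos (\<omega> i 0 * t + \<psi> i 0) * ?s i t) *\<^sub>R \<xi> i)"
    using log_tuple_in_pos_tuples[of k]
    by eventually_elim (simp add: 2 \<psi> scaleR_sum_right mult_ac)
  ultimately show ?thesis by (rule graded_cong)
qed

lemma (in log_scale) slow_cong:
  assumes "slow s" "\<forall>\<^sub>F t in at_top. r t = s t"
  shows "slow r"
proof -
  obtain s' where s': "\<forall>\<^sub>F t in at_top. (s has_real_derivative s' t) (at t)" "s' \<in> graded m \<zeta> 1"
    using assms(1) unfolding slow_def by blast
  obtain T where T: "\<And>t. t \<ge> T \<Longrightarrow> r t = s t"
    using assms(2) unfolding eventually_at_top_linorder by blast
  have "\<forall>\<^sub>F t in at_top. (r has_real_derivative s' t) (at t)"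
    using s'(1) eventually_gt_at_top[of T]
  proof eventually_elim
    case (elim t)
    have "\<forall>\<^sub>F x in nhds t. x \<in> {T<..}" using elim by (intro eventually_nhds_in_open) auto
    then have "\<forall>\<^sub>F x in nhds t. r x = s x" by eventually_elim (simp add: T)
    with elim(1) show ?case by (simp add: DERIV_cong_ev)
  qed
  with s'(2) show ?thesis by (rule slow_I[rotated])
qed

text \<open>The leading monomial dominates \<open>g0\<close>, whose other terms do not oscillate in \<open>t\<close>.\<close>

lemma Pplus_slow_log_scale:
  assumes "g0 \<in> Pplus m k"
  defines "\<zeta> \<equiv> \<lambda>t. g0 (log_tuple k t)"
  shows "slow_log_scale m \<zeta>"
proof -
  obtain \<alpha>max c and N :: nat and \<alpha> \<sigma> \<omega> \<xi> where \<alpha>max: "\<alpha>max \<in> exponents m k" and c: "c > 0"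
    and 1: "\<forall>i<N. \<alpha> i \<in> exponents m k \<and> trig_choice k (\<sigma> i) \<and> lex_less k (\<alpha> i) \<alpha>max \<and> \<omega> i 0 = 0"
    and 2: "\<forall>z\<in>pos_tuples k. g0 z = c * tuple_powr k z \<alpha>max +
              (\<Sum>i<N. tuple_powr k z (\<alpha> i) * trig_prod k (\<sigma> i) (\<omega> i) z * \<xi> i)"
    using assms(1) unfolding Pplus_def mem_Collect_eq by (elim exE conjE) (rule that; assumption)
  have "\<exists>\<psi>. \<forall>t. trig_prod k (\<sigma> i) (\<omega> i) (log_tuple k t) = cos (\<omega> i 0 * t + \<psi> 0) *
    (\<Prod>j\<in>{1..k}. cos (\<omega> i (int j) * Lg j t + \<psi> j))" if "i < N" for i
    using 1 that by (intro trig_prod_log_tuple) simp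
  then obtain \<psi> where \<psi>: "\<And>i t. i < N \<Longrightarrow> trig_prod k (\<sigma> i) (\<omega> i) (log_tuple k t) = cos (\<omega> i 0 * t + \<psi> i 0) *
    (\<Prod>j\<in>{1..k}. cos (\<omega> i (int j) * Lg j t + \<psi> i j))" by metis
  define L where "L \<beta> t = (\<Prod>j\<in>{m<..k}. Lg j t powr \<beta> j)" for \<beta> :: "nat \<Rightarrow> real" and t
  let ?A = "\<lambda>j. \<alpha>max (int j)"
  \<comment> \<open>With frequency 0 in z_0 the first factor of the trigonometric product is the
    constant cos (\<psi> i 0), so the product is an amplitude.\<close>
  define \<tau> where "\<tau> i t = cos (\<psi> i 0) * (\<Prod>j\<in>{1..k}. cos (\<omega> i (int j) * Lg j t + \<psi> i j))" for i t
  have \<tau>: "\<bar>\<tau> i t\<bar> \<le> 1" for i t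
    unfolding \<tau>_def abs_mult abs_prod by (intro mult_le_one prod_le_1 prod_nonneg) auto
  have ev_pos: "\<forall>\<^sub>F t in at_top. \<forall>j\<in>{..k}. 0 < Lg j t"
    by (intro eventually_ball_finite ballI eventually_Lg_gt) simp
  have L_pos: "\<forall>\<^sub>F t in at_top. 0 < L \<beta> t" for \<beta>
    using ev_pos
  proof eventually_elim
    case (elim t)
    have "0 < Lg j t powr \<beta> j" if "j \<in> {m<..k}" for j
    proof -
      have "0 < Lg j t" using elim that by simp
      then show ?thesis by simp
    qed
    then show ?case unfolding L_def by (intro prod_pos)
  qed
  have "\<forall>\<^sub>F t in at_top. \<forall>i\<in>{..<N}. tuple_powr k (log_tuple k t) (\<alpha> i) = L (\<lambda>j. \<alpha> i (int j)) t"
    unfolding L_def by (intro eventually_ball_finite ballI tuple_powr_log_tuple) (use 1 in auto)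
  moreover have "\<forall>\<^sub>F t in at_top. tuple_powr k (log_tuple k t) \<alpha>max = L ?A t"
    unfolding L_def by (rule tuple_powr_log_tuple[OF \<alpha>max])
  ultimately have \<zeta>_eq: "\<forall>\<^sub>F t in at_top. \<zeta> t = c * L ?A t + (\<Sum>i<N. L (\<lambda>j. \<alpha> i (int j)) t * \<tau> i t * \<xi> i)"
    using log_tuple_in_pos_tuples[of k]
  proof eventually_elim
    case (elim t)
    have "\<zeta> t = c * L ?A t + (\<Sum>i<N. L (\<lambda>j. \<alpha> i (int j)) t * trig_prod k (\<sigma> i) (\<omega> i) (log_tuple k t) * \<xi> i)"
      using elim 2 by (simp add: \<zeta>_def)
    also have "(\<Sum>i<N. L (\<lambda>j. \<alpha> i (int j)) t * trig_prod k (\<sigma> i) (\<omega> i) (log_tuple k t) * \<xi> i)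
        = (\<Sum>i<N. L (\<lambda>j. \<alpha> i (int j)) t * \<tau> i t * \<xi> i)"
      by (rule sum.cong) (use 1 in \<open>auto simp: \<psi> \<tau>_def\<close>)
    finally show ?case .
  qed
  \<comment> \<open>Eventually \<zeta> is the leading monomial times c + \<rho>, and the
    lexicographic order sends each summand of \<rho> to 0.\<close>
  define \<rho> where "\<rho> t = (\<Sum>i<N. L (\<lambda>j. \<alpha> i (int j) - ?A j) t * (\<tau> i t * \<xi> i))" for t
  have "(\<rho> \<longlongrightarrow> (\<Sum>i<N. 0)) at_top"
    unfolding \<rho>_def
  proof (rule tendsto_sum)
    fix i assume i: "i \<in> {..<N}"
    have lim: "(L (\<lambda>j. \<alpha> i (int j) - ?A j) \<longlongrightarrow> 0) at_top"
      unfolding L_def by (rule lex_less_powr_tendsto_0) (use 1 \<alpha>max i in auto)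
    have "\<forall>\<^sub>F t in at_top. norm (L (\<lambda>j. \<alpha> i (int j) - ?A j) t * (\<tau> i t * \<xi> i))
        \<le> L (\<lambda>j. \<alpha> i (int j) - ?A j) t * \<bar>\<xi> i\<bar>"
      using L_pos[of "\<lambda>j. \<alpha> i (int j) - ?A j"]
      by eventually_elim (use \<tau>[of i] in \<open>auto simp: abs_mult intro!: mult_left_mono mult_left_le_one_le\<close>)
    then show "((\<lambda>t. L (\<lambda>j. \<alpha> i (int j) - ?A j) t * (\<tau> i t * \<xi> i)) \<longlongrightarrow> 0) at_top"
      by (rule Lim_null_comparison) (rule tendsto_mult_left_zero[OF lim])
  qed
  then have "\<forall>\<^sub>F t in at_top. \<bar>\<rho> t\<bar> < c / 2"
    using c by (intro order_tendstoD(2)[OF tendsto_rabs_zero]) auto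
  then have bounds: "\<forall>\<^sub>F t in at_top. c / 2 * L ?A t \<le> \<zeta> t \<and> \<zeta> t \<le> 2 * c * L ?A t"
    using \<zeta>_eq ev_pos L_pos[of ?A]
  proof eventually_elim
    case (elim t)
    have "L (\<lambda>j. \<alpha> i (int j)) t = L ?A t * L (\<lambda>j. \<alpha> i (int j) - ?A j) t" for i
      unfolding L_def prod.distrib[symmetric]
      by (intro prod.cong) (auto simp flip: powr_add)
    then have "\<zeta> t = L ?A t * (c + \<rho> t)"
      using elim(2) by (simp add: \<rho>_def sum_distrib_left distrib_left mult_ac)
    moreover have "c / 2 \<le> c + \<rho> t" "c + \<rho> t \<le> 2 * c" using elim(1) c by linarith+
    ultimately show ?case
      using elim(4) by (metis less_imp_le mult.commute mult_left_mono)
  qed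
  have ls: "log_scale m \<zeta>"
  proof
    show "\<forall>\<^sub>F t in at_top. 0 < \<zeta> t"
      using bounds L_pos[of ?A]
    proof eventually_elim
      case (elim t)
      have "0 < c / 2 * L ?A t" using c elim by simp
      with elim show ?case by linarith
    qed
    fix \<epsilon> b :: real assume \<epsilon>: "\<epsilon> > 0"
    \<comment> \<open>For b \<ge> 0 the upper bound on \<zeta> is used, for b < 0 the lower
      one.\<close>
    define K where "K = max ((c / 2) powr b) ((2 * c) powr b)"
    have "log_bigo m (- \<epsilon>) (L (\<lambda>j. ?A j * b))" unfolding L_def by (rule log_bigo_log_prod[OF \<epsilon>])
    then show "log_bigo m (- \<epsilon>) (\<lambda>t. \<zeta> t powr b)"
    proof (rule log_bigo_le)
      show "\<forall>\<^sub>F t in at_top. norm (\<zeta> t powr b) \<le> K * norm (L (\<lambda>j. ?A j * b) t)"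
        using bounds L_pos[of ?A] L_pos[of "\<lambda>j. ?A j * b"]
      proof eventually_elim
        case (elim t)
        have Lb: "L (\<lambda>j. ?A j * b) t = L ?A t powr b"
          unfolding L_def by (subst prod_powr_distrib) (auto simp: powr_powr)
        have cL: "0 < c / 2 * L ?A t" using c elim by simp
        have "\<zeta> t powr b \<le> K * L ?A t powr b"
        proof (cases "b \<ge> 0")
          case True
          then have "\<zeta> t powr b \<le> (2 * c * L ?A t) powr b" using elim cL by (intro powr_mono2) auto
          also have "\<dots> = (2 * c) powr b * L ?A t powr b" using elim c by (simp add: powr_mult)
          also have "\<dots> \<le> K * L ?A t powr b" by (intro mult_right_mono) (auto simp: K_def)
          finally show ?thesis .
        next
          case False
          then have "\<zeta> t powr b \<le> (c / 2 * L ?A t) powr b" using elim cL by (intro powr_mono2') auto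
          also have "\<dots> = (c / 2) powr b * L ?A t powr b" using elim c by (subst powr_mult) auto
          also have "\<dots> \<le> K * L ?A t powr b" by (intro mult_right_mono) (auto simp: K_def)
          finally show ?thesis .
        qed
        then show ?case using elim by (simp add: Lb)
      qed
    qed (simp add: K_def le_max_iff_disj)
  qed
  interpret log_scale m \<zeta> by (rule ls)
  have L_amplitudes: "L \<beta> \<in> amplitudes m \<zeta>" for \<beta> unfolding L_def by (rule log_prod_amplitudes)
  have \<tau>_amplitudes: "\<tau> i \<in> amplitudes m \<zeta>" for i unfolding \<tau>_def by (intro amplitudes.const amplitudes_prod amplitudes_trig) auto
  have const: "(\<lambda>t. x) \<in> amplitudes m \<zeta>" for x using amplitudes.const[OF amplitudes.one, of x] by simp
  have L_slow: "slow (L \<beta>)" for \<beta> unfolding L_def by (rule slow_log_prod)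
  have \<tau>_slow: "slow (\<tau> i)" for i unfolding \<tau>_def
    by (intro slow_mult slow_const slow_prod graded_amplitudes_real const amplitudes_prod conjI slow_trig amplitudes_trig) auto
  have "slow (\<lambda>t. c * L ?A t + (\<Sum>i<N. L (\<lambda>j. \<alpha> i (int j)) t * \<tau> i t * \<xi> i))"
    by (intro slow_add slow_sum slow_mult slow_const L_slow \<tau>_slow graded_amplitudes_real const L_amplitudes \<tau>_amplitudes amplitudes_mult) auto
  then have "slow \<zeta>" using \<zeta>_eq by (rule slow_cong)
  then show ?thesis by unfold_locales
qed

subsection \<open>The asymptotic expansion\<close>

text \<open>The finite expansions in (H2) and (f2) are padded with zero terms.\<close>

definition extend_seq :: "(nat \<Rightarrow> real) \<Rightarrow> nat \<Rightarrow> nat \<Rightarrow> real" where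
  "extend_seq s K k = (if k \<le> K then s k else s K + real (k - K))"

lemma extend_seq_strict_mono:
  assumes "strict_mono_on {1..K} s" "K \<ge> 1"
  shows "strict_mono_on {1..} (extend_seq s K)"
proof (rule strict_mono_onI)
  fix x y :: nat assume xy: "x \<in> {1..}" "y \<in> {1..}" "x < y"
  have le: "s x \<le> s K" if "x \<le> K"
    using strict_mono_onD[OF assms(1), of x K] xy that assms(2) by (cases "x = K") auto
  show "extend_seq s K x < extend_seq s K y"
  proof (cases "y \<le> K")
    case True
    then show ?thesis using xy strict_mono_onD[OF assms(1), of x y] by (simp add: extend_seq_def)
  next
    case False
    then show ?thesis using xy le by (auto simp: extend_seq_def)
  qed
qed

lemma extend_seq_tendsto: "filterlim (extend_seq s K) at_top sequentially"
proof -
  have "filterlim (\<lambda>k. (s K - real K) + real k) at_top sequentially"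
    by (intro filterlim_tendsto_add_at_top[OF tendsto_const] filterlim_real_sequentially)
  moreover have "\<forall>\<^sub>F k in sequentially. (s K - real K) + real k = extend_seq s K k"
    using eventually_gt_at_top[of K] by eventually_elim (simp add: extend_seq_def of_nat_diff)
  note filterlim_cong[OF refl refl this]
  ultimately show ?thesis by simp
qed

lemma strict_mono_on_ge:
  fixes s :: "nat \<Rightarrow> real"
  assumes "strict_mono_on {1..} s" "1 \<le> i" "i \<le> k"
  shows "s i \<le> s k"
  using strict_mono_onD[OF assms(1), of i k] assms(2,3) by (cases "i = k") auto

lemma smooth_on_zero: "smooth_on S (\<lambda>x::'a::euclidean_space. 0::'b::real_normed_vector)"
proof -
  have "Ck_on k S (\<lambda>x::'a. 0::'b)" for k
    by (induction k) simp_all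
  then show ?thesis by (simp add: smooth_on_def)
qed

text \<open>The bound is wanted on a full ball: equal values at 0 cover the centre, and a radius of
  at most 1 allows the exponent to be lowered.\<close>

lemma bigo_at_0_bound:
  fixes F G :: "'a::euclidean_space \<Rightarrow> 'a"
  assumes "(\<lambda>x. norm (F x - G x)) \<in> O[at 0](\<lambda>x. norm x powr b)" "b' \<le> b" "F 0 = G 0"
  shows "\<exists>C r. r > 0 \<and> (\<forall>x. norm x < r \<longrightarrow> norm (F x - G x) \<le> C * norm x powr b')"
proof -
  obtain c where c: "c > 0" "\<forall>\<^sub>F x in at 0. norm (norm (F x - G x)) \<le> c * norm (norm x powr b)"
    using assms(1) by (rule landau_o.bigE)
  then obtain d where d: "d > 0"
    "\<And>x. x \<noteq> 0 \<Longrightarrow> dist x 0 < d \<Longrightarrow> norm (norm (F x - G x)) \<le> c * norm (norm x powr b)"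
    unfolding eventually_at by auto
  have "norm (F x - G x) \<le> c * norm x powr b'" if x: "norm x < min d 1" for x
  proof (cases "x = 0")
    case False
    have "norm (F x - G x) \<le> c * norm x powr b" using d(2)[OF False] x by simp
    also have "\<dots> \<le> c * norm x powr b'"
      using c(1) x assms(2) False by (intro mult_left_mono powr_mono') auto
    finally show ?thesis .
  qed (simp add: assms(3))
  then show ?thesis using d(1) by (intro exI[of _ c] exI[of _ "min d 1"]) auto
qed

text \<open>The zero function is homogeneous of every degree, which legitimates the padding. A
  remainder of order \<beta> N, without strict gain, suffices because N can be taken as large as
  needed.\<close>

lemma nonlin_expansion:
  fixes F :: "'a::euclidean_space \<Rightarrow> 'a"
  assumes "nonlin_H1 F \<or> nonlin_H2 F" "F 0 = 0"
  shows "\<exists>\<beta> Fk. (\<forall>k\<ge>1. \<beta> k > 1 \<and> \<beta> 1 \<le> \<beta> k \<and> Fk k \<in> pos_homogeneous (\<beta> k) \<and> smooth_on (- {0}) (Fk k)) \<and>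
    filterlim \<beta> at_top sequentially \<and>
    (\<forall>\<^sub>F N in sequentially. \<exists>C r. r > 0 \<and>
      (\<forall>x. norm x < r \<longrightarrow> norm (F x - (\<Sum>k=1..N. Fk k x)) \<le> C * norm x powr \<beta> N))"
  using assms(1)
proof
  assume "nonlin_H1 F"
  then obtain \<beta> Fk where b: "\<forall>k\<ge>1. \<beta> k > 1" "strict_mono_on {1..} \<beta>" "filterlim \<beta> at_top sequentially"
    and Fk: "\<forall>k\<ge>1. Fk k \<in> pos_homogeneous (\<beta> k) \<and> smooth_on (- {0}) (Fk k)"
    and rem: "\<forall>N\<ge>1. \<exists>b>\<beta> N. (\<lambda>x. norm (F x - (\<Sum>k=1..N. Fk k x))) \<in> O[at 0](\<lambda>x. norm x powr b)"
    unfolding nonlin_H1_def by (elim exE conjE) (rule that; assumption)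
  have Fk0: "Fk k 0 = 0" if "k \<ge> 1" for k
    using homogeneous_zero[of "Fk k" "\<beta> k"] b(1) Fk that by force
  have "\<exists>C r. r > 0 \<and> (\<forall>x. norm x < r \<longrightarrow> norm (F x - (\<Sum>k=1..N. Fk k x)) \<le> C * norm x powr \<beta> N)"
    if N: "N \<ge> 1" for N
  proof -
    obtain b where "b > \<beta> N" "(\<lambda>x. norm (F x - (\<Sum>k=1..N. Fk k x))) \<in> O[at 0](\<lambda>x. norm x powr b)"
      using rem N by blast
    then show ?thesis by (intro bigo_at_0_bound) (auto simp: assms(2) Fk0)
  qed
  then have "\<forall>\<^sub>F N in sequentially. \<exists>C r. r > 0 \<and>
      (\<forall>x. norm x < r \<longrightarrow> norm (F x - (\<Sum>k=1..N. Fk k x)) \<le> C * norm x powr \<beta> N)"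
    unfolding eventually_sequentially by blast
  with b Fk show ?thesis by (intro exI[of _ \<beta>] exI[of _ Fk]) (auto intro: strict_mono_on_ge)
next
  assume "nonlin_H2 F"
  then obtain K :: nat and \<beta> Fk where K: "K \<ge> 1" and b: "\<forall>k\<in>{1..K}. \<beta> k > 1" "strict_mono_on {1..K} \<beta>"
    and Fk: "\<forall>k\<in>{1..K}. Fk k \<in> pos_homogeneous (\<beta> k) \<and> smooth_on (- {0}) (Fk k)"
    and rem: "\<forall>b>\<beta> K. (\<lambda>x. norm (F x - (\<Sum>k=1..K. Fk k x))) \<in> O[at 0](\<lambda>x. norm x powr b)"
    unfolding nonlin_H2_def by (elim exE conjE) (rule that; assumption)
  define \<beta>' where "\<beta>' = extend_seq \<beta> K"
  define Fk' where "Fk' k = (if k \<le> K then Fk k else (\<lambda>x. 0))" for k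
  have sm: "strict_mono_on {1..} \<beta>'" unfolding \<beta>'_def by (rule extend_seq_strict_mono[OF b(2) K])
  have b1: "\<beta>' k > 1" if "k \<ge> 1" for k
  proof -
    have "\<beta>' 1 > 1" using b(1) K by (simp add: \<beta>'_def extend_seq_def)
    then show ?thesis using strict_mono_on_ge[OF sm _ that] by force
  qed
  have Fk': "Fk' k \<in> pos_homogeneous (\<beta>' k) \<and> smooth_on (- {0}) (Fk' k)" if "k \<ge> 1" for k
    using Fk that by (auto simp: Fk'_def \<beta>'_def extend_seq_def smooth_on_zero pos_homogeneous_def)
  have Fk0: "Fk k 0 = 0" if "k \<in> {1..K}" for k
    using homogeneous_zero[of "Fk k" "\<beta> k"] b(1) Fk that by force
  have "\<exists>C r. r > 0 \<and> (\<forall>x. norm x < r \<longrightarrow> norm (F x - (\<Sum>k=1..N. Fk' k x)) \<le> C * norm x powr \<beta>' N)"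
    if N: "N > K" for N
  proof -
    have eq: "(\<Sum>k=1..N. Fk' k x) = (\<Sum>k=1..K. Fk k x)" for x
      by (rule sum.mono_neutral_cong_right) (use N in \<open>auto simp: Fk'_def\<close>)
    have "\<beta>' N > \<beta> K" using N by (simp add: \<beta>'_def extend_seq_def)
    then have "(\<lambda>x. norm (F x - (\<Sum>k=1..K. Fk k x))) \<in> O[at 0](\<lambda>x. norm x powr \<beta>' N)" using rem by blast
    then show ?thesis unfolding eq by (rule bigo_at_0_bound) (auto simp: assms(2) Fk0)
  qed
  then have "\<forall>\<^sub>F N in sequentially. \<exists>C r. r > 0 \<and>
      (\<forall>x. norm x < r \<longrightarrow> norm (F x - (\<Sum>k=1..N. Fk' k x)) \<le> C * norm x powr \<beta>' N)"
    by (rule eventually_mono[OF eventually_gt_at_top[of K]])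
  moreover have "filterlim \<beta>' at_top sequentially" unfolding \<beta>'_def by (rule extend_seq_tendsto)
  ultimately show ?thesis using b1 Fk' sm
    by (intro exI[of _ \<beta>'] exI[of _ Fk']) (auto intro: strict_mono_on_ge)
qed

lemma remainder_bound_log_bigo:
  assumes "remainder_bound m u v \<gamma> N a" "b \<le> a"
  shows "log_bigo m b (\<lambda>t. u t - (\<Sum>k=1..N. Lg m t powr (- \<gamma> k) *\<^sub>R v k t))"
proof -
  obtain c where "\<forall>\<^sub>F t in at_top. norm (norm (u t - (\<Sum>k=1..N. Lg m t powr (- \<gamma> k) *\<^sub>R v k t)))
      \<le> c * norm (Lg m t powr (- a))"
    using assms(1) unfolding remainder_bound_def iter_log_int by (rule landau_o.bigE)
  then have "log_bigo m a (\<lambda>t. u t - (\<Sum>k=1..N. Lg m t powr (- \<gamma> k) *\<^sub>R v k t))"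
    by (intro log_bigo_I[of _ c]) simp
  then show ?thesis using assms(2) by (rule log_bigo_mono)
qed

text \<open>The gap between the first two exponents enters the step \<delta> of the iteration; for a
  single term the padding makes it 1.\<close>

lemma forcing_expansion:
  assumes "(forcing_f1 m f \<gamma> nt g \<and> n1 = nt 1) \<or> (forcing_f2 m f K \<gamma> nstar g \<and> n1 = nstar)"
  shows "m \<le> n1 \<and> (\<exists>\<gamma>' fk. \<gamma>' 1 > 0 \<and> (\<exists>\<delta>>0. \<forall>k\<ge>2. \<gamma>' 1 + \<delta> \<le> \<gamma>' k) \<and>
    filterlim \<gamma>' at_top sequentially \<and> (\<forall>k\<ge>1. fk k \<in> graded m \<zeta> (\<gamma>' k)) \<and>
    fk 1 = (\<lambda>t. Lg m t powr (- \<gamma>' 1) *\<^sub>R g 1 (log_tuple n1 t)) \<and>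
    (\<forall>\<^sub>F N in sequentially. log_bigo m (\<gamma>' N) (\<lambda>t. f t - (\<Sum>k=1..N. fk k t))))"
  using assms
proof
  assume f1: "forcing_f1 m f \<gamma> nt g \<and> n1 = nt 1"
  then have \<gamma>: "\<forall>k\<ge>1. \<gamma> k > 0" "strict_mono_on {1..} \<gamma>" "filterlim \<gamma> at_top sequentially"
    and nt: "\<forall>k\<ge>1. nt k \<ge> 1 \<and> nt k \<ge> m \<and> g k \<in> P1 m (nt k)" and n1: "n1 = nt 1"
    and ex: "asymp_expansion m f (\<lambda>k t. g k (log_tuple (nt k) t)) \<gamma>"
    unfolding forcing_f1_def by auto
  define fk where "fk k t = Lg m t powr (- \<gamma> k) *\<^sub>R g k (log_tuple (nt k) t)" for k t
  have "fk k \<in> graded m \<zeta> (\<gamma> k)" if "k \<ge> 1" for k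
    unfolding fk_def by (rule P1_in_graded) (use nt that in auto)
  moreover have "\<gamma> 1 + (\<gamma> 2 - \<gamma> 1) \<le> \<gamma> k" if "k \<ge> 2" for k
    using strict_mono_on_ge[OF \<gamma>(2), of 2 k] that by simp
  moreover have "\<gamma> 2 - \<gamma> 1 > 0" using strict_mono_onD[OF \<gamma>(2), of 1 2] by simp
  moreover have "log_bigo m (\<gamma> N) (\<lambda>t. f t - (\<Sum>k=1..N. fk k t))" if N: "N \<ge> 1" for N
  proof -
    obtain a where "a > \<gamma> N" "remainder_bound m f (\<lambda>k t. g k (log_tuple (nt k) t)) \<gamma> N a"
      using ex N unfolding asymp_expansion_def by blast
    then show ?thesis unfolding fk_def by (intro remainder_bound_log_bigo) auto
  qed
  then have "\<forall>\<^sub>F N in sequentially. log_bigo m (\<gamma> N) (\<lambda>t. f t - (\<Sum>k=1..N. fk k t))"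
    unfolding eventually_sequentially by blast
  moreover have "fk 1 = (\<lambda>t. Lg m t powr (- \<gamma> 1) *\<^sub>R g 1 (log_tuple n1 t))"
    by (simp add: fk_def[abs_def] n1)
  ultimately show ?thesis using \<gamma> nt n1
    by (intro conjI exI[of _ \<gamma>] exI[of _ fk] exI[of _ "\<gamma> 2 - \<gamma> 1"]) auto
next
  assume f2: "forcing_f2 m f K \<gamma> nstar g \<and> n1 = nstar"
  then have K: "K \<ge> 1" and \<gamma>: "\<forall>k\<in>{1..K}. \<gamma> k > 0" "strict_mono_on {1..K} \<gamma>"
    and nt: "m \<le> n1" "\<forall>k\<in>{1..K}. g k \<in> P1 m n1"
    and ex: "\<forall>a>\<gamma> K. remainder_bound m f (\<lambda>k t. g k (log_tuple n1 t)) \<gamma> K a"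
    unfolding forcing_f2_def by auto
  define \<gamma>' where "\<gamma>' = extend_seq \<gamma> K"
  define fk where "fk k t = (if k \<le> K then Lg m t powr (- \<gamma> k) *\<^sub>R g k (log_tuple n1 t) else 0)" for k t
  have sm: "strict_mono_on {1..} \<gamma>'" unfolding \<gamma>'_def by (rule extend_seq_strict_mono[OF \<gamma>(2) K])
  have "fk k \<in> graded m \<zeta> (\<gamma>' k)" if "k \<ge> 1" for k
  proof (cases "k \<le> K")
    case True
    then have "fk k = (\<lambda>t. Lg m t powr (- \<gamma>' k) *\<^sub>R g k (log_tuple n1 t))"
      by (simp add: fk_def[abs_def] \<gamma>'_def extend_seq_def)
    then show ?thesis using P1_in_graded[of "g k" m n1 "\<gamma>' k" \<zeta>] nt True that by simp
  qed (simp add: fk_def[abs_def] graded_zero)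
  moreover have "\<gamma>' 1 + (\<gamma>' 2 - \<gamma>' 1) \<le> \<gamma>' k" if "k \<ge> 2" for k
    using strict_mono_on_ge[OF sm, of 2 k] that by simp
  moreover have "\<gamma>' 2 - \<gamma>' 1 > 0" using strict_mono_onD[OF sm, of 1 2] by simp
  moreover have "log_bigo m (\<gamma>' N) (\<lambda>t. f t - (\<Sum>k=1..N. fk k t))" if N: "N > K" for N
  proof -
    have eq: "(\<Sum>k=1..N. fk k t) = (\<Sum>k=1..K. Lg m t powr (- \<gamma> k) *\<^sub>R g k (log_tuple n1 t))" for t
      by (rule sum.mono_neutral_cong_right) (use N in \<open>auto simp: fk_def\<close>)
    have "\<gamma>' N > \<gamma> K" using N by (simp add: \<gamma>'_def extend_seq_def)
    then have "remainder_bound m f (\<lambda>k t. g k (log_tuple n1 t)) \<gamma> K (\<gamma>' N)" using ex by blast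
    then show ?thesis unfolding eq by (rule remainder_bound_log_bigo) simp
  qed
  then have "\<forall>\<^sub>F N in sequentially. log_bigo m (\<gamma>' N) (\<lambda>t. f t - (\<Sum>k=1..N. fk k t))"
    by (rule eventually_mono[OF eventually_gt_at_top[of K]])
  moreover have "fk 1 = (\<lambda>t. Lg m t powr (- \<gamma>' 1) *\<^sub>R g 1 (log_tuple n1 t))"
    using K by (simp add: fk_def[abs_def] \<gamma>'_def extend_seq_def)
  moreover have "\<gamma>' 1 > 0" using \<gamma>(1) K by (simp add: \<gamma>'_def extend_seq_def)
  moreover have "filterlim \<gamma>' at_top sequentially" unfolding \<gamma>'_def by (rule extend_seq_tendsto)
  ultimately show ?thesis using nt(1)
    by (intro conjI exI[of _ \<gamma>'] exI[of _ fk] exI[of _ "\<gamma>' 2 - \<gamma>' 1"]) auto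
qed

text \<open>The derivative in \<open>C1_on_atLeast\<close> is one-sided at T0 only; every t > T0 is
  an interior point.\<close>

lemma solves_systemD:
  assumes "solves_system A F f T0 y"
  shows "\<forall>\<^sub>F t in at_top. (y has_vector_derivative vector_derivative y (at t)) (at t)"
    and "\<forall>\<^sub>F t in at_top. vector_derivative y (at t) + A *v y t = F (y t) + f t"
proof -
  obtain y' where y': "\<And>t. t \<ge> T0 \<Longrightarrow> (y has_vector_derivative y' t) (at t within {T0..})"
    using assms unfolding solves_system_def C1_on_atLeast_def by blast
  show "\<forall>\<^sub>F t in at_top. (y has_vector_derivative vector_derivative y (at t)) (at t)"
    using eventually_gt_at_top[of T0]
  proof eventually_elim
    case (elim t)
    then have "at t within {T0..} = at t" by (intro at_within_interior) (simp add: interior_real_atLeast)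
    with y'[of t] elim have "(y has_vector_derivative y' t) (at t)" by simp
    then show ?case by (simp add: vector_derivative_at)
  qed
  show "\<forall>\<^sub>F t in at_top. vector_derivative y (at t) + A *v y t = F (y t) + f t"
    by (rule eventually_mono[OF eventually_gt_at_top[of T0]]) (use assms in \<open>simp add: solves_system_def\<close>)
qed

theorem theorem6p4:
  fixes A :: "real^'n^'n"
    and F :: "real^'n \<Rightarrow> real^'n"
    and f :: "real \<Rightarrow> real^'n"
    and T :: real
    and mstar K nstar n1 :: nat
    and \<gamma> :: "nat \<Rightarrow> real"
    and nt :: "nat \<Rightarrow> nat"
    and g :: "nat \<Rightarrow> (int \<Rightarrow> real) \<Rightarrow> real^'n"
    and g0 :: "(int \<Rightarrow> real) \<Rightarrow> real"
    and \<xi>0 :: "real^'n"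
  assumes "\<And>l. complex_eigenvalue A l \<Longrightarrow> Re l > 0"
    and "locally_lipschitz F" and "F 0 = 0"
    and "nonlin_H1 F \<or> nonlin_H2 F"
    and "T \<ge> 0" and "continuous_on {T..} f"
    and "(forcing_f1 mstar f \<gamma> nt g \<and> n1 = nt 1) \<or>
         (forcing_f2 mstar f K \<gamma> nstar g \<and> n1 = nstar)"
    and "g0 \<in> Pplus mstar n1" and "\<xi>0 \<noteq> 0"
    and "\<And>z. z \<in> pos_tuples n1 \<Longrightarrow> g 1 z = g0 z *\<^sub>R \<xi>0"
  shows "\<exists>(\<mu>::nat \<Rightarrow> real) (n::nat \<Rightarrow> nat) (\<zeta>::(int \<Rightarrow> real) \<Rightarrow> real)
            (h::nat \<Rightarrow> (int \<Rightarrow> real) \<Rightarrow> real \<Rightarrow> real^'n).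
           (\<forall>k\<ge>1. \<mu> k > 0) \<and> strict_mono_on {1..} \<mu> \<and> filterlim \<mu> at_top sequentially \<and>
           mono n \<and> (\<forall>k. n k \<ge> mstar) \<and>
           \<zeta> \<in> Pplus mstar (n 0) \<and>
           (\<forall>k\<ge>1. h k \<in> P1hat mstar (n k)) \<and>
           (\<forall>T0 y. T0 > 0 \<and> T0 \<ge> T \<and> solves_system A F f T0 y \<and> (y \<longlongrightarrow> 0) at_top \<longrightarrow>
              asymp_expansion mstar y
                (\<lambda>k t. h k (log_tuple (n k) t) (\<zeta> (log_tuple (n 0) t))) \<mu>)"
proof -
  define z where "z t = g0 (log_tuple n1 t)" for t
  interpret slow_log_scale mstar z
    unfolding z_def[abs_def] by (rule Pplus_slow_log_scale[OF assms(8)])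
  obtain B \<kappa> where B: "\<kappa> > 0" "bounded_bilinear B" "\<forall>x y. B x y = B y x"
    "\<forall>x. (norm x)\<^sup>2 \<le> B x x \<and> \<kappa> * B x x \<le> (B x (A *v x) :: real)"
    using lyapunov_form[OF assms(1)] by blast
  interpret lyapunov "(*v) A" B \<kappa>
    by (rule lyapunov.intro) (use B matrix_vector_mul_bounded_linear in auto)
  \<comment> \<open>Frequency 0 in the coefficient system makes A surjective.\<close>
  obtain x0 where x0: "A *v x0 = \<xi>0" using A_cos_sin_solvable[of 0 \<xi>0] by auto
  with assms(9) have x0_nz: "x0 \<noteq> 0" by auto
  obtain \<beta> Fk where \<beta>: "\<And>k. k \<ge> 1 \<Longrightarrow> \<beta> k > 1" "\<And>k. k \<ge> 1 \<Longrightarrow> \<beta> 1 \<le> \<beta> k" "filterlim \<beta> at_top sequentially"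
    and Fk: "\<And>k. k \<ge> 1 \<Longrightarrow> Fk k \<in> pos_homogeneous (\<beta> k)" "\<And>k. k \<ge> 1 \<Longrightarrow> smooth_on (- {0}) (Fk k)"
    and F: "\<forall>\<^sub>F N in sequentially. \<exists>C r. r > 0 \<and>
      (\<forall>x. norm x < r \<longrightarrow> norm (F x - (\<Sum>k=1..N. Fk k x)) \<le> C * norm x powr \<beta> N)"
    using nonlin_expansion[OF assms(4,3)] by blast
  obtain \<gamma>' fk \<delta>0 where n1: "mstar \<le> n1" and \<gamma>: "\<gamma>' 1 > 0" "\<And>k. k \<ge> 2 \<Longrightarrow> \<gamma>' 1 + \<delta>0 \<le> \<gamma>' k"
      "filterlim \<gamma>' at_top sequentially" and \<delta>0: "\<delta>0 > 0"
    and fk: "\<And>k. k \<ge> 1 \<Longrightarrow> fk k \<in> graded mstar z (\<gamma>' k)"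
      "fk 1 = (\<lambda>t. Lg mstar t powr (- \<gamma>' 1) *\<^sub>R g 1 (log_tuple n1 t))"
    and f: "\<forall>\<^sub>F N in sequentially. log_bigo mstar (\<gamma>' N) (\<lambda>t. f t - (\<Sum>k=1..N. fk k t))"
    using forcing_expansion[OF assms(7), of z] by blast
  define \<delta> where "\<delta> = min 1 (min (\<gamma>' 1 * (\<beta> 1 - 1)) \<delta>0)"
  have \<delta>: "\<delta> > 0" using \<gamma>(1) \<delta>0 \<beta>(1)[of 1] by (simp add: \<delta>_def)
  interpret newton mstar z "(*v) A" B \<kappa> F Fk \<beta> f fk \<gamma>' x0 \<delta>
  proof unfold_locales
    show "\<forall>\<^sub>F t in at_top. fk 1 t = (Lg mstar t powr (- \<gamma>' 1) * z t) *\<^sub>R (A *v x0)"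
      using log_tuple_in_pos_tuples[of n1]
      by eventually_elim (simp only: fk(2) assms(10) z_def x0 scaleR_scaleR)
    show "\<delta> \<le> \<gamma>' 1 * (\<beta> k - 1)" if "k \<ge> 1" for k
    proof -
      have "\<delta> \<le> \<gamma>' 1 * (\<beta> 1 - 1)" by (simp add: \<delta>_def)
      also have "\<dots> \<le> \<gamma>' 1 * (\<beta> k - 1)" using \<beta>(2)[OF that] \<gamma>(1) by (intro mult_left_mono) auto
      finally show ?thesis .
    qed
    show "\<gamma>' 1 + \<delta> \<le> \<gamma>' k" if "k \<ge> 2" for k
      using \<gamma>(2)[OF that] by (simp add: \<delta>_def min_def split: if_splits)
    show "\<delta> \<le> 1" by (simp add: \<delta>_def)
  qed (use assms(3) Fk \<beta> F fk(1) \<gamma> f x0_nz \<delta> in auto)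
  obtain W where W: "\<And>j. W j \<in> graded mstar z (\<gamma>' 1 + real j * \<delta>)"
    and sol: "\<And>y y' a j. (\<forall>\<^sub>F t in at_top. (y has_vector_derivative y' t) (at t)) \<Longrightarrow>
        (\<forall>\<^sub>F t in at_top. y' t + A *v (y t) = F (y t) + f t) \<Longrightarrow> (y \<longlongrightarrow> 0) at_top \<Longrightarrow>
        a < \<gamma>' 1 + real j * \<delta> \<Longrightarrow> log_bigo mstar a (\<lambda>t. y t - (\<Sum>i<j. W i t))"
    using expansion_sequence by blast
  have lim: "filterlim (\<lambda>j. \<gamma>' 1 + real j * \<delta>) at_top sequentially"
    by (intro filterlim_tendsto_add_at_top[OF tendsto_const]
        filterlim_at_top_mult_tendsto_pos[OF tendsto_const \<delta>(1)] filterlim_real_sequentially)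
  have "\<gamma>' 1 + real j * \<delta> > 0" for j using \<gamma>(1) \<delta>(1) by (simp add: add_pos_nonneg)
  \<comment> \<open>Starting \<open>n\<close> at \<open>n1\<close> lets \<zeta> be \<open>g0\<close>
    itself, evaluated on the tuple of index 0.\<close>
  from regroup_expansion[OF W this lim, of n1]
  obtain \<mu> n h where \<mu>: "\<forall>k\<ge>1. \<mu> k > 0" "strict_mono_on {1..} \<mu>" "filterlim \<mu> at_top sequentially"
    and n: "mono n" "n 0 = n1" and h: "\<forall>k\<ge>1. h k \<in> P1hat mstar (n k)"
    and ex: "\<forall>y. (\<forall>a. \<forall>\<^sub>F j in sequentially. log_bigo mstar a (\<lambda>t. y t - (\<Sum>i<j. W i t))) \<longrightarrow>
       asymp_expansion mstar y (\<lambda>k t. h k (log_tuple (n k) t) (z t)) \<mu>"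
    by (elim exE conjE) (rule that; assumption)
  have "asymp_expansion mstar y (\<lambda>k t. h k (log_tuple (n k) t) (g0 (log_tuple (n 0) t))) \<mu>"
    if y: "solves_system A F f T0 y" "(y \<longlongrightarrow> 0) at_top" for T0 y
  proof -
    have "\<forall>\<^sub>F j in sequentially. log_bigo mstar a (\<lambda>t. y t - (\<Sum>i<j. W i t))" for a
    proof -
      have "\<forall>\<^sub>F j in sequentially. a < \<gamma>' 1 + real j * \<delta>"
        using lim unfolding filterlim_at_top_dense by blast
      then show ?thesis
        by eventually_elim (rule sol[OF solves_systemD[OF y(1)] y(2)])
    qed
    with ex have "asymp_expansion mstar y (\<lambda>k t. h k (log_tuple (n k) t) (z t)) \<mu>" by blast
    then show ?thesis unfolding z_def n(2) .
  qed
  moreover have "mstar \<le> n k" for k using monoD[OF n(1), of 0 k] n(2) n1 by simp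
  moreover have "g0 \<in> Pplus mstar (n 0)" using assms(8) n(2) by simp
  ultimately show ?thesis using \<mu> n(1) h
    by (intro exI[of _ \<mu>] exI[of _ n] exI[of _ g0] exI[of _ h]) blast
qed

end
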